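(* Let $m,\beta$ be positive integers and let $\varphi$ be a linear fractional self-map of $\mathbb{B}^m$. If $\varphi$ is elliptic, then the spectral radius of the composition operator $C_\varphi$ acting on $H^2_{m,\beta}$ is $1$. If $\varphi$ is non-elliptic with dilatation coefficient $\alpha$, then the spectral radius of $C_\varphi$ acting on $H^2_{m,\beta}$ is $\alpha^{-\beta/2}$.
   Context: $\mathbb{B}^m$ denotes the open unit ball of $\mathbb{C}^m$, $\langle\cdot,\cdot\rangle$ the standard Hermitian inner product on $\mathbb{C}^m$ (linear in the first argument), and $|z|=\sqrt{\langle z,z\rangle}$. A linear fractional self-map of $\mathbb{B}^m$ is a map $\varphi:\mathbb{B}^m\to\mathbb{B}^m$ of the form $\varphi(z)=\dfrac{Az+B}{\langle z,C\rangle+D}$, where $A$ is an $m\times m$ complex matrix, $B,C\in\mathbb{C}^m$ are column vectors and $D\in\mathbb{C}$ (with denominator nonvanishing on $\mathbb{B}^m$). $H^2_{m,\beta}$ is the Hilbert space of holomorphic functions on $\mathbb{B}^m$ with reproducing kernel $k_\beta(z,w)=(1-\langle z,w\rangle)^{-\beta}$. The composition operator is $C_\varphi f=f\circ\varphi$; for linear fractional self-maps of $\mathbb{B}^m$ it is bounded on $H^2_{m,\beta}$. A holomorphic self-map $\varphi$ of $\mathbb{B}^m$ is called elliptic if it fixes a point of $\mathbb{B}^m$. If $\varphi$ is not elliptic, there is a unique point $\zeta\in\partial\mathbb{B}^m$ (the Denjoy-Wolff point of $\varphi$) such that the iterates of $\varphi$ converge to $\zeta$ uniformly on compact subsets of $\mathbb{B}^m$;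 the dilatation coefficient of $\varphi$ is $$\alpha=\liminf_{z\to\zeta}\frac{1-|\varphi(z)|^2}{1-|z|^2},$$ and it satisfies $0<\alpha\le 1$. *)

theory Defs
  imports "HOL-Analysis.Analysis"
begin

definition hinner :: "complex^'m \<Rightarrow> complex^'m \<Rightarrow> complex" where
  "hinner z w = (\<Sum>i\<in>UNIV. z $ i * cnj (w $ i))"

text \<open>Holomorphy in several variables: real Frechet differentiability with a
  complex-linear derivative.\<close>

definition holomorphic_several_on :: "(complex^'m \<Rightarrow> complex) \<Rightarrow> (complex^'m) set \<Rightarrow> bool" where
  "holomorphic_several_on f S \<longleftrightarrow>
     (\<forall>z\<in>S. \<exists>L. (f has_derivative L) (at z) \<and> (\<forall>c v. L (c *s v) = c * L v))"

definition linear_fractional_self_map :: "(complex^'m \<Rightarrow> complex^'m) \<Rightarrow> bool" where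
  "linear_fractional_self_map \<phi> \<longleftrightarrow>
     \<phi> ` ball 0 1 \<subseteq> ball 0 1 \<and>
     (\<exists>(A :: complex^'m^'m) B C D. \<forall>z\<in>ball 0 1.
        hinner z C + D \<noteq> 0 \<and> \<phi> z = inverse (hinner z C + D) *s (A *v z + B))"

definition elliptic :: "(complex^'m \<Rightarrow> complex^'m) \<Rightarrow> bool" where
  "elliptic \<phi> \<longleftrightarrow> (\<exists>z\<in>ball 0 1. \<phi> z = z)"

definition denjoy_wolff_point :: "(complex^'m \<Rightarrow> complex^'m) \<Rightarrow> complex^'m \<Rightarrow> bool" where
  "denjoy_wolff_point \<phi> \<zeta> \<longleftrightarrow>
     \<zeta> \<in> sphere 0 1 \<and>
     (\<forall>K. compact K \<and> K \<subseteq> ball 0 1 \<longrightarrow>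
        uniform_limit K (\<lambda>n. \<phi> ^^ n) (\<lambda>_. \<zeta>) sequentially)"

definition dilatation_coefficient :: "(complex^'m \<Rightarrow> complex^'m) \<Rightarrow> real \<Rightarrow> bool" where
  "dilatation_coefficient \<phi> \<alpha> \<longleftrightarrow>
     (\<exists>\<zeta>. denjoy_wolff_point \<phi> \<zeta> \<and>
        ereal \<alpha> = Liminf (at \<zeta> within ball 0 1)
                    (\<lambda>z. ereal ((1 - (norm (\<phi> z))\<^sup>2) / (1 - (norm z)\<^sup>2))))"

text \<open>Complex Hilbert spaces of functions, given by a carrier \<open>H\<close> and an inner product
  \<open>ip\<close> that is only meaningful on \<open>H\<close>.\<close>

definition ip_norm :: "(('a \<Rightarrow> complex) \<Rightarrow> ('a \<Rightarrow> complex) \<Rightarrow> complex) \<Rightarrow> ('a \<Rightarrow> complex) \<Rightarrow> real" where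
  "ip_norm ip f = sqrt (Re (ip f f))"

locale hilbert_function_space =
  fixes H :: "('a \<Rightarrow> complex) set"
    and ip :: "('a \<Rightarrow> complex) \<Rightarrow> ('a \<Rightarrow> complex) \<Rightarrow> complex"
  assumes zero_mem: "(\<lambda>_. 0) \<in> H"
    and add_mem: "\<lbrakk>f \<in> H; g \<in> H\<rbrakk> \<Longrightarrow> (\<lambda>x. f x + g x) \<in> H"
    and scale_mem: "f \<in> H \<Longrightarrow> (\<lambda>x. c * f x) \<in> H"
    and ip_add_left: "\<lbrakk>f \<in> H; g \<in> H; h \<in> H\<rbrakk> \<Longrightarrow> ip (\<lambda>x. f x + g x) h = ip f h + ip g h"
    and ip_scale_left: "\<lbrakk>f \<in> H; g \<in> H\<rbrakk> \<Longrightarrow> ip (\<lambda>x. c * f x) g = c * ip f g"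
    and ip_commute: "\<lbrakk>f \<in> H; g \<in> H\<rbrakk> \<Longrightarrow> ip g f = cnj (ip f g)"
    and ip_nonneg: "f \<in> H \<Longrightarrow> 0 \<le> Re (ip f f)"
    and ip_definite: "\<lbrakk>f \<in> H; ip f f = 0\<rbrakk> \<Longrightarrow> f = (\<lambda>_. 0)"
    and complete:
      "\<lbrakk>\<And>n::nat. F n \<in> H;
        \<And>e. e > 0 \<Longrightarrow> \<exists>N. \<forall>m\<ge>N. \<forall>n\<ge>N. ip_norm ip (\<lambda>x. F m x - F n x) < e\<rbrakk>
       \<Longrightarrow> \<exists>f\<in>H. (\<lambda>n. ip_norm ip (\<lambda>x. F n x - f x)) \<longlonglongrightarrow> 0"

definition bounded_operator_on ::
  "('a \<Rightarrow> complex) set \<Rightarrow> (('a \<Rightarrow> complex) \<Rightarrow> ('a \<Rightarrow> complex) \<Rightarrow> complex) \<Rightarrow>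
   (('a \<Rightarrow> complex) \<Rightarrow> ('a \<Rightarrow> complex)) \<Rightarrow> bool" where
  "bounded_operator_on H ip T \<longleftrightarrow>
     T ` H \<subseteq> H \<and>
     (\<forall>f\<in>H. \<forall>g\<in>H. T (\<lambda>x. f x + g x) = (\<lambda>x. T f x + T g x)) \<and>
     (\<forall>c. \<forall>f\<in>H. T (\<lambda>x. c * f x) = (\<lambda>x. c * T f x)) \<and>
     (\<exists>K. \<forall>f\<in>H. ip_norm ip (T f) \<le> K * ip_norm ip f)"

definition operator_spectrum ::
  "('a \<Rightarrow> complex) set \<Rightarrow> (('a \<Rightarrow> complex) \<Rightarrow> ('a \<Rightarrow> complex) \<Rightarrow> complex) \<Rightarrow>
   (('a \<Rightarrow> complex) \<Rightarrow> ('a \<Rightarrow> complex)) \<Rightarrow> complex set" where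
  "operator_spectrum H ip T =
     {\<mu>. \<not> (\<exists>S. bounded_operator_on H ip S \<and>
             (\<forall>f\<in>H. S (\<lambda>x. T f x - \<mu> * f x) = f \<and>
                    (\<lambda>x. T (S f) x - \<mu> * S f x) = f))}"

text \<open>Taking the supremum in the extended reals avoids the unspecified value of \<open>Sup\<close> on
  empty or unbounded sets of reals.\<close>

definition operator_spectral_radius ::
  "('a \<Rightarrow> complex) set \<Rightarrow> (('a \<Rightarrow> complex) \<Rightarrow> ('a \<Rightarrow> complex) \<Rightarrow> complex) \<Rightarrow>
   (('a \<Rightarrow> complex) \<Rightarrow> ('a \<Rightarrow> complex)) \<Rightarrow> ereal" where
  "operator_spectral_radius H ip T = (SUP \<mu>\<in>operator_spectrum H ip T. ereal (cmod \<mu>))"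

text \<open>A function on the unit ball is represented by the total function that vanishes off the
  ball, so that equality of representatives is equality on the ball.\<close>

definition on_ball :: "(complex^'m \<Rightarrow> complex) \<Rightarrow> complex^'m \<Rightarrow> complex" where
  "on_ball f = (\<lambda>z. if z \<in> ball 0 1 then f z else 0)"

definition ball_kernel :: "nat \<Rightarrow> complex^'m \<Rightarrow> complex^'m \<Rightarrow> complex" where
  "ball_kernel \<beta> z w = inverse ((1 - hinner z w) ^ \<beta>)"

text \<open>The pair \<open>(H, ip)\<close> is the Hilbert space of holomorphic functions on the unit ball with
  reproducing kernel \<open>ball_kernel \<beta>\<close>; a space with a given reproducing kernel is unique
  (on \<open>H\<close>) by the Moore-Aronszajn theorem.\<close>

definition H2_space ::
  "nat \<Rightarrow> (complex^'m \<Rightarrow> complex) set \<Rightarrow>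
   ((complex^'m \<Rightarrow> complex) \<Rightarrow> (complex^'m \<Rightarrow> complex) \<Rightarrow> complex) \<Rightarrow> bool" where
  "H2_space \<beta> H ip \<longleftrightarrow>
     hilbert_function_space H ip \<and>
     (\<forall>f\<in>H. holomorphic_several_on f (ball 0 1) \<and> (\<forall>z. z \<notin> ball 0 1 \<longrightarrow> f z = 0)) \<and>
     (\<forall>w\<in>ball 0 1. on_ball (\<lambda>z. ball_kernel \<beta> z w) \<in> H \<and>
        (\<forall>f\<in>H. ip f (on_ball (\<lambda>z. ball_kernel \<beta> z w)) = f w))"

definition composition_operator ::
  "(complex^'m \<Rightarrow> complex^'m) \<Rightarrow> (complex^'m \<Rightarrow> complex) \<Rightarrow> (complex^'m \<Rightarrow> complex)" where
  "composition_operator \<phi> f = on_ball (f \<circ> \<phi>)"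

end

theory Submission
  imports Defs "HOL-Complex_Analysis.Complex_Analysis"
begin

text \<open>
The spectral radius is governed by the growth of the powers of \<open>C_\<phi>\<close>, and the norms of these
  powers are read off from inequalities between positive kernels. Let
  \<open>k(z, w) = 1 / (1 - \<langle>z, w\<rangle>)\<close> be the Drury-Arveson kernel, so that the space has kernel \<open>k\<^sup>\<beta>\<close>.
  If \<open>M k - k \<circ> \<psi>\<close> is positive, then so is \<open>M\<^sup>\<beta> k\<^sup>\<beta> - (k \<circ> \<psi>)\<^sup>\<beta>\<close>, and this says precisely that the
  norm of \<open>C_\<psi>\<close> is at most \<open>M\<close> to the power \<open>\<beta>/2\<close>
  (\<open>composition_bound_of_drury_arveson_bound\<close>). So it is enough to compare \<open>k \<circ> \<phi>\<^sup>n\<close> with \<open>k\<close>.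

  The comparison comes from the indefinite geometry of \<open>\<phi>\<close>. Write \<open>d\<close> for the denominator of \<open>\<phi>\<close>
  and lift \<open>\<phi>\<close> to a linear map of the space of pairs \<open>(z, u)\<close>. That \<open>\<phi>\<close> maps the ball to itself says
  that the pullback of the Lorentz form \<open>|u|\<^sup>2 - |z|\<^sup>2\<close> is nonnegative wherever the Lorentz form is, and
  the S-lemma for Hermitian forms turns this into
  \<open>d(z) d(w)\<^sup>* (1 - \<langle>\<phi> z, \<phi> w\<rangle>) = t (1 - \<langle>z, w\<rangle>) + P(z, w)\<close> with \<open>t \<ge> 0\<close> and \<open>P\<close> positive
  semidefinite (\<open>krein_decomposition\<close>).

  Elliptic case. Dividing by \<open>d\<close> and \<open>1 - \<langle>z, w\<rangle>\<close> shows that \<open>(1 - \<langle>\<phi> z, \<phi> w\<rangle>) k(z, w)\<close> is positive.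
  Its Schur complement at the fixed point \<open>p\<close> says that \<open>q(z) q(w)\<^sup>* k(z, w)\<close>, where
  \<open>q(z) = 1 - \<langle>z, p\<rangle>\<close>, decreases under composition with \<open>\<phi>\<close>. As multiplication by \<open>q\<close> is bounded
  with bounded inverse, the powers of \<open>C_\<phi>\<close> are uniformly bounded, and the spectral radius is at
  most \<open>1\<close>; it is attained because constants are fixed.

  Non-elliptic case. Here \<open>t > 0\<close>, since \<open>t = 0\<close> would make \<open>\<phi>\<close> constant. The identity above gives
  \<open>t k \<circ> \<phi> \<le> d d\<^sup>* k\<close>; iterating, \<open>t\<^sup>n k \<circ> \<phi>\<^sup>n \<le> d\<^sub>n d\<^sub>n\<^sup>* k\<close>, where the denominator \<open>d\<^sub>n\<close> of \<open>\<phi>\<^sup>n\<close> is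
  affine and zero-free on the ball, so multiplication by it has norm at most \<open>2 |d\<^sub>n(0)|\<close>. As
  \<open>d\<^sub>n\<^sub>+\<^sub>1(0) = d\<^sub>n(0) d(\<phi>\<^sup>n(0))\<close> and the orbit of \<open>0\<close> tends to the Denjoy-Wolff point \<open>\<zeta>\<close>, the growth
  rate is governed by \<open>|d(\<zeta>)|\<^sup>2 / t\<close>. The lift of \<open>\<zeta>\<close> is isotropic for \<open>P\<close>, hence lies in its kernel;
  evaluating the dilatation quotient radially gives \<open>\<alpha> = t / |d(\<zeta>)|\<^sup>2\<close>
  (\<open>Liminf_dilatation\<close>), which yields the upper bound.

  For the lower bound, isotropy also gives \<open>1 - \<langle>\<phi> z, \<zeta>\<rangle> = (1 - \<langle>z, \<zeta>\<rangle>) t / (d(z) d(\<zeta>)\<^sup>*)\<close>, so the orbit of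
  \<open>0\<close> approaches the sphere at an exponential rate no slower than \<open>\<alpha>\<close>, and the norms of its kernel functions grow
  accordingly. A spectrum inside a smaller disc would, by Cauchy's estimate for the resolvent, forbid
  that growth (\<open>geometric_growth_of_spectrum_bound\<close>).
\<close>

section \<open>Geometry of a Hilbert function space\<close>

context hilbert_function_space
begin

abbreviation nrm :: "('a \<Rightarrow> complex) \<Rightarrow> real" where
  "nrm \<equiv> ip_norm ip"

lemma diff_mem: "f \<in> H \<Longrightarrow> g \<in> H \<Longrightarrow> (\<lambda>x. f x - g x) \<in> H"
  using add_mem[of f "\<lambda>x. (-1) * g x"] scale_mem[of g "-1"] by simp

lemma sum_mem: "(\<And>i. i \<in> I \<Longrightarrow> F i \<in> H) \<Longrightarrow> (\<lambda>x. \<Sum>i\<in>I. F i x) \<in> H"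
proof (induction I rule: infinite_finite_induct)
  case (insert i I)
  then show ?case
    using add_mem[of "F i" "\<lambda>x. \<Sum>i\<in>I. F i x"] by simp
qed (simp_all add: zero_mem)

lemma ip_diff_left:
  assumes "f \<in> H" "g \<in> H" "h \<in> H"
  shows "ip (\<lambda>x. f x - g x) h = ip f h - ip g h"
  using ip_add_left[of f "\<lambda>x. (-1) * g x" h] ip_scale_left[of g h "-1"] scale_mem[of g "-1"] assms
  by simp

lemma ip_zero_left: "f \<in> H \<Longrightarrow> ip (\<lambda>_. 0) f = 0"
  using ip_scale_left[of f f 0] by simp

lemma ip_add_right:
  "f \<in> H \<Longrightarrow> g \<in> H \<Longrightarrow> h \<in> H \<Longrightarrow> ip h (\<lambda>x. f x + g x) = ip h f + ip h g"
  using ip_commute[of "\<lambda>x. f x + g x" h] ip_commute[of f h] ip_commute[of g h]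
    ip_add_left[of f g h] add_mem[of f g] by simp

lemma ip_scale_right:
  "f \<in> H \<Longrightarrow> g \<in> H \<Longrightarrow> ip f (\<lambda>x. c * g x) = cnj c * ip f g"
  using ip_commute[of "\<lambda>x. c * g x" f] ip_commute[of g f] ip_scale_left[of g f c] scale_mem[of g c]
  by simp

lemma ip_diff_right:
  "f \<in> H \<Longrightarrow> g \<in> H \<Longrightarrow> h \<in> H \<Longrightarrow> ip h (\<lambda>x. f x - g x) = ip h f - ip h g"
  using ip_commute[of "\<lambda>x. f x - g x" h] ip_commute[of f h] ip_commute[of g h]
    ip_diff_left[of f g h] diff_mem[of f g] by simp

lemma ip_zero_right: "f \<in> H \<Longrightarrow> ip f (\<lambda>_. 0) = 0"
  using ip_scale_right[of f f 0] by simp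

lemma ip_sum_left:
  "(\<And>i. i \<in> I \<Longrightarrow> F i \<in> H) \<Longrightarrow> h \<in> H \<Longrightarrow> ip (\<lambda>x. \<Sum>i\<in>I. F i x) h = (\<Sum>i\<in>I. ip (F i) h)"
proof (induction I rule: infinite_finite_induct)
  case (insert i I)
  then show ?case
    using ip_add_left[of "F i" "\<lambda>x. \<Sum>i\<in>I. F i x" h] sum_mem[of I F] by simp
qed (simp_all add: ip_zero_left)

lemma ip_sum_right:
  "(\<And>i. i \<in> I \<Longrightarrow> F i \<in> H) \<Longrightarrow> h \<in> H \<Longrightarrow> ip h (\<lambda>x. \<Sum>i\<in>I. F i x) = (\<Sum>i\<in>I. ip h (F i))"
proof (induction I rule: infinite_finite_induct)
  case (insert i I)
  then show ?case
    using ip_add_right[of "F i" "\<lambda>x. \<Sum>i\<in>I. F i x" h] sum_mem[of I F] by simp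
qed (simp_all add: ip_zero_right)

lemma nrm_nonneg: "f \<in> H \<Longrightarrow> 0 \<le> nrm f"
  by (simp add: ip_norm_def ip_nonneg)

lemma nrm_power2: "f \<in> H \<Longrightarrow> (nrm f)\<^sup>2 = Re (ip f f)"
  by (simp add: ip_norm_def ip_nonneg)

lemma ip_self: "f \<in> H \<Longrightarrow> ip f f = of_real ((nrm f)\<^sup>2)"
  using ip_commute[of f f] by (simp add: nrm_power2 complex_eq_iff)

lemma nrm_zero: "nrm (\<lambda>_. 0) = 0"
  using ip_zero_left[OF zero_mem] by (simp add: ip_norm_def)

lemma nrm_eq_0D: "f \<in> H \<Longrightarrow> nrm f = 0 \<Longrightarrow> f = (\<lambda>_. 0)"
  using ip_self ip_definite by fastforce

lemma nrm_scale: "f \<in> H \<Longrightarrow> nrm (\<lambda>x. c * f x) = cmod c * nrm f"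
proof -
  assume f: "f \<in> H"
  have "ip (\<lambda>x. c * f x) (\<lambda>x. c * f x) = c * cnj c * ip f f"
    using f by (simp add: ip_scale_left ip_scale_right scale_mem)
  also have "\<dots> = of_real ((cmod c * nrm f)\<^sup>2)"
    by (simp only: complex_norm_square[symmetric] ip_self[OF f] power_mult_distrib of_real_mult)
  finally have "nrm (\<lambda>x. c * f x) = sqrt ((cmod c * nrm f)\<^sup>2)"
    by (simp only: ip_norm_def Re_complex_of_real)
  then show ?thesis using nrm_nonneg[OF f] by simp
qed

lemma cauchy_schwarz:
  assumes "f \<in> H" "g \<in> H"
  shows "cmod (ip f g) \<le> nrm f * nrm g"
proof (cases "nrm g = 0")
  case True
  then show ?thesis using nrm_eq_0D[OF assms(2)] ip_zero_right[OF assms(1)] by simp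
next
  case False
  define c where "c = ip f g / ip g g"
  define h where "h = (\<lambda>x. f x - c * g x)"
  have h: "h \<in> H" unfolding h_def using assms by (intro diff_mem scale_mem)
  have gg: "ip g g \<noteq> 0" using False by (simp add: ip_self[OF assms(2)])
  have "ip h g = ip f g - c * ip g g"
    unfolding h_def using assms by (simp add: ip_diff_left scale_mem ip_scale_left)
  then have hg: "ip h g = 0" using gg by (simp add: c_def)
  have "ip h h = ip h f - cnj c * ip h g"
    using h assms by (subst (2) h_def) (simp add: ip_diff_right scale_mem ip_scale_right)
  also have "ip h f = ip f f - c * ip g f"
    unfolding h_def using assms by (simp add: ip_diff_left scale_mem ip_scale_left)
  finally have "ip h h = of_real ((nrm f)\<^sup>2) - ip f g * cnj (ip f g) / of_real ((nrm g)\<^sup>2)"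
    using hg ip_commute[OF assms] by (simp add: c_def ip_self assms)
  also have "\<dots> = of_real ((nrm f)\<^sup>2 - (cmod (ip f g))\<^sup>2 / (nrm g)\<^sup>2)"
    by (simp only: complex_norm_square[symmetric] of_real_diff of_real_divide)
  finally have "0 \<le> (nrm f)\<^sup>2 - (cmod (ip f g))\<^sup>2 / (nrm g)\<^sup>2"
    using ip_nonneg[OF h] by simp
  then have "(cmod (ip f g))\<^sup>2 \<le> (nrm f * nrm g)\<^sup>2"
    using False by (simp add: field_simps power_mult_distrib)
  then show ?thesis
    using nrm_nonneg assms by (meson abs_le_square_iff mult_nonneg_nonneg power2_le_imp_le)
qed

lemma nrm_triangle:
  assumes "f \<in> H" "g \<in> H"
  shows "nrm (\<lambda>x. f x + g x) \<le> nrm f + nrm g"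
proof (rule power2_le_imp_le)
  have "Re (ip f g) \<le> nrm f * nrm g" "Re (ip g f) \<le> nrm g * nrm f"
    using cauchy_schwarz assms complex_Re_le_cmod order_trans by blast+
  then show "(nrm (\<lambda>x. f x + g x))\<^sup>2 \<le> (nrm f + nrm g)\<^sup>2"
    using assms by (simp add: nrm_power2 add_mem ip_add_left ip_add_right power2_sum algebra_simps)
qed (use assms nrm_nonneg in auto)

lemma nrm_diff_commute: "f \<in> H \<Longrightarrow> g \<in> H \<Longrightarrow> nrm (\<lambda>x. f x - g x) = nrm (\<lambda>x. g x - f x)"
  using nrm_scale[of "\<lambda>x. f x - g x" "-1"] diff_mem[of f g] by simp

lemma nrm_triangle_diff:
  assumes "f \<in> H" "g \<in> H"
  shows "nrm f \<le> nrm g + nrm (\<lambda>x. f x - g x)"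
  using nrm_triangle[of g "\<lambda>x. f x - g x"] diff_mem[of f g] assms by simp

lemma abs_nrm_diff_le:
  assumes "f \<in> H" "g \<in> H"
  shows "\<bar>nrm f - nrm g\<bar> \<le> nrm (\<lambda>x. f x - g x)"
  using nrm_triangle_diff[OF assms] nrm_triangle_diff[OF assms(2,1)] nrm_diff_commute[OF assms]
  by linarith

lemma nrm_sum_le:
  "(\<And>i. i \<in> I \<Longrightarrow> F i \<in> H) \<Longrightarrow> nrm (\<lambda>x. \<Sum>i\<in>I. F i x) \<le> (\<Sum>i\<in>I. nrm (F i))"
proof (induction I rule: infinite_finite_induct)
  case (insert i I)
  then show ?case
    using nrm_triangle[of "F i" "\<lambda>x. \<Sum>i\<in>I. F i x"] sum_mem[of I F] by simp
qed (simp_all add: nrm_zero)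

lemma ip_tendsto_left:
  assumes "\<And>n. F n \<in> H" "f \<in> H" "g \<in> H" "(\<lambda>n. nrm (\<lambda>x. F n x - f x)) \<longlonglongrightarrow> 0"
  shows "(\<lambda>n. ip (F n) g) \<longlonglongrightarrow> ip f g"
proof (rule LIM_zero_cancel, rule Lim_null_comparison)
  show "\<forall>\<^sub>F n in sequentially. norm (ip (F n) g - ip f g) \<le> nrm (\<lambda>x. F n x - f x) * nrm g"
    using cauchy_schwarz[OF diff_mem[OF assms(1,2)] assms(3)] assms by (simp add: ip_diff_left)
  show "(\<lambda>n. nrm (\<lambda>x. F n x - f x) * nrm g) \<longlonglongrightarrow> 0"
    using tendsto_mult_right[OF assms(4), of "nrm g"] by simp
qed

lemma nrm_tendsto:
  assumes "\<And>n. F n \<in> H" "f \<in> H" "(\<lambda>n. nrm (\<lambda>x. F n x - f x)) \<longlonglongrightarrow> 0"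
  shows "(\<lambda>n. nrm (F n)) \<longlonglongrightarrow> nrm f"
proof (rule LIM_zero_cancel, rule Lim_null_comparison)
  show "\<forall>\<^sub>F n in sequentially. norm (nrm (F n) - nrm f) \<le> nrm (\<lambda>x. F n x - f x)"
    using abs_nrm_diff_le[OF assms(1,2)] by simp
qed (fact assms(3))

text \<open>Absolutely convergent series converge; only geometric majorants occur below, and the
  explicit bound on the limit is what makes resolvents bounded.\<close>

lemma geometric_series_converges:
  assumes a: "\<And>n. a n \<in> H" and bound: "\<And>n. nrm (a n) \<le> B * q ^ n"
    and q: "0 \<le> q" "q < 1"
  shows "\<exists>g\<in>H. (\<lambda>N. nrm (\<lambda>x. (\<Sum>n<N. a n x) - g x)) \<longlonglongrightarrow> 0 \<and> nrm g \<le> B / (1 - q)"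
proof -
  define F where "F = (\<lambda>N x. \<Sum>n<N. a n x)"
  have F: "F N \<in> H" for N unfolding F_def by (rule sum_mem) (rule a)
  have B: "0 \<le> B" using nrm_nonneg[OF a[of 0]] bound[of 0] by simp
  have tail: "nrm (\<lambda>x. F N x - F M x) \<le> B / (1 - q) * q ^ M" if "M \<le> N" for M N
  proof -
    have eq: "(\<lambda>x. F N x - F M x) = (\<lambda>x. \<Sum>n\<in>{M..<N}. a n x)"
    proof
      fix x show "F N x - F M x = (\<Sum>n\<in>{M..<N}. a n x)"
        unfolding F_def lessThan_atLeast0
        by (rule sum_diff_nat_ivl) (use that in auto)
    qed
    have "nrm (\<lambda>x. F N x - F M x) \<le> (\<Sum>n\<in>{M..<N}. nrm (a n))"
      unfolding eq by (rule nrm_sum_le) (rule a)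
    also have "\<dots> \<le> (\<Sum>n\<in>{M..<N}. B * q ^ n)" by (intro sum_mono bound)
    also have "\<dots> = (\<Sum>n<N - M. B * q ^ (n + M))"
      using that sum.shift_bounds_nat_ivl[of "\<lambda>n. B * q ^ n" 0 M "N - M"]
      by (simp add: lessThan_atLeast0)
    also have "\<dots> = B * q ^ M * (\<Sum>n<N - M. q ^ n)"
      by (simp add: sum_distrib_left power_add algebra_simps)
    also have "\<dots> \<le> B * q ^ M * (1 / (1 - q))"
    proof (rule mult_left_mono)
      have "(\<Sum>n<N - M. q ^ n) = (1 - q ^ (N - M)) / (1 - q)"
        using q by (simp add: sum_gp_strict)
      also have "\<dots> \<le> 1 / (1 - q)" using q by (intro divide_right_mono) auto
      finally show "(\<Sum>n<N - M. q ^ n) \<le> 1 / (1 - q)" .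
    qed (use B q in auto)
    finally show ?thesis by simp
  qed
  have lim0: "(\<lambda>M. B / (1 - q) * q ^ M) \<longlonglongrightarrow> 0"
    by (rule tendsto_mult_right_zero[OF LIMSEQ_realpow_zero[OF q]])
  have "\<exists>g\<in>H. (\<lambda>N. nrm (\<lambda>x. F N x - g x)) \<longlonglongrightarrow> 0"
  proof (rule complete)
    fix e :: real assume "e > 0"
    from order_tendstoD(2)[OF lim0 this] obtain N0 where
      N0: "\<And>M. M \<ge> N0 \<Longrightarrow> B / (1 - q) * q ^ M < e"
      unfolding eventually_sequentially by blast
    have "nrm (\<lambda>x. F m x - F n x) < e" if "m \<ge> N0" "n \<ge> N0" for m n
      using tail[of m n] tail[of n m] N0[OF that(1)] N0[OF that(2)] nrm_diff_commute[OF F F, of m n]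
      by (cases "m \<le> n") auto
    then show "\<exists>N. \<forall>m\<ge>N. \<forall>n\<ge>N. nrm (\<lambda>x. F m x - F n x) < e" by blast
  qed (fact F)
  then obtain g where g: "g \<in> H" "(\<lambda>N. nrm (\<lambda>x. F N x - g x)) \<longlonglongrightarrow> 0" by blast
  have "nrm (F N) \<le> B / (1 - q)" for N using tail[of 0 N] by (simp add: F_def)
  then have "nrm g \<le> B / (1 - q)"
    using LIMSEQ_le_const2[OF nrm_tendsto[OF F g]] by blast
  with g show ?thesis unfolding F_def by blast
qed

end

section \<open>Spectrum and growth of powers\<close>

context hilbert_function_space
begin

lemma bounded_operatorD:
  assumes "bounded_operator_on H ip T"
  shows "f \<in> H \<Longrightarrow> T f \<in> H"
    and "f \<in> H \<Longrightarrow> g \<in> H \<Longrightarrow> T (\<lambda>x. f x + g x) = (\<lambda>x. T f x + T g x)"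
    and "f \<in> H \<Longrightarrow> T (\<lambda>x. c * f x) = (\<lambda>x. c * T f x)"
  using assms unfolding bounded_operator_on_def by blast+

lemma bounded_operator_bound:
  assumes "bounded_operator_on H ip T"
  obtains K where "K > 0" "\<And>f. f \<in> H \<Longrightarrow> nrm (T f) \<le> K * nrm f"
proof -
  obtain K where K: "\<And>f. f \<in> H \<Longrightarrow> nrm (T f) \<le> K * nrm f"
    using assms unfolding bounded_operator_on_def by blast
  have "nrm (T f) \<le> (\<bar>K\<bar> + 1) * nrm f" if "f \<in> H" for f
    using order_trans[OF K[OF that], of "(\<bar>K\<bar> + 1) * nrm f"] nrm_nonneg[OF that]
    by (simp add: mult_right_mono)
  then show ?thesis by (intro that[of "\<bar>K\<bar> + 1"]) auto
qed

lemma bounded_operator_diff: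
  assumes T: "bounded_operator_on H ip T" and "f \<in> H" "g \<in> H"
  shows "T (\<lambda>x. f x - g x) = (\<lambda>x. T f x - T g x)"
  using bounded_operatorD(2)[OF T assms(2) scale_mem[OF assms(3), of "-1"]]
    bounded_operatorD(3)[OF T assms(3), of "-1"] by simp

lemma bounded_operator_zero:
  assumes T: "bounded_operator_on H ip T"
  shows "T (\<lambda>_. 0) = (\<lambda>_. 0)"
  using bounded_operatorD(3)[OF T zero_mem, of 0] by simp

lemma bounded_operator_sum:
  assumes T: "bounded_operator_on H ip T" and "\<And>i. i \<in> I \<Longrightarrow> F i \<in> H"
  shows "T (\<lambda>x. \<Sum>i\<in>I. F i x) = (\<lambda>x. \<Sum>i\<in>I. T (F i) x)"
  using assms(2)
proof (induction I rule: infinite_finite_induct)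
  case (insert i I)
  then show ?case
    using bounded_operatorD(2)[OF T, of "F i" "\<lambda>x. \<Sum>i\<in>I. F i x"] sum_mem[of I F] by simp
qed (simp_all add: bounded_operator_zero[OF T])

lemma funpow_mem:
  assumes T: "bounded_operator_on H ip T" and "f \<in> H"
  shows "(T ^^ n) f \<in> H"
  by (induction n) (use assms bounded_operatorD(1)[OF T] in auto)

text \<open>Unique solvability with a norm bound makes the solution operator linear and bounded, so no
  linearity has to be checked when solutions are produced one right-hand side at a time.\<close>

lemma not_in_operator_spectrumI:
  assumes T: "bounded_operator_on H ip T"
    and solve: "\<And>f. f \<in> H \<Longrightarrow> \<exists>g\<in>H. (\<lambda>x. T g x - \<mu> * g x) = f \<and> nrm g \<le> K * nrm f"
    and inj: "\<And>g. g \<in> H \<Longrightarrow> (\<lambda>x. T g x - \<mu> * g x) = (\<lambda>_. 0) \<Longrightarrow> g = (\<lambda>_. 0)"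
  shows "\<mu> \<notin> operator_spectrum H ip T"
proof -
  define R where "R = (\<lambda>g x. T g x - \<mu> * g x)"
  have R_mem: "R g \<in> H" if "g \<in> H" for g
    unfolding R_def using that by (intro diff_mem scale_mem bounded_operatorD(1)[OF T])
  have R_diff: "R (\<lambda>x. g x - h x) = (\<lambda>x. R g x - R h x)" if "g \<in> H" "h \<in> H" for g h
    using that by (simp add: R_def bounded_operator_diff[OF T] algebra_simps)
  have R_add: "R (\<lambda>x. g x + h x) = (\<lambda>x. R g x + R h x)" if "g \<in> H" "h \<in> H" for g h
    using that by (simp add: R_def bounded_operatorD(2)[OF T] algebra_simps)
  have R_scale: "R (\<lambda>x. c * g x) = (\<lambda>x. c * R g x)" if "g \<in> H" for g c
    using that by (simp add: R_def bounded_operatorD(3)[OF T] algebra_simps)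
  have R_inj: "g = h" if "g \<in> H" "h \<in> H" "R g = R h" for g h
  proof -
    have "R (\<lambda>x. g x - h x) = (\<lambda>_. 0)" using that by (simp add: R_diff)
    then have "(\<lambda>x. g x - h x) = (\<lambda>_. 0)"
      using inj diff_mem that by (auto simp: R_def)
    then show "g = h" by (simp add: fun_eq_iff)
  qed
  have "\<exists>S. \<forall>f\<in>H. S f \<in> H \<and> R (S f) = f \<and> nrm (S f) \<le> K * nrm f"
    using solve unfolding R_def by (intro bchoice) blast
  then obtain S where S: "\<And>f. f \<in> H \<Longrightarrow> S f \<in> H" "\<And>f. f \<in> H \<Longrightarrow> R (S f) = f"
      "\<And>f. f \<in> H \<Longrightarrow> nrm (S f) \<le> K * nrm f"
    by blast
  have "bounded_operator_on H ip S"
    unfolding bounded_operator_on_def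
  proof (intro conjI ballI allI)
    show "S ` H \<subseteq> H" using S(1) by blast
    show "S (\<lambda>x. f x + g x) = (\<lambda>x. S f x + S g x)" if "f \<in> H" "g \<in> H" for f g
      by (rule R_inj) (use that S R_add add_mem in auto)
    show "S (\<lambda>x. c * f x) = (\<lambda>x. c * S f x)" if "f \<in> H" for c f
      by (rule R_inj) (use that S R_scale scale_mem in auto)
    show "\<exists>K. \<forall>f\<in>H. nrm (S f) \<le> K * nrm f" using S(3) by blast
  qed
  moreover have "S (R f) = f" if "f \<in> H" for f
    by (rule R_inj) (use that S R_mem in auto)
  ultimately show ?thesis
    using S(2) unfolding operator_spectrum_def R_def by blast
qed

text \<open>The Neumann series. Its partial sums solve the equation up to the term \<open>\<mu> a\<^sub>N\<close>, which tends
  to \<open>0\<close>; an eigenvector for \<open>\<mu>\<close> would violate the growth bound.\<close>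

lemma power_bound_not_in_operator_spectrum:
  assumes T: "bounded_operator_on H ip T"
    and bound: "\<And>n f. f \<in> H \<Longrightarrow> nrm ((T ^^ n) f) \<le> C * \<rho> ^ n * nrm f"
    and \<rho>: "0 \<le> \<rho>" "\<rho> < cmod \<mu>"
  shows "\<mu> \<notin> operator_spectrum H ip T"
proof -
  have \<mu>: "\<mu> \<noteq> 0" using \<rho> by auto
  define q where "q = \<rho> / cmod \<mu>"
  have q: "0 \<le> q" "q < 1" using \<rho> \<mu> by (auto simp: q_def divide_simps)
  show ?thesis
  proof (rule not_in_operator_spectrumI[OF T, where K = "C / cmod \<mu> / (1 - q)"])
    fix f assume f: "f \<in> H"
    define a where "a = (\<lambda>n x. - inverse (\<mu> ^ Suc n) * (T ^^ n) f x)"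
    have a: "a n \<in> H" for n
      unfolding a_def by (intro scale_mem funpow_mem[OF T] f)
    have a_bound: "nrm (a n) \<le> (C / cmod \<mu> * nrm f) * q ^ n" for n
    proof -
      have "nrm (a n) = nrm ((T ^^ n) f) / cmod \<mu> ^ Suc n"
        unfolding a_def nrm_scale[OF funpow_mem[OF T f]]
        by (simp add: norm_inverse norm_power norm_mult norm_divide divide_simps)
      also have "\<dots> \<le> (C * \<rho> ^ n * nrm f) / cmod \<mu> ^ Suc n"
        by (intro divide_right_mono bound f) simp
      also have "\<dots> = (C / cmod \<mu> * nrm f) * q ^ n"
        by (simp add: q_def power_divide field_simps)
      finally show ?thesis .
    qed
    obtain g where g: "g \<in> H" "(\<lambda>N. nrm (\<lambda>x. (\<Sum>n<N. a n x) - g x)) \<longlonglongrightarrow> 0"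
        "nrm g \<le> C / cmod \<mu> * nrm f / (1 - q)"
      using geometric_series_converges[OF a a_bound q] by blast
    obtain L where L: "L > 0" "\<And>f. f \<in> H \<Longrightarrow> nrm (T f) \<le> L * nrm f"
      using bounded_operator_bound[OF T] by blast
    define P where "P = (\<lambda>N x. \<Sum>n<N. a n x)"
    have P: "P N \<in> H" for N unfolding P_def by (rule sum_mem) (rule a)
    have Ta: "T (a n) = (\<lambda>x. \<mu> * a (Suc n) x)" for n
      unfolding a_def bounded_operatorD(3)[OF T funpow_mem[OF T f]]
      using \<mu> by (simp add: fun_eq_iff)
    have TP: "T (P N) x - \<mu> * P N x = \<mu> * a N x + f x" for N x
    proof -
      have "T (P N) x = (\<Sum>n<N. \<mu> * a (Suc n) x)"
        unfolding P_def using bounded_operator_sum[OF T, of "{..<N}" a] a Ta by (simp add: fun_eq_iff)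
      then have "T (P N) x - \<mu> * P N x = \<mu> * (\<Sum>n<N. a (Suc n) x - a n x)"
        unfolding P_def by (simp add: sum_distrib_left sum_subtractf algebra_simps)
      also have "\<dots> = \<mu> * (a N x - a 0 x)"
        using sum_lessThan_telescope[of "\<lambda>n. a n x" N] by simp
      also have "\<dots> = \<mu> * a N x + f x"
        using \<mu> by (simp add: a_def algebra_simps)
      finally show ?thesis .
    qed
    define h where "h = (\<lambda>x. T g x - \<mu> * g x - f x)"
    have h: "h \<in> H"
      unfolding h_def by (intro diff_mem scale_mem f g bounded_operatorD(1)[OF T])
    have "nrm h \<le> (L + cmod \<mu>) * nrm (\<lambda>x. P N x - g x) + cmod \<mu> * nrm (a N)" for N
    proof -
      let ?e = "\<lambda>x. P N x - g x"
      have e: "?e \<in> H" by (intro diff_mem P g)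
      have "h = (\<lambda>x. \<mu> * ?e x - T ?e x + \<mu> * a N x)"
        using TP[of N] unfolding h_def bounded_operator_diff[OF T P g(1)]
        by (auto simp: fun_eq_iff algebra_simps)
      then have "nrm h \<le> nrm (\<lambda>x. \<mu> * ?e x - T ?e x) + nrm (\<lambda>x. \<mu> * a N x)"
        using nrm_triangle[of "\<lambda>x. \<mu> * ?e x - T ?e x" "\<lambda>x. \<mu> * a N x"] e a
        by (simp add: diff_mem scale_mem bounded_operatorD(1)[OF T])
      also have "nrm (\<lambda>x. \<mu> * ?e x - T ?e x) \<le> nrm (\<lambda>x. \<mu> * ?e x) + nrm (\<lambda>x. (-1) * T ?e x)"
        using nrm_triangle[of "\<lambda>x. \<mu> * ?e x" "\<lambda>x. (-1) * T ?e x"] e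
        by (simp only: scale_mem bounded_operatorD(1)[OF T]) simp
      also have "\<dots> = cmod \<mu> * nrm ?e + nrm (T ?e)"
        using nrm_scale[OF e] nrm_scale[OF bounded_operatorD(1)[OF T e], of "-1"] by simp
      finally show ?thesis
        using L(2)[OF e] nrm_scale[OF a] by (simp add: algebra_simps)
    qed
    moreover have "(\<lambda>N. (L + cmod \<mu>) * nrm (\<lambda>x. P N x - g x) + cmod \<mu> * nrm (a N)) \<longlonglongrightarrow> 0"
    proof -
      have "(\<lambda>N. nrm (a N)) \<longlonglongrightarrow> 0"
      proof (rule Lim_null_comparison)
        show "\<forall>\<^sub>F N in sequentially. norm (nrm (a N)) \<le> (C / cmod \<mu> * nrm f) * q ^ N"
          using a_bound nrm_nonneg[OF a] by simp
        show "(\<lambda>N. (C / cmod \<mu> * nrm f) * q ^ N) \<longlonglongrightarrow> 0"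
          by (rule tendsto_mult_right_zero[OF LIMSEQ_realpow_zero[OF q]])
      qed
      then show ?thesis
        using tendsto_add[OF tendsto_mult_right_zero[OF g(2)] tendsto_mult_right_zero]
        unfolding P_def by fastforce
    qed
    ultimately have "nrm h \<le> 0"
      by (intro LIMSEQ_le_const) auto
    then have "h = (\<lambda>_. 0)" using nrm_nonneg[OF h] nrm_eq_0D[OF h] by simp
    then have "(\<lambda>x. T g x - \<mu> * g x) = f" by (simp add: h_def fun_eq_iff)
    with g show "\<exists>g\<in>H. (\<lambda>x. T g x - \<mu> * g x) = f \<and> nrm g \<le> C / cmod \<mu> / (1 - q) * nrm f"
      by auto
  next
    fix g assume g: "g \<in> H" and "(\<lambda>x. T g x - \<mu> * g x) = (\<lambda>_. 0)"
    then have Tg: "T g = (\<lambda>x. \<mu> * g x)" by (simp add: fun_eq_iff)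
    have "(T ^^ n) g = (\<lambda>x. \<mu> ^ n * g x)" for n
      by (induction n) (simp_all add: bounded_operatorD(3)[OF T g] Tg mult.assoc mult.left_commute)
    then have "cmod \<mu> ^ n * nrm g \<le> C * \<rho> ^ n * nrm g" for n
      using bound[OF g, of n] nrm_scale[OF g] by (simp add: norm_power)
    then have "nrm g \<le> (C * nrm g) * q ^ n" for n
      using \<mu> by (simp add: q_def power_divide field_simps)
    then have "nrm g \<le> 0"
      by (intro LIMSEQ_le_const[OF tendsto_mult_right_zero[OF LIMSEQ_realpow_zero[OF q]]]) auto
    then show "g = (\<lambda>_. 0)" using nrm_nonneg[OF g] nrm_eq_0D[OF g] by simp
  qed
qed

lemma eigenvalue_in_operator_spectrum:
  assumes T: "bounded_operator_on H ip T"
    and g: "g \<in> H" "g \<noteq> (\<lambda>_. 0)" "T g = (\<lambda>x. \<mu> * g x)"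
  shows "\<mu> \<in> operator_spectrum H ip T"
proof (rule ccontr)
  assume "\<mu> \<notin> operator_spectrum H ip T"
  then obtain S where S: "bounded_operator_on H ip S" "S (\<lambda>x. T g x - \<mu> * g x) = g"
    using g(1) unfolding operator_spectrum_def by blast
  then show False using bounded_operator_zero[OF S(1)] g by simp
qed

end

context hilbert_function_space
begin

text \<open>The half of Gelfand's formula that bounds the powers by the spectrum. If the spectrum lies in
  the closed disc of radius \<open>r\<^sub>1\<close>, then \<open>1 - z T\<close> has a bounded inverse \<open>Q z\<close> for
  \<open>|z| < 1/r\<^sub>1\<close>. The functions \<open>z \<mapsto> \<langle>Q z f, g\<rangle>\<close> are holomorphic there with Taylor coefficients
  \<open>\<langle>T\<^sup>n f, g\<rangle>\<close>, and Cauchy's estimate applies on the circle of radius \<open>1/r\<close>. The constant is uniform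
  in \<open>f\<close> and \<open>g\<close> because \<open>Q\<close> is locally bounded and the circle is compact; working with \<open>1 - z T\<close>
  instead of \<open>T - \<mu>\<close> makes \<open>z = 0\<close> a regular point.\<close>

lemma geometric_growth_of_spectrum_bound:
  assumes T: "bounded_operator_on H ip T"
    and spec: "\<And>\<mu>. \<mu> \<in> operator_spectrum H ip T \<Longrightarrow> cmod \<mu> \<le> r\<^sub>1"
    and r: "0 < r\<^sub>1" "r\<^sub>1 < r"
  obtains K where "\<And>n f g. f \<in> H \<Longrightarrow> g \<in> H \<Longrightarrow> cmod (ip ((T ^^ n) f) g) \<le> K * r ^ n * nrm f * nrm g"
proof -
  define D where "D = ball (0::complex) (1 / r\<^sub>1)"
  define \<rho> where "\<rho> = 1 / r"
  have \<rho>: "0 < \<rho>" "cball 0 \<rho> \<subseteq> D" "0 \<in> D" "open D"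
    using r unfolding D_def \<rho>_def by (auto simp: divide_simps cball_subset_ball_iff)
  define invs where "invs = (\<lambda>z Q. bounded_operator_on H ip Q \<and>
      (\<forall>f\<in>H. Q (\<lambda>x. f x - z * T f x) = f \<and> (\<lambda>x. Q f x - z * T (Q f) x) = f))"
  have "\<exists>Q. invs z Q" if "z \<in> D" for z
  proof (cases "z = 0")
    case True
    have "invs z (\<lambda>f. f)"
      unfolding invs_def bounded_operator_on_def using True by (auto intro!: exI[of _ 1])
    then show ?thesis by blast
  next
    case False
    define \<mu> where "\<mu> = inverse z"
    have "cmod \<mu> > r\<^sub>1"
      using that False r by (simp add: \<mu>_def D_def norm_inverse norm_divide field_simps)
    then have "\<mu> \<notin> operator_spectrum H ip T" using spec by force
    then obtain S where S: "bounded_operator_on H ip S"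
      "\<And>f. f \<in> H \<Longrightarrow> S (\<lambda>x. T f x - \<mu> * f x) = f"
      "\<And>f. f \<in> H \<Longrightarrow> (\<lambda>x. T (S f) x - \<mu> * S f x) = f"
      unfolding operator_spectrum_def by blast
    obtain K where K: "\<And>f. f \<in> H \<Longrightarrow> nrm (S f) \<le> K * nrm f"
      using bounded_operator_bound[OF S(1)] by blast
    define Q where "Q = (\<lambda>f x. - \<mu> * S f x)"
    have "bounded_operator_on H ip Q"
      unfolding bounded_operator_on_def
    proof (intro conjI ballI allI)
      show "Q ` H \<subseteq> H" unfolding Q_def using bounded_operatorD(1)[OF S(1)] scale_mem by blast
      show "Q (\<lambda>x. f x + g x) = (\<lambda>x. Q f x + Q g x)" if "f \<in> H" "g \<in> H" for f g
        by (simp add: Q_def bounded_operatorD(2)[OF S(1) that] algebra_simps)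
      show "Q (\<lambda>x. c * f x) = (\<lambda>x. c * Q f x)" if "f \<in> H" for c f
        by (simp add: Q_def bounded_operatorD(3)[OF S(1) that] algebra_simps)
      have "nrm (Q f) \<le> cmod \<mu> * K * nrm f" if "f \<in> H" for f
        unfolding Q_def using nrm_scale[OF bounded_operatorD(1)[OF S(1) that], of "- \<mu>"]
          mult_left_mono[OF K[OF that], of "cmod \<mu>"] by simp
      then show "\<exists>K. \<forall>f\<in>H. nrm (Q f) \<le> K * nrm f" by blast
    qed
    moreover have "Q (\<lambda>x. f x - z * T f x) = f" if f: "f \<in> H" for f
    proof -
      have Tf: "(\<lambda>x. T f x - \<mu> * f x) \<in> H"
        by (intro diff_mem scale_mem bounded_operatorD(1)[OF T] f)
      have "(\<lambda>x. f x - z * T f x) = (\<lambda>x. - z * (T f x - \<mu> * f x))"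
        using False by (simp add: \<mu>_def fun_eq_iff algebra_simps)
      then have "S (\<lambda>x. f x - z * T f x) = (\<lambda>x. - z * f x)"
        by (simp only: bounded_operatorD(3)[OF S(1) Tf] S(2)[OF f])
      then show ?thesis using False by (simp add: Q_def \<mu>_def fun_eq_iff)
    qed
    moreover have "(\<lambda>x. Q f x - z * T (Q f) x) = f" if f: "f \<in> H" for f
    proof -
      have Sf: "S f \<in> H" by (rule bounded_operatorD(1)[OF S(1) f])
      have TSf: "T (S f) x = f x + \<mu> * S f x" for x
        using fun_cong[OF S(3)[OF f], of x] by (simp add: algebra_simps)
      have TQ: "T (Q f) = (\<lambda>x. - \<mu> * T (S f) x)"
        unfolding Q_def by (rule bounded_operatorD(3)[OF T Sf])
      have "z * \<mu> = 1" using False by (simp add: \<mu>_def)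
      then have "- \<mu> * S f x - z * (- \<mu> * (f x + \<mu> * S f x)) = f x" for x
        by algebra
      then show ?thesis
        unfolding TQ TSf by (simp add: Q_def)
    qed
    ultimately show ?thesis unfolding invs_def by blast
  qed
  then obtain Q where invs: "\<And>z. z \<in> D \<Longrightarrow> invs z (Q z)" by metis
  have Q: "bounded_operator_on H ip (Q z)" if "z \<in> D" for z
    using invs[OF that] by (simp add: invs_def)
  have Q_left: "Q z (\<lambda>x. f x - z * T f x) = f" if "z \<in> D" "f \<in> H" for z f
    using invs that by (simp add: invs_def)
  have Q_right: "(\<lambda>x. Q z f x - z * T (Q z f) x) = f" if "z \<in> D" "f \<in> H" for z f
    using invs that by (simp add: invs_def)
  have Q_mem: "Q z f \<in> H" if "z \<in> D" "f \<in> H" for z f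
    using bounded_operatorD(1)[OF Q] that by blast
  have T_mem: "T f \<in> H" if "f \<in> H" for f using bounded_operatorD(1)[OF T] that .
  have resolvent: "(\<lambda>x. Q z f x - Q w f x) = (\<lambda>x. (z - w) * Q z (T (Q w f)) x)"
    if z: "z \<in> D" and w: "w \<in> D" and f: "f \<in> H" for z w f
  proof -
    let ?h = "Q w f"
    have h: "?h \<in> H" by (rule Q_mem[OF w f])
    have "(\<lambda>x. Q z f x - ?h x) =
        (\<lambda>x. Q z (\<lambda>x. ?h x - w * T ?h x) x - Q z (\<lambda>x. ?h x - z * T ?h x) x)"
      by (simp only: Q_left[OF z h] Q_right[OF w f])
    also have "\<dots> = Q z (\<lambda>x. (?h x - w * T ?h x) - (?h x - z * T ?h x))"
      by (rule bounded_operator_diff[OF Q[OF z], symmetric]) (intro diff_mem scale_mem T_mem h)+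
    also have "(\<lambda>x. (?h x - w * T ?h x) - (?h x - z * T ?h x)) = (\<lambda>x. (z - w) * T ?h x)"
      by (simp add: algebra_simps)
    also have "Q z \<dots> = (\<lambda>x. (z - w) * Q z (T ?h) x)"
      by (rule bounded_operatorD(3)[OF Q[OF z] T_mem[OF h]])
    finally show ?thesis .
  qed
  obtain L where L: "L > 0" "\<And>f. f \<in> H \<Longrightarrow> nrm (T f) \<le> L * nrm f"
    using bounded_operator_bound[OF T] by blast
  have locally_bounded: "\<exists>\<delta> K. \<delta> > 0 \<and> K > 0 \<and>
      (\<forall>z\<in>D \<inter> ball w \<delta>. \<forall>f\<in>H. nrm (Q z f) \<le> K * nrm f)" if w: "w \<in> D" for w
  proof -
    obtain K where K: "K > 0" "\<And>f. f \<in> H \<Longrightarrow> nrm (Q w f) \<le> K * nrm f"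
      using bounded_operator_bound[OF Q[OF w]] by blast
    define \<delta> where "\<delta> = 1 / (2 * K * L)"
    have "nrm (Q z f) \<le> 2 * K * nrm f" if z: "z \<in> D" "z \<in> ball w \<delta>" and f: "f \<in> H" for z f
    proof -
      have QT: "Q w (T (Q z f)) \<in> H" by (intro Q_mem w T_mem z f)
      have "nrm (Q z f) \<le> nrm (Q w f) + nrm (\<lambda>x. Q z f x - Q w f x)"
        by (intro nrm_triangle_diff Q_mem w z f)
      also have "nrm (\<lambda>x. Q z f x - Q w f x) = nrm (\<lambda>x. Q w f x - Q z f x)"
        by (intro nrm_diff_commute Q_mem w z f)
      also have "\<dots> = cmod (w - z) * nrm (Q w (T (Q z f)))"
        by (simp only: resolvent[OF w z(1) f] nrm_scale[OF QT])
      also have "\<dots> \<le> cmod (w - z) * (K * (L * nrm (Q z f)))"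
        using order_trans[OF K(2)[OF T_mem[OF Q_mem[OF z(1) f]]]
            mult_left_mono[OF L(2)[OF Q_mem[OF z(1) f]]]] K(1)
        by (intro mult_left_mono) auto
      also have "\<dots> = (cmod (w - z) * K * L) * nrm (Q z f)" by simp
      also have "\<dots> \<le> 1 / 2 * nrm (Q z f)"
        using z(2) K(1) L(1) unfolding \<delta>_def
        by (intro mult_right_mono nrm_nonneg Q_mem z(1) f)
          (auto simp: dist_norm field_simps)
      finally show ?thesis using K(2)[OF f] by simp
    qed
    moreover have "\<delta> > 0" using K L by (simp add: \<delta>_def)
    ultimately show ?thesis using K(1) by (intro exI[of _ \<delta>] exI[of _ "2 * K"]) auto
  qed
  then obtain \<delta> M where \<delta>: "\<And>w. w \<in> D \<Longrightarrow> \<delta> w > 0" and M: "\<And>w. w \<in> D \<Longrightarrow> M w > 0"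
    and \<delta>M: "\<And>w z f. w \<in> D \<Longrightarrow> z \<in> D \<Longrightarrow> z \<in> ball w (\<delta> w) \<Longrightarrow> f \<in> H \<Longrightarrow> nrm (Q z f) \<le> M w * nrm f"
    by (metis IntI)
  obtain K where K: "\<And>z f. z \<in> cball 0 \<rho> \<Longrightarrow> f \<in> H \<Longrightarrow> nrm (Q z f) \<le> K * nrm f"
  proof -
    have "cball 0 \<rho> \<subseteq> (\<Union>w\<in>cball 0 \<rho>. ball w (\<delta> w))"
      using \<delta>[OF subsetD[OF \<rho>(2)]] by (blast intro: centre_in_ball[THEN iffD2])
    then obtain C where C: "C \<subseteq> cball 0 \<rho>" "finite C" "cball 0 \<rho> \<subseteq> (\<Union>w\<in>C. ball w (\<delta> w))"
      using compactE_image[OF compact_cball, of "cball 0 \<rho>" "\<lambda>w. ball w (\<delta> w)"] by (metis open_ball)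
    have "nrm (Q z f) \<le> (\<Sum>w\<in>C. M w) * nrm f" if z: "z \<in> cball 0 \<rho>" and f: "f \<in> H" for z f
    proof -
      obtain w where w: "w \<in> C" "z \<in> ball w (\<delta> w)" using C z by blast
      have "M w \<le> (\<Sum>w\<in>C. M w)"
        using C \<rho>(2) M by (intro member_le_sum w) (auto intro!: less_imp_le)
      then show ?thesis
        using \<delta>M[of w z f] w z f C \<rho>(2) nrm_nonneg[OF f]
        by (meson mult_right_mono order_trans subsetD)
    qed
    then show ?thesis using that by blast
  qed
  define G where "G = (\<lambda>f g z. ip (Q z f) g)"
  have G_deriv: "(G f g has_field_derivative ip (Q w (T (Q w f))) g) (at w)"
    if w: "w \<in> D" and f: "f \<in> H" and g: "g \<in> H" for f g w
    unfolding has_field_derivative_iff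
  proof -
    let ?h = "T (Q w f)"
    have h: "?h \<in> H" "T (Q w ?h) \<in> H" by (intro T_mem Q_mem w f)+
    have near: "\<forall>\<^sub>F z in at w. z \<in> D \<and> z \<in> ball w (\<delta> w) \<and> z \<noteq> w"
      using \<rho>(4) w \<delta>[OF w] by (intro eventually_conj eventually_at_in_open' eventually_neq_at_within) auto
    have "((\<lambda>z. ip (Q z ?h) g - ip (Q w ?h) g) \<longlongrightarrow> 0) (at w)"
    proof (rule Lim_null_comparison)
      show "\<forall>\<^sub>F z in at w. norm (ip (Q z ?h) g - ip (Q w ?h) g)
          \<le> cmod (z - w) * (M w * nrm (T (Q w ?h)) * nrm g)"
        using near
      proof eventually_elim
        case (elim z)
        have QT: "Q z (T (Q w ?h)) \<in> H" by (intro Q_mem h conjunct1[OF elim])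
        have "ip (Q z ?h) g - ip (Q w ?h) g = ip (\<lambda>x. Q z ?h x - Q w ?h x) g"
          by (rule ip_diff_left[symmetric]) (use elim Q_mem h w g in auto)
        also have "\<dots> = (z - w) * ip (Q z (T (Q w ?h))) g"
          using elim by (simp only: resolvent[OF _ w h(1)] ip_scale_left[OF QT g])
        finally have "norm (ip (Q z ?h) g - ip (Q w ?h) g) = cmod (z - w) * cmod (ip (Q z (T (Q w ?h))) g)"
          by (simp add: norm_mult)
        also have "\<dots> \<le> cmod (z - w) * (nrm (Q z (T (Q w ?h))) * nrm g)"
          by (intro mult_left_mono cauchy_schwarz QT g) auto
        also have "\<dots> \<le> cmod (z - w) * (M w * nrm (T (Q w ?h)) * nrm g)"
          using elim by (intro mult_left_mono mult_right_mono \<delta>M nrm_nonneg g h w) auto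
        finally show ?case .
      qed
      show "((\<lambda>z. cmod (z - w) * (M w * nrm (T (Q w ?h)) * nrm g)) \<longlongrightarrow> 0) (at w)"
        by (auto intro!: tendsto_eq_intros)
    qed
    then have "((\<lambda>z. ip (Q z ?h) g) \<longlongrightarrow> ip (Q w ?h) g) (at w)"
      by (rule LIM_zero_cancel)
    moreover have "\<forall>\<^sub>F z in at w. ip (Q z ?h) g = (G f g z - G f g w) / (z - w)"
      using near
    proof eventually_elim
      case (elim z)
      have QT: "Q z ?h \<in> H" by (intro Q_mem h conjunct1[OF elim])
      have "G f g z - G f g w = ip (\<lambda>x. Q z f x - Q w f x) g"
        unfolding G_def by (rule ip_diff_left[symmetric]) (use elim Q_mem f w g in auto)
      also have "\<dots> = (z - w) * ip (Q z ?h) g"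
        using elim by (simp only: resolvent[OF _ w f] ip_scale_left[OF QT g])
      finally show ?case using elim by simp
    qed
    ultimately show "((\<lambda>z. (G f g z - G f g w) / (z - w)) \<longlongrightarrow> ip (Q w ?h) g) (at w)"
      by (rule Lim_transform_eventually)
  qed
  then have G_hol: "G f g holomorphic_on D" if "f \<in> H" "g \<in> H" for f g
    using that \<rho>(4) holomorphic_on_open by blast
  have coeff: "fps_nth (fps_expansion (G f g) 0) n = ip ((T ^^ n) f) g" if "f \<in> H" "g \<in> H" for f g n
    using that(1)
  proof (induction n arbitrary: f)
    case 0
    have "Q 0 f = f" using Q_left[OF \<rho>(3) 0] by simp
    then show ?case by (simp add: fps_expansion_def G_def)
  next
    case (Suc n)
    note f = Suc.prems
    have expansion: "G f g has_fps_expansion fps_expansion (G f g) 0" if "f \<in> H" for f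
      by (rule has_fps_expansion_fps_expansion[OF \<rho>(4,3) G_hol[OF that \<open>g \<in> H\<close>]])
    have "(\<lambda>z. ip f g + z * G (T f) g z) has_fps_expansion
        fps_const (ip f g) + fps_X * fps_expansion (G (T f) g) 0"
      by (intro fps_expansion_intros expansion T_mem f)
    moreover have ev: "\<forall>\<^sub>F z in nhds 0. ip f g + z * G (T f) g z = G f g z"
    proof -
      have "\<forall>\<^sub>F z in nhds 0. z \<in> D" using \<rho>(3,4) by (rule eventually_nhds_in_open[rotated])
      then show ?thesis
      proof eventually_elim
        case (elim z)
        \<comment> \<open>the recursion \<open>Q z f = f + z Q z (T f)\<close> shifts Taylor coefficients\<close>
        have "f = Q z (\<lambda>x. f x - z * T f x)" by (rule Q_left[OF elim f, symmetric])
        also have "\<dots> = (\<lambda>x. Q z f x - Q z (\<lambda>x. z * T f x) x)"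
          by (rule bounded_operator_diff[OF Q[OF elim] f scale_mem[OF T_mem[OF f]]])
        also have "\<dots> = (\<lambda>x. Q z f x - z * Q z (T f) x)"
          by (simp only: bounded_operatorD(3)[OF Q[OF elim] T_mem[OF f]])
        finally have "ip f g = ip (\<lambda>x. Q z f x - z * Q z (T f) x) g" by simp
        also have "\<dots> = G f g z - z * G (T f) g z"
          unfolding G_def using Q_mem[OF elim f] Q_mem[OF elim T_mem[OF f]] that(2)
          by (simp add: ip_diff_left scale_mem ip_scale_left)
        finally show ?case by simp
      qed
    qed
    ultimately have "G f g has_fps_expansion
        fps_const (ip f g) + fps_X * fps_expansion (G (T f) g) 0"
      using has_fps_expansion_cong[OF ev refl] by simp
    from fps_nth_fps_expansion[OF this, of "Suc n"]
    have "(deriv ^^ Suc n) (G f g) 0 / fact (Suc n) = fps_nth (fps_expansion (G (T f) g) 0) n"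
      by simp
    then show ?case
      using Suc.IH[OF T_mem[OF f]] fps_nth_fps_expansion[OF expansion[OF f], of "Suc n"]
      by (simp only: funpow_Suc_right o_apply)
  qed
  have "cmod (ip ((T ^^ n) f) g) \<le> K * r ^ n * nrm f * nrm g" if f: "f \<in> H" and g: "g \<in> H" for n f g
  proof -
    have "norm ((deriv ^^ n) (G f g) 0) \<le> fact n * (K * nrm f * nrm g) / \<rho> ^ n"
    proof (rule Cauchy_inequality)
      show "G f g holomorphic_on ball 0 \<rho>"
        by (rule holomorphic_on_subset[OF G_hol[OF f g]]) (use \<rho>(2) in auto)
      show "continuous_on (cball 0 \<rho>) (G f g)"
        by (rule holomorphic_on_imp_continuous_on, rule holomorphic_on_subset[OF G_hol[OF f g] \<rho>(2)])
      fix z :: complex assume "norm (0 - z) = \<rho>"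
      then have z: "z \<in> cball 0 \<rho>" by simp
      have "norm (G f g z) \<le> nrm (Q z f) * nrm g"
        unfolding G_def by (rule cauchy_schwarz) (use Q_mem \<rho>(2) z f g in auto)
      also have "\<dots> \<le> K * nrm f * nrm g" by (intro mult_right_mono K z f nrm_nonneg g)
      finally show "norm (G f g z) \<le> K * nrm f * nrm g" .
    qed (fact \<rho>(1))
    then have "norm ((deriv ^^ n) (G f g) 0) / fact n \<le> K * nrm f * nrm g / \<rho> ^ n"
      by (simp add: divide_le_eq mult.commute)
    moreover have "ip ((T ^^ n) f) g = (deriv ^^ n) (G f g) 0 / fact n"
      using coeff[OF f g, of n] by (simp add: fps_expansion_def)
    ultimately show ?thesis
      using r by (simp add: norm_divide \<rho>_def power_one_over mult.commute mult.left_commute)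
  qed
  then show ?thesis using that by blast
qed

end

section \<open>Representation of functionals given on a subspace\<close>

context hilbert_function_space
begin

text \<open>Riesz representation for a bounded conjugate-linear functional on a subspace, given by its
  graph \<open>V\<close>. Working with the graph avoids having to show first that the value depends only on the
  vector and not on the linear combination that represents it. The representing vector is the
  minimiser of \<open>\<parallel>g\<parallel>\<^sup>2 - 2 Re v\<close>: by the parallelogram law every minimising sequence is Cauchy. It
  lies in the closure of the subspace, which gives the norm bound.\<close>

lemma riesz_on_subspace:
  fixes V :: "(('a \<Rightarrow> complex) \<times> complex) set"
  assumes zero: "((\<lambda>_. 0), 0) \<in> V"
    and add: "\<And>g v g' v'. (g, v) \<in> V \<Longrightarrow> (g', v') \<in> V \<Longrightarrow> (\<lambda>x. g x + g' x, v + v') \<in> V"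
    and scale: "\<And>c g v. (g, v) \<in> V \<Longrightarrow> (\<lambda>x. c * g x, cnj c * v) \<in> V"
    and mem: "\<And>g v. (g, v) \<in> V \<Longrightarrow> g \<in> H"
    and bound: "\<And>g v. (g, v) \<in> V \<Longrightarrow> cmod v \<le> C * nrm g"
    and C: "0 \<le> C"
  shows "\<exists>h\<in>H. nrm h \<le> C \<and> (\<forall>(g, v)\<in>V. ip h g = v)"
proof -
  define J where "J = (\<lambda>(g, v). (nrm g)\<^sup>2 - 2 * Re v)"
  define I where "I = Inf (J ` V)"
  have bdd: "bdd_below (J ` V)"
  proof (rule bdd_belowI2)
    fix p assume p: "p \<in> V"
    obtain g v where gv: "p = (g, v)" by force
    have "2 * Re v \<le> 2 * (C * nrm g)"
      using bound[of g v] p gv complex_Re_le_cmod[of v] by simp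
    moreover have "0 \<le> (nrm g - C)\<^sup>2" by simp
    ultimately show "- C\<^sup>2 \<le> J p"
      by (simp add: J_def gv power2_diff algebra_simps)
  qed
  have I_le: "I \<le> J p" if "p \<in> V" for p
    unfolding I_def using bdd that by (intro cINF_lower)
  have "\<exists>p\<in>V. J p < I + 1 / Suc n" for n
  proof (rule ccontr)
    assume "\<not> ?thesis"
    then have "I + 1 / Suc n \<le> I"
      unfolding I_def using zero by (intro cINF_greatest) (auto simp: not_less)
    then show False by simp
  qed
  then obtain p where p: "\<And>n. p n \<in> V" "\<And>n. J (p n) < I + 1 / Suc n" by metis
  define g where "g = (\<lambda>n. fst (p n))"
  define v where "v = (\<lambda>n. snd (p n))"
  have gv: "(g n, v n) \<in> V" for n using p(1) by (simp add: g_def v_def)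
  have J_gv: "(nrm (g n))\<^sup>2 - 2 * Re (v n) < I + 1 / Suc n" for n
    using p(2)[of n] by (simp add: J_def g_def v_def split: prod.splits)
  have g: "g n \<in> H" for n using mem[OF gv] .
  have dist: "(nrm (\<lambda>x. g m x - g n x))\<^sup>2 \<le> 2 / Suc m + 2 / Suc n" for m n
  proof -
    \<comment> \<open>the midpoint competes with \<open>g m\<close> and \<open>g n\<close>\<close>
    have "(\<lambda>x. (1/2) * (g m x + g n x), cnj (1/2) * (v m + v n)) \<in> V"
      by (intro scale add gv)
    from I_le[OF this] have "I \<le> (nrm (\<lambda>x. (1/2) * (g m x + g n x)))\<^sup>2 - Re (v m + v n)"
      by (simp add: J_def add_divide_distrib)
    also have "(nrm (\<lambda>x. (1/2) * (g m x + g n x)))\<^sup>2 = (nrm (\<lambda>x. g m x + g n x))\<^sup>2 / 4"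
      by (subst nrm_scale[OF add_mem[OF g g]]) (simp add: power_mult_distrib power_divide)
    finally have "4 * I \<le> (nrm (\<lambda>x. g m x + g n x))\<^sup>2 - 4 * Re (v m + v n)" by simp
    moreover have "(nrm (\<lambda>x. g m x + g n x))\<^sup>2 + (nrm (\<lambda>x. g m x - g n x))\<^sup>2
        = 2 * (nrm (g m))\<^sup>2 + 2 * (nrm (g n))\<^sup>2"
      using g by (simp add: nrm_power2 add_mem diff_mem ip_add_left ip_add_right ip_diff_left ip_diff_right)
    ultimately show ?thesis using J_gv[of m] J_gv[of n] by (simp add: algebra_simps)
  qed
  have "\<exists>h\<in>H. (\<lambda>n. nrm (\<lambda>x. g n x - h x)) \<longlonglongrightarrow> 0"
  proof (rule complete[OF g])
    fix e :: real assume e: "e > 0"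
    obtain N where N: "inverse (Suc N) < e\<^sup>2 / 4" using reals_Archimedean[of "e\<^sup>2 / 4"] e by auto
    have "nrm (\<lambda>x. g m x - g n x) < e" if "m \<ge> N" "n \<ge> N" for m n
    proof (rule power2_less_imp_less)
      have "1 / Suc m \<le> inverse (Suc N)" "1 / Suc n \<le> inverse (Suc N)"
        using that by (auto simp: divide_simps)
      then show "(nrm (\<lambda>x. g m x - g n x))\<^sup>2 < e\<^sup>2"
        using dist[of m n] N by simp
    qed (use e in simp)
    then show "\<exists>N. \<forall>m\<ge>N. \<forall>n\<ge>N. nrm (\<lambda>x. g m x - g n x) < e" by blast
  qed
  then obtain h where h: "h \<in> H" "(\<lambda>n. nrm (\<lambda>x. g n x - h x)) \<longlonglongrightarrow> 0" by blast
  have variation: "- (nrm k)\<^sup>2 \<le> 2 * Re (ip h k - w)" if kw: "(k, w) \<in> V" for k w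
  proof -
    have k: "k \<in> H" using mem[OF kw] .
    have "- (nrm k)\<^sup>2 - 1 / Suc n \<le> 2 * Re (ip (g n) k - w)" for n
    proof -
      have "(\<lambda>x. g n x + k x, v n + w) \<in> V" by (intro add gv kw)
      from I_le[OF this] have "I \<le> (nrm (\<lambda>x. g n x + k x))\<^sup>2 - 2 * Re (v n + w)"
        by (simp add: J_def)
      also have "(nrm (\<lambda>x. g n x + k x))\<^sup>2 = (nrm (g n))\<^sup>2 + 2 * Re (ip (g n) k) + (nrm k)\<^sup>2"
        using g k ip_commute[OF g k]
        by (simp add: nrm_power2 add_mem ip_add_left ip_add_right)
      finally show ?thesis using J_gv[of n] by simp
    qed
    moreover have "(\<lambda>n. - (nrm k)\<^sup>2 - 1 / Suc n) \<longlonglongrightarrow> - (nrm k)\<^sup>2 - 0"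
      by (intro tendsto_intros lim_1_over_n[THEN filterlim_compose] LIMSEQ_Suc[OF lim_1_over_n])
    moreover have "(\<lambda>n. 2 * Re (ip (g n) k - w)) \<longlonglongrightarrow> 2 * Re (ip h k - w)"
      by (intro tendsto_intros ip_tendsto_left g h k)
    ultimately show ?thesis using LIMSEQ_le[of _ "- (nrm k)\<^sup>2 - 0"] by fastforce
  qed
  have represents: "ip h k = w" if kw: "(k, w) \<in> V" for k w
  proof (rule ccontr)
    assume "ip h k \<noteq> w"
    define u where "u = ip h k - w"
    have u: "cmod u > 0" using \<open>ip h k \<noteq> w\<close> by (simp add: u_def)
    have k: "k \<in> H" using mem[OF kw] .
    \<comment> \<open>a step so short that the quadratic term cannot compensate the linear gain\<close>
    define s where "s = 1 / (1 + (nrm k)\<^sup>2)"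
    have s: "s > 0" "s * (nrm k)\<^sup>2 < 1" by (auto simp: s_def divide_simps add_pos_nonneg)
    define c where "c = - of_real s * u"
    have "(\<lambda>x. c * k x, cnj c * w) \<in> V" by (rule scale[OF kw])
    from variation[OF this] have "- (cmod c * nrm k)\<^sup>2 \<le> 2 * Re (cnj c * u)"
      using k h(1) by (simp add: nrm_scale ip_scale_right u_def algebra_simps)
    moreover have "cnj c * u = - of_real (s * (cmod u)\<^sup>2)"
      using complex_norm_square[of u] by (simp add: c_def mult.commute)
    moreover have "cmod c = s * cmod u" using s by (simp add: c_def norm_mult)
    ultimately have "- ((s * cmod u * nrm k)\<^sup>2) \<le> - 2 * (s * (cmod u)\<^sup>2)" by simp
    then have "2 * (s * (cmod u)\<^sup>2) \<le> (s * (cmod u)\<^sup>2) * (s * (nrm k)\<^sup>2)"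
      by (simp add: power2_eq_square algebra_simps)
    also have "\<dots> \<le> (s * (cmod u)\<^sup>2) * 1"
      using s by (intro mult_left_mono) auto
    finally show False using s u by simp
  qed
  have "nrm h * nrm h \<le> C * nrm h"
  proof -
    have "cmod (ip h (g n)) \<le> C * nrm (g n)" for n
      using represents[OF gv] bound[OF gv] by simp
    moreover have "(\<lambda>n. ip h (g n)) \<longlonglongrightarrow> ip h h"
    proof -
      have "(\<lambda>n. cnj (ip (g n) h)) \<longlonglongrightarrow> cnj (ip h h)"
        by (intro tendsto_intros ip_tendsto_left g h)
      then show ?thesis using ip_commute[OF g h(1)] ip_commute[OF h(1) h(1)] by simp
    qed
    ultimately have "cmod (ip h h) \<le> C * nrm h"
      using LIMSEQ_le[OF tendsto_norm tendsto_mult_left[OF nrm_tendsto[OF g h]]] by blast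
    then show ?thesis
      using ip_self[OF h(1)] by (simp add: norm_power power2_eq_square norm_mult)
  qed
  then have "nrm h \<le> C"
    using nrm_nonneg[OF h(1)] C by (cases "nrm h = 0") (auto simp: mult_le_cancel_right)
  then show ?thesis using h(1) represents by blast
qed

end

section \<open>Positive kernels\<close>

text \<open>Points may repeat in the families that are tested; this makes positivity stable under
  composition with maps that are not injective. Only the real part is tested; Hermitian symmetry is
  a separate assumption of the one lemma that relies on it.\<close>

definition positive_kernel :: "'a set \<Rightarrow> ('a \<Rightarrow> 'a \<Rightarrow> complex) \<Rightarrow> bool" where
  "positive_kernel X K \<longleftrightarrow> (\<forall>(n::nat) x c. (\<forall>i<n. x i \<in> X) \<longrightarrow>
     0 \<le> Re (\<Sum>i<n. \<Sum>j<n. c i * cnj (c j) * K (x i) (x j)))"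

lemma positive_kernelI:
  assumes "\<And>(n::nat) x c. \<forall>i<n. x i \<in> X \<Longrightarrow>
     0 \<le> Re (\<Sum>i<n. \<Sum>j<n. c i * cnj (c j) * K (x i) (x j))"
  shows "positive_kernel X K"
  using assms unfolding positive_kernel_def by blast

lemma positive_kernelD:
  fixes n :: nat
  assumes "positive_kernel X K" "\<forall>i<n. x i \<in> X"
  shows "0 \<le> Re (\<Sum>i<n. \<Sum>j<n. c i * cnj (c j) * K (x i) (x j))"
  using assms unfolding positive_kernel_def by blast

lemma positive_kernel_cong:
  assumes "\<And>x y. x \<in> X \<Longrightarrow> y \<in> X \<Longrightarrow> K x y = L x y"
  shows "positive_kernel X K \<longleftrightarrow> positive_kernel X L"
proof -
  have "(\<Sum>i<n. \<Sum>j<n. c i * cnj (c j) * K (x i) (x j)) =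
      (\<Sum>i<n. \<Sum>j<n. c i * cnj (c j) * L (x i) (x j))" if "\<forall>i<n. x i \<in> X" for n :: nat and x c
    using assms that by (intro sum.cong refl) auto
  then show ?thesis unfolding positive_kernel_def by (metis (no_types, lifting))
qed

lemma positive_kernel_congD:
  assumes "positive_kernel X K" "\<And>x y. x \<in> X \<Longrightarrow> y \<in> X \<Longrightarrow> K x y = L x y"
  shows "positive_kernel X L"
  using positive_kernel_cong[of X K L] assms by blast

lemma positive_kernel_zero: "positive_kernel X (\<lambda>x y. 0)"
  by (simp add: positive_kernel_def)

lemma positive_kernel_add:
  assumes "positive_kernel X K" "positive_kernel X L"
  shows "positive_kernel X (\<lambda>x y. K x y + L x y)"
proof (rule positive_kernelI)
  fix n :: nat and x c assume x: "\<forall>i<n. x i \<in> X"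
  from positive_kernelD[OF assms(1) x, of c] positive_kernelD[OF assms(2) x, of c]
  show "0 \<le> Re (\<Sum>i<n. \<Sum>j<n. c i * cnj (c j) * (K (x i) (x j) + L (x i) (x j)))"
    by (simp only: distrib_left sum.distrib plus_complex.simps add_nonneg_nonneg)
qed

lemma positive_kernel_sum:
  "(\<And>k. k \<in> I \<Longrightarrow> positive_kernel X (K k)) \<Longrightarrow> positive_kernel X (\<lambda>x y. \<Sum>k\<in>I. K k x y)"
  by (induction I rule: infinite_finite_induct)
    (auto intro: positive_kernel_zero positive_kernel_add)

lemma positive_kernel_rank_one_mult:
  assumes "positive_kernel X K"
  shows "positive_kernel X (\<lambda>x y. g x * cnj (g y) * K x y)"
proof (rule positive_kernelI)
  fix n :: nat and x c assume x: "\<forall>i<n. x i \<in> X"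
  from positive_kernelD[OF assms x, of "\<lambda>i. c i * g (x i)"]
  show "0 \<le> Re (\<Sum>i<n. \<Sum>j<n. c i * cnj (c j) * (g (x i) * cnj (g (x j)) * K (x i) (x j)))"
    by (simp only: complex_cnj_mult ac_simps)
qed

lemma positive_kernel_compose:
  assumes "positive_kernel Y K" "\<psi> ` X \<subseteq> Y"
  shows "positive_kernel X (\<lambda>x y. K (\<psi> x) (\<psi> y))"
proof (rule positive_kernelI)
  fix n :: nat and x c assume x: "\<forall>i<n. x i \<in> X"
  then show "0 \<le> Re (\<Sum>i<n. \<Sum>j<n. c i * cnj (c j) * K (\<psi> (x i)) (\<psi> (x j)))"
    using positive_kernelD[OF assms(1), of n "\<lambda>i. \<psi> (x i)" c] assms(2) x by fast
qed

lemma positive_kernel_limit: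
  assumes "\<And>N. positive_kernel X (K N)"
    and "\<And>x y. x \<in> X \<Longrightarrow> y \<in> X \<Longrightarrow> (\<lambda>N. K N x y) \<longlonglongrightarrow> L x y"
  shows "positive_kernel X L"
proof (rule positive_kernelI)
  fix n :: nat and x c assume x: "\<forall>i<n. x i \<in> X"
  have "(\<lambda>N. Re (\<Sum>i<n. \<Sum>j<n. c i * cnj (c j) * K N (x i) (x j)))
      \<longlonglongrightarrow> Re (\<Sum>i<n. \<Sum>j<n. c i * cnj (c j) * L (x i) (x j))"
    using x by (intro tendsto_intros assms(2)) auto
  then show "0 \<le> Re (\<Sum>i<n. \<Sum>j<n. c i * cnj (c j) * L (x i) (x j))"
    by (rule LIMSEQ_le_const) (use positive_kernelD[OF assms(1) x] in blast)
qed

lemma positive_kernel_one: "positive_kernel X (\<lambda>x y. 1)"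
proof (rule positive_kernelI)
  fix n :: nat and x :: "nat \<Rightarrow> 'a" and c
  have "(\<Sum>i<n. \<Sum>j<n. c i * cnj (c j) * 1) = (\<Sum>i<n. c i) * cnj (\<Sum>i<n. c i)"
    by (simp add: sum_product)
  also have "\<dots> = of_real ((cmod (\<Sum>i<n. c i))\<^sup>2)" by (simp only: complex_norm_square)
  finally show "0 \<le> Re (\<Sum>i<n. \<Sum>j<n. c i * cnj (c j) * 1)" by simp
qed

lemma positive_kernel_rank_one: "positive_kernel X (\<lambda>x y. g x * cnj (g y))"
  using positive_kernel_rank_one_mult[OF positive_kernel_one, where g = g] by simp

lemma positive_kernel_scale:
  assumes "positive_kernel X K" "0 \<le> a"
  shows "positive_kernel X (\<lambda>x y. of_real a * K x y)"
  using positive_kernel_rank_one_mult[OF assms(1), where g = "\<lambda>_. of_real (sqrt a)"] assms(2)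
  by (simp flip: of_real_mult)

text \<open>Testing \<open>S\<close> on the given points together with \<open>p\<close>, where the weight of \<open>p\<close> is chosen to
  minimise the quadratic form, leaves exactly the form of the complement.\<close>

lemma positive_kernel_schur_complement:
  assumes S: "positive_kernel X S" and herm: "\<And>x y. x \<in> X \<Longrightarrow> y \<in> X \<Longrightarrow> S y x = cnj (S x y)"
    and p: "p \<in> X" "S p p = 1"
  shows "positive_kernel X (\<lambda>x y. S x y - S x p * S p y)"
proof (rule positive_kernelI)
  fix n :: nat and x c assume x: "\<forall>i<n. x i \<in> X"
  define a where "a = (\<Sum>i<n. c i * S (x i) p)"
  define Q where "Q = (\<Sum>i<n. \<Sum>j<n. c i * cnj (c j) * S (x i) (x j))"
  define x' where "x' = (\<lambda>i. if i < n then x i else p)"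
  define c' where "c' = (\<lambda>i. if i < n then c i else - a)"
  have cnj_a: "cnj a = (\<Sum>j<n. cnj (c j) * S p (x j))"
  proof -
    have "S p (x j) = cnj (S (x j) p)" if "j < n" for j by (rule herm) (use p x that in auto)
    then show ?thesis by (simp add: a_def)
  qed
  have "(\<Sum>i<Suc n. \<Sum>j<Suc n. c' i * cnj (c' j) * S (x' i) (x' j)) =
      Q + (\<Sum>i<n. c i * cnj (- a) * S (x i) p) + ((\<Sum>j<n. - a * cnj (c j) * S p (x j)) + a * cnj a)"
    by (simp add: x'_def c'_def Q_def sum.distrib sum_negf sum_subtractf p(2))
  also have "(\<Sum>i<n. c i * cnj (- a) * S (x i) p) = - (cnj a * a)"
    unfolding a_def[symmetric] by (subst (3) a_def) (simp add: sum_distrib_left sum_negf ac_simps)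
  also have "(\<Sum>j<n. - a * cnj (c j) * S p (x j)) = - (a * cnj a)"
    unfolding cnj_a by (simp add: sum_distrib_left sum_negf ac_simps)
  finally have "(\<Sum>i<Suc n. \<Sum>j<Suc n. c' i * cnj (c' j) * S (x' i) (x' j)) = Q - a * cnj a"
    by simp
  also have "a * cnj a = (\<Sum>i<n. \<Sum>j<n. c i * cnj (c j) * (S (x i) p * S p (x j)))"
    unfolding cnj_a unfolding a_def by (simp add: sum_product ac_simps)
  finally have "(\<Sum>i<Suc n. \<Sum>j<Suc n. c' i * cnj (c' j) * S (x' i) (x' j)) =
      (\<Sum>i<n. \<Sum>j<n. c i * cnj (c j) * (S (x i) (x j) - S (x i) p * S p (x j)))"
    by (simp add: Q_def right_diff_distrib sum_subtractf)
  moreover have "0 \<le> Re (\<Sum>i<Suc n. \<Sum>j<Suc n. c' i * cnj (c' j) * S (x' i) (x' j))"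
    by (rule positive_kernelD[OF S]) (use x p in \<open>auto simp: x'_def\<close>)
  ultimately show "0 \<le> Re (\<Sum>i<n. \<Sum>j<n. c i * cnj (c j) * (S (x i) (x j) - S (x i) p * S p (x j)))"
    by simp
qed

text \<open>The kernels whose product with every positive kernel is positive. By Schur's product theorem
  every Hermitian positive kernel has this property; the kernels needed as factors below are limits of sums
  of rank-one kernels, and for these it is immediate from the closure properties.\<close>

definition schur_multiplier :: "'a set \<Rightarrow> ('a \<Rightarrow> 'a \<Rightarrow> complex) \<Rightarrow> bool" where
  "schur_multiplier X K \<longleftrightarrow>
     (\<forall>L. positive_kernel X L \<longrightarrow> positive_kernel X (\<lambda>x y. K x y * L x y))"

lemma schur_multiplierD:
  "schur_multiplier X K \<Longrightarrow> positive_kernel X L \<Longrightarrow> positive_kernel X (\<lambda>x y. K x y * L x y)"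
  by (simp add: schur_multiplier_def)

lemma schur_multiplier_one: "schur_multiplier X (\<lambda>x y. 1)"
  by (simp add: schur_multiplier_def)

lemma schur_multiplier_rank_one: "schur_multiplier X (\<lambda>x y. g x * cnj (g y))"
  by (simp add: schur_multiplier_def positive_kernel_rank_one_mult)

lemma schur_multiplier_mult:
  "schur_multiplier X K \<Longrightarrow> schur_multiplier X L \<Longrightarrow> schur_multiplier X (\<lambda>x y. K x y * L x y)"
  by (simp add: schur_multiplier_def mult.assoc)

lemma schur_multiplier_sum:
  "(\<And>k. k \<in> I \<Longrightarrow> schur_multiplier X (K k)) \<Longrightarrow> schur_multiplier X (\<lambda>x y. \<Sum>k\<in>I. K k x y)"
  by (simp add: schur_multiplier_def sum_distrib_right positive_kernel_sum)

lemma schur_multiplier_power: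
  "schur_multiplier X K \<Longrightarrow> schur_multiplier X (\<lambda>x y. K x y ^ n)"
  by (induction n) (auto intro: schur_multiplier_one schur_multiplier_mult)

lemma schur_multiplier_limit:
  assumes "\<And>N. schur_multiplier X (K N)"
    and "\<And>x y. x \<in> X \<Longrightarrow> y \<in> X \<Longrightarrow> (\<lambda>N. K N x y) \<longlonglongrightarrow> L x y"
  shows "schur_multiplier X L"
  unfolding schur_multiplier_def
proof (intro allI impI)
  fix M assume M: "positive_kernel X M"
  show "positive_kernel X (\<lambda>x y. L x y * M x y)"
    by (rule positive_kernel_limit[where K = "\<lambda>N x y. K N x y * M x y"])
      (auto intro!: schur_multiplierD[OF assms(1) M] tendsto_mult assms(2))
qed

text \<open>From \<open>a\<^sup>n - b\<^sup>n = (a - b) \<Sum> a\<^sup>i b\<^sup>j\<close>. This is where the integrality of \<open>\<beta>\<close> enters.\<close>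

lemma positive_kernel_power_diff:
  assumes "schur_multiplier X K" "schur_multiplier X L" "positive_kernel X (\<lambda>x y. K x y - L x y)"
  shows "positive_kernel X (\<lambda>x y. K x y ^ n - L x y ^ n)"
proof -
  have "schur_multiplier X (\<lambda>x y. \<Sum>i<n. L x y ^ (n - Suc i) * K x y ^ i)"
    by (intro schur_multiplier_sum schur_multiplier_mult schur_multiplier_power assms)
  from schur_multiplierD[OF this assms(3)] show ?thesis
    by (simp add: power_diff_sumr2 mult.commute)
qed

section \<open>The Drury-Arveson kernel\<close>

lemma hinner_add_left: "hinner (x + y) z = hinner x z + hinner y z"
  by (simp add: hinner_def distrib_right sum.distrib)

lemma hinner_scale_left: "hinner (c *s x) y = c * hinner x y"
  by (simp add: hinner_def sum_distrib_left mult.assoc)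

lemma hinner_commute: "hinner y x = cnj (hinner x y)"
  by (simp add: hinner_def mult.commute)

lemma hinner_add_right: "hinner z (x + y) = hinner z x + hinner z y"
  by (simp add: hinner_def distrib_left sum.distrib)

lemma hinner_scale_right: "hinner x (c *s y) = cnj c * hinner x y"
  by (simp add: hinner_def sum_distrib_left ac_simps)

lemma hinner_zero [simp]: "hinner 0 x = 0" "hinner x 0 = 0"
  by (simp_all add: hinner_def)

lemma hinner_self: "hinner x x = of_real ((norm x)\<^sup>2)"
proof -
  have "(norm x)\<^sup>2 = (\<Sum>i\<in>UNIV. (cmod (x $ i))\<^sup>2)"
    by (simp add: norm_vec_def L2_set_def sum_nonneg)
  then show ?thesis
    by (simp only: hinner_def complex_norm_square of_real_sum)
qed

lemma norm_hinner_le: "cmod (hinner x y) \<le> norm x * norm y"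
proof -
  have "cmod (hinner x y) \<le> (\<Sum>i\<in>UNIV. \<bar>cmod (x $ i)\<bar> * \<bar>cmod (y $ i)\<bar>)"
    unfolding hinner_def by (rule order_trans[OF norm_sum]) (simp add: norm_mult)
  also have "\<dots> \<le> norm x * norm y"
    unfolding norm_vec_def by (rule L2_set_mult_ineq)
  finally show ?thesis .
qed

lemma norm_hinner_less_1:
  assumes "z \<in> ball 0 1" "norm w \<le> 1"
  shows "cmod (hinner z w) < 1"
  using norm_hinner_le[of z w] mult_left_le[of "norm w" "norm z"] assms by simp

lemma one_minus_hinner_nonzero:
  assumes "z \<in> ball 0 1" "norm w \<le> 1"
  shows "1 - hinner z w \<noteq> 0"
  using norm_hinner_less_1[OF assms] by (metis eq_iff_diff_eq_0 less_irrefl norm_one)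

abbreviation drury_arveson :: "complex^'m \<Rightarrow> complex^'m \<Rightarrow> complex" where
  "drury_arveson z w \<equiv> inverse (1 - hinner z w)"

lemma ball_kernel_eq_power: "ball_kernel \<beta> z w = drury_arveson z w ^ \<beta>"
  by (simp add: ball_kernel_def power_inverse)

text \<open>The geometric series writes the kernel as a limit of sums of powers of
  \<open>\<Sum> \<psi>(x)\<^sub>i \<psi>(y)\<^sub>i\<^sup>*\<close>.\<close>

lemma schur_multiplier_drury_arveson:
  assumes "\<psi> ` X \<subseteq> ball 0 1"
  shows "schur_multiplier X (\<lambda>x y. drury_arveson (\<psi> x) (\<psi> y))"
proof (rule schur_multiplier_limit)
  show "schur_multiplier X (\<lambda>x y. \<Sum>n<N. hinner (\<psi> x) (\<psi> y) ^ n)" for N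
    unfolding hinner_def
    by (intro schur_multiplier_sum schur_multiplier_power schur_multiplier_rank_one)
next
  fix x y assume "x \<in> X" "y \<in> X"
  then have "\<psi> x \<in> ball 0 1" "\<psi> y \<in> ball 0 1" using assms by blast+
  then have "cmod (hinner (\<psi> x) (\<psi> y)) < 1"
    by (intro norm_hinner_less_1) auto
  from geometric_sums[OF this]
  show "(\<lambda>N. \<Sum>n<N. hinner (\<psi> x) (\<psi> y) ^ n) \<longlonglongrightarrow> drury_arveson (\<psi> x) (\<psi> y)"
    by (simp add: sums_def divide_inverse)
qed

section \<open>Hermitian forms\<close>

text \<open>The scaling is a parameter because pairs of a complex vector and a complex number carry no
  complex scalar multiplication of their own.\<close>

definition hermitian_form ::
  "(complex \<Rightarrow> 'v::ab_group_add \<Rightarrow> 'v) \<Rightarrow> ('v \<Rightarrow> 'v \<Rightarrow> complex) \<Rightarrow> bool" where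
  "hermitian_form s B \<longleftrightarrow>
     (\<forall>x y z. B (x + y) z = B x z + B y z) \<and>
     (\<forall>c x y. B (s c x) y = c * B x y) \<and>
     (\<forall>x y. B y x = cnj (B x y))"

context
  fixes s :: "complex \<Rightarrow> 'v::ab_group_add \<Rightarrow> 'v" and B :: "'v \<Rightarrow> 'v \<Rightarrow> complex"
  assumes B: "hermitian_form s B"
begin

lemma form_add_left: "B (x + y) z = B x z + B y z"
  and form_scale_left: "B (s c x) y = c * B x y"
  and form_commute: "B y x = cnj (B x y)"
  using B unfolding hermitian_form_def by blast+

lemma form_add_right: "B z (x + y) = B z x + B z y"
  using form_commute[of z] form_add_left by (metis complex_cnj_add)

lemma form_scale_right: "B x (s c y) = cnj c * B x y"
  using form_commute[of x] form_scale_left by (metis complex_cnj_mult)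

lemma form_zero_left: "B 0 x = 0"
  using form_add_left[of 0 0 x] by simp

lemma form_sum_left: "B (\<Sum>i\<in>I. f i) y = (\<Sum>i\<in>I. B (f i) y)"
  by (induction I rule: infinite_finite_induct) (simp_all add: form_zero_left form_add_left)

lemma form_sum_right: "B y (\<Sum>i\<in>I. f i) = (\<Sum>i\<in>I. B y (f i))"
  using form_sum_left[of f I y] form_commute[of y] by simp

lemma form_diff_left: "B (x - y) z = B x z - B y z"
  using form_add_left[of "x - y" y z] by simp

lemma form_diff_right: "B z (x - y) = B z x - B z y"
  using form_add_right[of z "x - y" y] by simp

lemma positive_kernel_of_form:
  assumes nonneg: "\<And>v. 0 \<le> Re (B v v)"
  shows "positive_kernel X (\<lambda>x y. B (e x) (e y))"
proof (rule positive_kernelI)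
  fix n :: nat and x c
  define v where "v = (\<Sum>i<n. s (c i) (e (x i)))"
  have "B v v = (\<Sum>i<n. \<Sum>j<n. c i * cnj (c j) * B (e (x i)) (e (x j)))"
    unfolding v_def
    by (subst form_sum_left)
      (simp add: form_sum_right form_scale_left form_scale_right sum_distrib_left ac_simps)
  then show "0 \<le> Re (\<Sum>i<n. \<Sum>j<n. c i * cnj (c j) * B (e (x i)) (e (x j)))"
    using nonneg[of v] by simp
qed

text \<open>An isotropic vector of a semidefinite form lies in its kernel: otherwise moving along it
  would make the form linear and unbounded below.\<close>

lemma form_isotropic_orthogonal:
  assumes nonneg: "\<And>v. 0 \<le> Re (B v v)" and x: "B x x = 0"
  shows "B y x = 0"
proof (rule ccontr)
  assume "B y x \<noteq> 0"
  define w where "w = B y x"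
  have w: "cmod w > 0" using \<open>B y x \<noteq> 0\<close> by (simp add: w_def)
  have quad: "0 \<le> Re (B y y) - 2 * r * (cmod w)\<^sup>2" for r :: real
  proof -
    \<comment> \<open>the displacement by \<open>c x\<close> changes the form by \<open>- 2 r |w|\<^sup>2\<close>\<close>
    define c where "c = - of_real r * w"
    have "B (y + s c x) (y + s c x) = B y y + (cnj c * w + c * cnj w)"
      using form_commute[of x y] x
      by (simp add: form_add_left form_add_right form_scale_left form_scale_right w_def)
    also have "cnj c * w + c * cnj w = - of_real (2 * r * (cmod w)\<^sup>2)"
      using complex_norm_square[of w] by (simp add: c_def algebra_simps)
    finally show ?thesis using nonneg[of "y + s c x"] by (simp add: add.assoc)
  qed
  have "0 \<le> Re (B y y) - 2 * ((Re (B y y) + 1) / (2 * (cmod w)\<^sup>2)) * (cmod w)\<^sup>2"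
    by (rule quad)
  also have "\<dots> = -1" using w by (simp add: field_simps)
  finally show False by simp
qed

end

lemma hermitian_form_diff_scaled:
  assumes "hermitian_form s F" "hermitian_form s G"
  shows "hermitian_form s (\<lambda>x y. F x y - of_real t * G x y)"
  unfolding hermitian_form_def
proof (intro conjI allI)
  show "F y x - of_real t * G y x = cnj (F x y - of_real t * G x y)" for x y
    by (simp add: form_commute[OF assms(1), of y x] form_commute[OF assms(2), of y x])
qed (simp_all add: form_add_left[OF assms(1)] form_add_left[OF assms(2)]
    form_scale_left[OF assms(1)] form_scale_left[OF assms(2)] algebra_simps)

text \<open>The S-lemma. A suitable \<open>t\<close> exists once every quotient \<open>F y / G y\<close> with \<open>G y < 0\<close> is at most
  every quotient \<open>F x / G x\<close> with \<open>G x > 0\<close>. To compare the two, scale \<open>x\<close> and \<open>y\<close> so that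
  \<open>G x + G y = 0\<close> and rotate \<open>y\<close> by a phase that kills the real part of \<open>G x y\<close>; then \<open>x + y\<close> and \<open>x - y\<close> are both
  isotropic for \<open>G\<close>, hence \<open>F\<close> is nonnegative on them, and the parallelogram law gives
  \<open>F x + F y \<ge> 0\<close>.\<close>

lemma hermitian_s_lemma:
  assumes F: "hermitian_form s F" and G: "hermitian_form s G"
    and slater: "0 < Re (G x\<^sub>0 x\<^sub>0)"
    and imp: "\<And>x. 0 \<le> Re (G x x) \<Longrightarrow> 0 \<le> Re (F x x)"
  obtains t where "0 \<le> t" "\<And>x. t * Re (G x x) \<le> Re (F x x)"
proof -
  let ?f = "\<lambda>x. Re (F x x)" and ?g = "\<lambda>x. Re (G x x)"
  have scale_sq: "Re (B (s c x) (s c x)) = (cmod c)\<^sup>2 * Re (B x x)" if "hermitian_form s B" for B c x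
  proof -
    have "B (s c x) (s c x) = (c * cnj c) * B x x"
      by (simp add: form_scale_left[OF that] form_scale_right[OF that])
    also have "\<dots> = of_real ((cmod c)\<^sup>2) * B x x" by (simp only: complex_norm_square)
    finally show ?thesis by simp
  qed
  have separate: "0 \<le> ?g y' * ?f x + ?g x * ?f y" if x: "0 < ?g x" and y: "?g y < 0" and y': "?g y' = - ?g y"
    for x y y'
  proof -
    define w where "w = G x y"
    \<comment> \<open>the phase that makes the cross term purely imaginary\<close>
    define \<theta> where "\<theta> = (if w = 0 then 1 else \<i> * sgn w)"
    have \<theta>: "cmod \<theta> = 1" by (simp add: \<theta>_def norm_mult norm_sgn)
    have "cnj (sgn w) * w = of_real (cmod w)"
      by (simp add: sgn_eq complex_norm_square[symmetric] power2_eq_square mult.commute[of "cnj w"]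
          divide_simps del: of_real_mult)
        (simp add: complex_norm_square[symmetric] power2_eq_square)
    then have orth: "Re (cnj \<theta> * w) = 0" by (simp add: \<theta>_def mult.assoc)
    define u where "u = s (of_real (sqrt (?g y'))) x"
    define v where "v = s (of_real (sqrt (?g x)) * \<theta>) y"
    have "G u v = of_real (sqrt (?g y') * sqrt (?g x)) * (cnj \<theta> * w)"
      by (simp add: u_def v_def form_scale_left[OF G] form_scale_right[OF G] w_def)
    then have Guv: "Re (G u v) = 0" using orth by (simp add: Re_complex_of_real del: of_real_mult)
    have "?g u + ?g v = 0"
      unfolding u_def v_def scale_sq[OF G] using \<theta> x y y' by (simp add: norm_mult)
    then have "?g (u + v) = 0" "?g (u - v) = 0"
      using Guv form_commute[OF G, of v u]
      by (simp_all add: form_add_left[OF G] form_add_right[OF G] form_diff_left[OF G] form_diff_right[OF G])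
    then have "0 \<le> ?f (u + v) + ?f (u - v)" using imp[of "u + v"] imp[of "u - v"] by simp
    also have "\<dots> = 2 * (?f u + ?f v)"
      by (simp add: form_add_left[OF F] form_add_right[OF F] form_diff_left[OF F] form_diff_right[OF F])
    finally show ?thesis
      unfolding u_def v_def scale_sq[OF F] using \<theta> x y y' by (simp add: norm_mult)
  qed
  define R where "R = (\<lambda>x. ?f x / ?g x) ` {x. 0 < ?g x}"
  define t where "t = Inf R"
  have R_nonneg: "0 \<le> r" if "r \<in> R" for r
    using that imp unfolding R_def by (auto intro: divide_nonneg_pos)
  have R_ne: "R \<noteq> {}" using slater by (auto simp: R_def)
  have R_bdd: "bdd_below R" using R_nonneg unfolding bdd_below_def by blast
  have "0 \<le> t" unfolding t_def by (rule cInf_greatest[OF R_ne R_nonneg])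
  moreover have "t * ?g y \<le> ?f y" for y
  proof (cases "?g y" "0::real" rule: linorder_cases)
    case less
    have "?f y / ?g y \<le> r" if r: "r \<in> R" for r
    proof -
      obtain x where x: "0 < ?g x" "r = ?f x / ?g x" using r unfolding R_def by blast
      obtain y' where y': "?g y' = - ?g y"
      proof
        show "?g (s (of_real (sqrt (- ?g y / ?g x))) x) = - ?g y"
          unfolding scale_sq[OF G] using x less by (simp add: divide_nonpos_pos)
      qed
      have "(r * ?g y) * ?g x \<le> ?f y * ?g x"
        using separate[OF x(1) less y'] x y' by (simp add: algebra_simps)
      then have "r * ?g y \<le> ?f y" using x(1) by (rule mult_right_le_imp_le)
      then show ?thesis using less by (simp add: neg_divide_le_eq)
    qed
    then have "?f y / ?g y \<le> t" unfolding t_def by (rule cInf_greatest[OF R_ne])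
    then show ?thesis using less by (simp add: divide_simps)
  next
    case equal
    then show ?thesis using imp[of y] by simp
  next
    case greater
    then have "t \<le> ?f y / ?g y"
      unfolding t_def using R_bdd by (intro cInf_lower) (auto simp: R_def)
    then show ?thesis using greater by (simp add: field_simps)
  qed
  ultimately show ?thesis using that by blast
qed

section \<open>Multiplication by affine functions\<close>

lemma schur_multiplier_drury_arveson_ball: "schur_multiplier (ball 0 1) drury_arveson"
  using schur_multiplier_drury_arveson[of "\<lambda>z. z" "ball 0 1"] by simp

text \<open>Multiplication by \<open>z \<mapsto> \<langle>z, c\<rangle>\<close> has norm at most \<open>|c|\<close>: with
  \<open>|c|\<^sup>2 = |c|\<^sup>2 (1 - \<langle>z, w\<rangle>) + |c|\<^sup>2 \<langle>z, w\<rangle>\<close> the kernel becomes a constant plus \<open>k\<close> times the form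
  \<open>|c|\<^sup>2 \<langle>z, w\<rangle> - \<langle>z, c\<rangle> \<langle>c, w\<rangle>\<close>, which is semidefinite by the Cauchy-Schwarz inequality.\<close>

lemma linear_functional_multiplication_bounded:
  "positive_kernel (ball 0 1)
     (\<lambda>z w. drury_arveson z w * (of_real ((norm c)\<^sup>2) - hinner z c * cnj (hinner w c)))"
proof -
  define B where "B = (\<lambda>z w. of_real ((norm c)\<^sup>2) * hinner z w - hinner z c * cnj (hinner w c))"
  have "hermitian_form (*s) B"
    unfolding hermitian_form_def
  proof (intro conjI allI)
    show "B y x = cnj (B x y)" for x y
      by (simp add: B_def hinner_commute[of y x] mult.commute)
  qed (simp_all add: B_def hinner_add_left hinner_scale_left algebra_simps)
  moreover have "0 \<le> Re (B v v)" for v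
  proof -
    have "B v v = of_real ((norm c)\<^sup>2 * (norm v)\<^sup>2 - (cmod (hinner v c))\<^sup>2)"
      by (simp only: B_def hinner_self complex_norm_square[symmetric] of_real_mult of_real_diff)
    moreover have "(cmod (hinner v c))\<^sup>2 \<le> (norm v * norm c)\<^sup>2"
      by (intro power_mono norm_hinner_le) simp
    ultimately show ?thesis by (simp add: power_mult_distrib mult.commute)
  qed
  ultimately have "positive_kernel (ball 0 1) (\<lambda>z w. drury_arveson z w * B z w)"
    by (intro schur_multiplierD[OF schur_multiplier_drury_arveson_ball]
        positive_kernel_of_form[where e = "\<lambda>z. z"])
  moreover have "positive_kernel (ball 0 1) (\<lambda>z w::complex^'a. of_real ((norm c)\<^sup>2) * 1)"
    by (intro positive_kernel_scale positive_kernel_one) simp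
  ultimately have pos: "positive_kernel (ball 0 1)
      (\<lambda>z w. of_real ((norm c)\<^sup>2) * 1 + drury_arveson z w * B z w)"
    by (rule positive_kernel_add[rotated])
  have "of_real ((norm c)\<^sup>2) * 1 + drury_arveson z w * B z w =
      drury_arveson z w * (of_real ((norm c)\<^sup>2) - hinner z c * cnj (hinner w c))"
    if "z \<in> ball 0 1" "w \<in> ball 0 1" for z w
    using one_minus_hinner_nonzero[of z w] that unfolding B_def
    by (simp add: field_simps)
  then show ?thesis by (rule positive_kernel_congD[OF pos])
qed

text \<open>With \<open>p(z) = \<langle>z, c\<rangle>\<close>, this is
  \<open>|b + p|\<^sup>2 + |b - p|\<^sup>2 = 2 |b|\<^sup>2 + 2 |p|\<^sup>2\<close> read as an identity between kernels. The constant is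
  not sharp; only its order in \<open>b\<close> matters.\<close>

lemma affine_multiplication_bounded:
  fixes c :: "complex^'m"
  assumes "norm c \<le> cmod b"
  shows "positive_kernel (ball 0 1)
     (\<lambda>z w. of_real (4 * (cmod b)\<^sup>2) * drury_arveson z w
          - (hinner z c + b) * cnj (hinner w c + b) * drury_arveson z w)"
proof -
  let ?k = "drury_arveson :: complex^'m \<Rightarrow> _"
  have "positive_kernel (ball 0 1) (\<lambda>z w.
      of_real 2 * (?k z w * (of_real ((norm c)\<^sup>2) - hinner z c * cnj (hinner w c))) +
      (?k z w * ((b - hinner z c) * cnj (b - hinner w c)) +
       of_real (2 * ((cmod b)\<^sup>2 - (norm c)\<^sup>2)) * (?k z w * 1)))"
    using assms
    by (intro positive_kernel_add positive_kernel_scale linear_functional_multiplication_bounded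
        schur_multiplierD[OF schur_multiplier_drury_arveson_ball]
        positive_kernel_rank_one positive_kernel_one) (auto simp: power_mono)
  then show ?thesis
  proof (rule positive_kernel_congD)
    have "of_real 2 * (k * (of_real C - p * cnj p')) +
      (k * ((b - p) * cnj (b - p')) + of_real (2 * ((cmod b)\<^sup>2 - C)) * (k * 1)) =
      of_real (4 * (cmod b)\<^sup>2) * k - (p + b) * cnj (p' + b) * k" for k p p' C
      by (simp only: of_real_mult of_real_diff of_real_numeral complex_norm_square
          complex_cnj_diff complex_cnj_add) algebra
    then show "of_real 2 * (?k z w * (of_real ((norm c)\<^sup>2) - hinner z c * cnj (hinner w c))) +
      (?k z w * ((b - hinner z c) * cnj (b - hinner w c)) +
       of_real (2 * ((cmod b)\<^sup>2 - (norm c)\<^sup>2)) * (?k z w * 1)) =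
      of_real (4 * (cmod b)\<^sup>2) * ?k z w - (hinner z c + b) * cnj (hinner w c + b) * ?k z w" for z w .
  qed
qed

text \<open>Multiplication by \<open>q(z) = 1 - \<langle>z, p\<rangle>\<close> has a bounded inverse. With \<open>\<pi>(z) = \<langle>z, p\<rangle>\<close>,
  \<open>r = |p|\<close> and \<open>l = 1 - r\<close>, the identity
  \<open>(1 + l) |q|\<^sup>2 + l (1 + l) |\<pi>|\<^sup>2 - l |q + \<pi>|\<^sup>2 = |q - l \<pi>|\<^sup>2\<close>, together with \<open>q + \<pi> = 1\<close> and the
  bound \<open>r\<^sup>2\<close> for \<open>|\<pi>|\<^sup>2\<close>, bounds \<open>|q|\<^sup>2\<close> from below, since
  \<open>(1 + l) r\<^sup>2 = r (2 - r) r < 1\<close>.\<close>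

lemma affine_multiplication_bounded_below:
  fixes p :: "complex^'m"
  assumes "norm p < 1"
  obtains \<kappa> where "\<kappa> > 0" "positive_kernel (ball 0 1)
     (\<lambda>z w. (1 - hinner z p) * cnj (1 - hinner w p) * drury_arveson z w
          - of_real \<kappa> * drury_arveson z w)"
proof -
  let ?k = "drury_arveson :: complex^'m \<Rightarrow> _"
  define r where "r = norm p"
  define l where "l = 1 - r"
  define \<kappa> where "\<kappa> = l * (1 - (1 + l) * r\<^sup>2) / (1 + l)"
  have l: "0 < l" "0 \<le> r" "r < 1" using assms by (auto simp: l_def r_def)
  have "(1 + l) * r\<^sup>2 = (r * (2 - r)) * r" by (simp add: l_def power2_eq_square)
  also have "\<dots> \<le> 1 * r"
  proof (rule mult_right_mono)
    show "r * (2 - r) \<le> 1" using zero_le_power2[of "1 - r"] by (simp add: power2_eq_square algebra_simps)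
  qed (fact l)
  finally have "\<kappa> > 0" using l by (simp add: \<kappa>_def)
  have pos: "positive_kernel (ball 0 1) (\<lambda>z w. of_real (1 / (1 + l)) *
      (?k z w * ((1 - hinner z p - of_real l * hinner z p) * cnj (1 - hinner w p - of_real l * hinner w p)) +
       of_real (l * (1 + l)) * (?k z w * (of_real ((norm p)\<^sup>2) - hinner z p * cnj (hinner w p)))))"
    using l
    by (intro positive_kernel_add positive_kernel_scale linear_functional_multiplication_bounded
        schur_multiplierD[OF schur_multiplier_drury_arveson_ball] positive_kernel_rank_one) auto
  have identity: "of_real (1 / (1 + l)) *
      (k * ((1 - x - of_real l * x) * cnj (1 - y - of_real l * y)) +
       of_real (l * (1 + l)) * (k * (of_real (r\<^sup>2) - x * cnj y))) =
      (1 - x) * cnj (1 - y) * k - of_real \<kappa> * k" for k x y :: complex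
  proof -
    have nz: "1 + complex_of_real l \<noteq> 0" using l by (metis add_pos_pos less_numeral_extra(1,3) of_real_1 of_real_add of_real_eq_0_iff)
    have "complex_of_real \<kappa> = of_real l * (1 - (1 + of_real l) * (of_real r)\<^sup>2) / (1 + of_real l)"
      by (simp add: \<kappa>_def)
    then have "complex_of_real \<kappa> * (1 + of_real l) = of_real l * (1 - (1 + of_real l) * (of_real r)\<^sup>2)"
      using nz by simp
    then have "k * ((1 - x - of_real l * x) * (1 - cnj y - of_real l * cnj y)) +
       of_real l * (1 + of_real l) * (k * ((of_real r)\<^sup>2 - x * cnj y)) =
       ((1 - x) * (1 - cnj y) * k - of_real \<kappa> * k) * (1 + of_real l)"
      by algebra
    with nz show ?thesis by (simp add: nonzero_divide_eq_eq)
  qed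
  show ?thesis
    by (rule that[OF \<open>\<kappa> > 0\<close>], rule positive_kernel_congD[OF pos]) (unfold identity[unfolded r_def], rule refl)
qed

section \<open>Composition operators and kernel inequalities\<close>

lemma schur_multiplier_scale:
  "0 \<le> a \<Longrightarrow> schur_multiplier X K \<Longrightarrow> schur_multiplier X (\<lambda>x y. of_real a * K x y)"
  by (simp add: schur_multiplier_def mult.assoc positive_kernel_scale)

text \<open>The kernel functions of the space, extended by \<open>0\<close> to all of the ambient space.\<close>

definition kernel_section :: "nat \<Rightarrow> complex^'m \<Rightarrow> complex^'m \<Rightarrow> complex" where
  "kernel_section \<beta> w = on_ball (\<lambda>z. ball_kernel \<beta> z w)"

lemma H2_spaceD:
  assumes "H2_space \<beta> H ip"
  shows "hilbert_function_space H ip"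
    and "f \<in> H \<Longrightarrow> \<forall>z. z \<notin> ball 0 1 \<longrightarrow> f z = 0"
    and "w \<in> ball 0 1 \<Longrightarrow> kernel_section \<beta> w \<in> H"
    and "w \<in> ball 0 1 \<Longrightarrow> f \<in> H \<Longrightarrow> ip f (kernel_section \<beta> w) = f w"
  using assms unfolding H2_space_def kernel_section_def by blast+

lemma ip_kernel_section:
  assumes "H2_space \<beta> H ip" "z \<in> ball 0 1" "w \<in> ball 0 1"
  shows "ip (kernel_section \<beta> w) (kernel_section \<beta> z) = ball_kernel \<beta> z w"
  using H2_spaceD(4)[OF assms(1,2) H2_spaceD(3)[OF assms(1,3)]] assms(2)
  by (simp add: kernel_section_def on_ball_def)

lemma kernel_combination_norm:
  assumes H2: "H2_space \<beta> H ip" and w: "\<forall>i<n. w i \<in> ball 0 1"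
  shows "(ip_norm ip (\<lambda>x. \<Sum>i<n. c i * kernel_section \<beta> (w i) x))\<^sup>2 =
    Re (\<Sum>i<n. \<Sum>j<n. cnj (c i) * cnj (cnj (c j)) * ball_kernel \<beta> (w i) (w j))"
proof -
  interpret hilbert_function_space H ip by (rule H2_spaceD(1)[OF H2])
  let ?k = "\<lambda>i x. c i * kernel_section \<beta> (w i) x"
  have k: "kernel_section \<beta> (w i) \<in> H" if "i < n" for i using H2_spaceD(3)[OF H2] w that by blast
  have "ip (\<lambda>x. \<Sum>i<n. ?k i x) (\<lambda>x. \<Sum>i<n. ?k i x) = (\<Sum>i<n. ip (\<lambda>x. \<Sum>i<n. ?k i x) (?k i))"
    by (rule ip_sum_right) (auto intro!: sum_mem scale_mem k)
  also have "\<dots> = (\<Sum>i<n. \<Sum>j<n. ip (?k j) (?k i))"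
    by (intro sum.cong refl ip_sum_left) (auto intro!: scale_mem k)
  also have "\<dots> = (\<Sum>i<n. \<Sum>j<n. cnj (c i) * cnj (cnj (c j)) * ball_kernel \<beta> (w i) (w j))"
    using w by (intro sum.cong refl)
      (simp add: ip_scale_left ip_scale_right scale_mem k ip_kernel_section[OF H2] ac_simps)
  finally show ?thesis
    by (subst nrm_power2) (auto intro!: sum_mem scale_mem k)
qed

text \<open>The functional sending a kernel function at \<open>w\<close> to \<open>f (\<psi> w)\<close> pairs \<open>f\<close> with kernel functions
  at points \<open>\<psi> w\<close>, so the kernel inequality is exactly its boundedness on the span of the kernel
  functions. The vector that represents it has the values of \<open>f \<circ> \<psi>\<close>.\<close>

lemma composition_mem_of_positive_kernel:
  fixes \<psi> :: "complex^'m \<Rightarrow> complex^'m"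
  assumes H2: "H2_space \<beta> H ip"
    and \<psi>: "\<psi> ` ball 0 1 \<subseteq> ball 0 1"
    and M: "0 \<le> M"
    and pos: "positive_kernel (ball 0 1)
      (\<lambda>z w. of_real M * ball_kernel \<beta> z w - ball_kernel \<beta> (\<psi> z) (\<psi> w))"
    and f: "f \<in> H"
  shows "on_ball (f \<circ> \<psi>) \<in> H \<and> ip_norm ip (on_ball (f \<circ> \<psi>)) \<le> sqrt M * ip_norm ip f"
proof -
  interpret hilbert_function_space H ip by (rule H2_spaceD(1)[OF H2])
  let ?k = "kernel_section \<beta> :: complex^'m \<Rightarrow> _"
  define g where "g = (\<lambda>n c (w :: nat \<Rightarrow> complex^'m) x. \<Sum>i<n. c i * ?k (w i) x)"
  define v where "v = (\<lambda>n c (w :: nat \<Rightarrow> complex^'m). \<Sum>i<n. cnj (c i) * f (\<psi> (w i)))"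
  define V where "V = {(g n c w, v n c w) | (n::nat) c w. \<forall>i<n. w i \<in> ball 0 1}"
  have VI: "(g', v') \<in> V" if "\<forall>i<n. w i \<in> ball 0 1" "g' = g n c w" "v' = v n c w" for n c w g' v'
    using that unfolding V_def by blast
  have VE: "thesis" if "(g', v') \<in> V"
    "\<And>n c w. \<forall>i<n. w i \<in> ball 0 1 \<Longrightarrow> g' = g n c w \<Longrightarrow> v' = v n c w \<Longrightarrow> thesis" for g' v' thesis
    using that unfolding V_def by blast
  have g_mem: "g n c w \<in> H" if "\<forall>i<n. w i \<in> ball 0 1" for n c w
    unfolding g_def using that by (intro sum_mem scale_mem H2_spaceD(3)[OF H2]) auto
  have concat: "(\<Sum>i<n + m. h (if i < n then a i else b (i - n))) = (\<Sum>i<n. h (a i)) + (\<Sum>i<m. h (b i))"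
    for n m :: nat and a b and h :: "complex \<times> (complex^'m) \<Rightarrow> complex"
    by (induction m) (auto simp: add.assoc intro!: sum.cong)
  have "\<exists>h\<in>H. nrm h \<le> sqrt M * nrm f \<and> (\<forall>(g', v')\<in>V. ip h g' = v')"
  proof (rule riesz_on_subspace)
    show "((\<lambda>_. 0), 0) \<in> V" by (rule VI[where n = 0]) (auto simp: g_def v_def)
  next
    fix g1 v1 g2 v2 assume "(g1, v1) \<in> V" "(g2, v2) \<in> V"
    then obtain n c w n' c' w' where *: "\<forall>i<n. w i \<in> ball 0 1" "g1 = g n c w" "v1 = v n c w"
        "\<forall>i<n'. w' i \<in> ball 0 1" "g2 = g n' c' w'" "v2 = v n' c' w'"
      by (elim VE) blast
    \<comment> \<open>concatenation of the two families of points and weights\<close>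
    define p where "p = (\<lambda>i. if i < n then (c i, w i) else (c' (i - n), w' (i - n)))"
    show "(\<lambda>x. g1 x + g2 x, v1 + v2) \<in> V"
    proof (rule VI[where n = "n + n'" and c = "\<lambda>i. fst (p i)" and w = "\<lambda>i. snd (p i)"])
      show "\<forall>i<n + n'. snd (p i) \<in> ball 0 1" using * by (auto simp: p_def)
      show "(\<lambda>x. g1 x + g2 x) = g (n + n') (\<lambda>i. fst (p i)) (\<lambda>i. snd (p i))"
        unfolding g_def *(2,5) p_def
        using concat[of "\<lambda>q. fst q * ?k (snd q) _" n "\<lambda>i. (c i, w i)" "\<lambda>i. (c' i, w' i)" n'] by simp
      show "v1 + v2 = v (n + n') (\<lambda>i. fst (p i)) (\<lambda>i. snd (p i))"
        unfolding v_def *(3,6) p_def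
        using concat[of "\<lambda>q. cnj (fst q) * f (\<psi> (snd q))" n "\<lambda>i. (c i, w i)" "\<lambda>i. (c' i, w' i)" n'] by simp
    qed
  next
    fix a g1 v1 assume "(g1, v1) \<in> V"
    then obtain n c w where *: "\<forall>i<n. w i \<in> ball 0 1" "g1 = g n c w" "v1 = v n c w" by (elim VE)
    show "(\<lambda>x. a * g1 x, cnj a * v1) \<in> V"
      by (rule VI[where n = n and c = "\<lambda>i. a * c i" and w = w])
        (use * in \<open>auto simp: g_def v_def sum_distrib_left mult.assoc\<close>)
  next
    fix g1 v1 assume "(g1, v1) \<in> V"
    then show "g1 \<in> H" by (elim VE) (simp add: g_mem)
  next
    fix g1 v1 assume "(g1, v1) \<in> V"
    then obtain n c w where w: "\<forall>i<n. w i \<in> ball 0 1" and gv: "g1 = g n c w" "v1 = v n c w" by (elim VE)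
    have \<psi>w: "\<forall>i<n. \<psi> (w i) \<in> ball 0 1" using w \<psi> by blast
    let ?h = "g n c (\<lambda>i. \<psi> (w i))"
    have h: "?h \<in> H" by (rule g_mem[OF \<psi>w])
    have "v1 = ip f ?h"
      unfolding gv v_def g_def using \<psi>w
      using f H2_spaceD(3)[OF H2] H2_spaceD(4)[OF H2]
      by (subst ip_sum_right) (auto intro!: scale_mem sum.cong simp: ip_scale_right)
    then have v1: "cmod v1 \<le> nrm f * nrm ?h" using cauchy_schwarz[OF f h] by simp
    have "nrm ?h \<le> sqrt M * nrm g1"
    proof (rule power2_le_imp_le)
      have "0 \<le> Re (\<Sum>i<n. \<Sum>j<n. cnj (c i) * cnj (cnj (c j)) *
          (of_real M * ball_kernel \<beta> (w i) (w j) - ball_kernel \<beta> (\<psi> (w i)) (\<psi> (w j))))"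
        by (rule positive_kernelD[OF pos w])
      also have "(\<Sum>i<n. \<Sum>j<n. cnj (c i) * cnj (cnj (c j)) *
          (of_real M * ball_kernel \<beta> (w i) (w j) - ball_kernel \<beta> (\<psi> (w i)) (\<psi> (w j)))) =
          of_real M * (\<Sum>i<n. \<Sum>j<n. cnj (c i) * cnj (cnj (c j)) * ball_kernel \<beta> (w i) (w j)) -
          (\<Sum>i<n. \<Sum>j<n. cnj (c i) * cnj (cnj (c j)) * ball_kernel \<beta> (\<psi> (w i)) (\<psi> (w j)))"
        by (simp add: right_diff_distrib sum_subtractf sum_distrib_left ac_simps)
      finally have "(nrm ?h)\<^sup>2 \<le> M * (nrm g1)\<^sup>2"
        unfolding gv g_def kernel_combination_norm[OF H2 w] kernel_combination_norm[OF H2 \<psi>w] by simp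
      then show "(nrm ?h)\<^sup>2 \<le> (sqrt M * nrm g1)\<^sup>2" using M by (simp add: power_mult_distrib)
      show "0 \<le> sqrt M * nrm g1" using M nrm_nonneg[OF g_mem[OF w]] gv by simp
    qed
    from order_trans[OF v1 mult_left_mono[OF this nrm_nonneg[OF f]]]
    show "cmod v1 \<le> sqrt M * nrm f * nrm g1"
      by (simp add: ac_simps)
  qed (use M nrm_nonneg[OF f] in simp)
  then obtain h where h: "h \<in> H" "nrm h \<le> sqrt M * nrm f" and "\<forall>(g', v')\<in>V. ip h g' = v'"
    by blast
  then have represents: "ip h g' = v'" if "(g', v') \<in> V" for g' v' using that by auto
  have "h = on_ball (f \<circ> \<psi>)"
  proof
    fix z
    show "h z = on_ball (f \<circ> \<psi>) z"
    proof (cases "z \<in> ball 0 1")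
      case True
      have "(?k z, f (\<psi> z)) \<in> V"
        by (rule VI[where n = 1 and c = "\<lambda>_. 1" and w = "\<lambda>_. z"]) (use True in \<open>auto simp: g_def v_def\<close>)
      from represents[OF this] show ?thesis
        using H2_spaceD(4)[OF H2 True h(1)] True by (simp add: on_ball_def)
    next
      case False
      then show ?thesis using H2_spaceD(2)[OF H2 h(1)] by (simp add: on_ball_def)
    qed
  qed
  with h show ?thesis by simp
qed

lemma composition_bound_of_drury_arveson_bound:
  fixes \<psi> :: "complex^'m \<Rightarrow> complex^'m"
  assumes H2: "H2_space \<beta> H ip"
    and \<psi>: "\<psi> ` ball 0 1 \<subseteq> ball 0 1"
    and M: "0 \<le> M"
    and pos: "positive_kernel (ball 0 1)
      (\<lambda>z w. of_real M * drury_arveson z w - drury_arveson (\<psi> z) (\<psi> w))"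
    and f: "f \<in> H"
  shows "on_ball (f \<circ> \<psi>) \<in> H" "ip_norm ip (on_ball (f \<circ> \<psi>)) \<le> sqrt M ^ \<beta> * ip_norm ip f"
proof -
  have "positive_kernel (ball 0 1)
      (\<lambda>z w. (of_real M * drury_arveson z w) ^ \<beta> - drury_arveson (\<psi> z) (\<psi> w) ^ \<beta>)"
    by (rule positive_kernel_power_diff[OF
          schur_multiplier_scale[OF M schur_multiplier_drury_arveson_ball]
          schur_multiplier_drury_arveson[OF \<psi>] pos])
  then have "positive_kernel (ball 0 1)
      (\<lambda>z w. of_real (M ^ \<beta>) * ball_kernel \<beta> z w - ball_kernel \<beta> (\<psi> z) (\<psi> w))"
    by (simp add: ball_kernel_eq_power power_mult_distrib)
  from composition_mem_of_positive_kernel[OF H2 \<psi> _ this f]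
  show "on_ball (f \<circ> \<psi>) \<in> H" "ip_norm ip (on_ball (f \<circ> \<psi>)) \<le> sqrt M ^ \<beta> * ip_norm ip f"
    using M by (simp_all add: real_sqrt_power)
qed

lemma composition_operator_funpow:
  fixes \<phi> :: "complex^'m \<Rightarrow> complex^'m"
  assumes "\<phi> ` ball 0 1 \<subseteq> ball 0 1"
    and f: "\<forall>z. z \<notin> ball 0 1 \<longrightarrow> f z = 0"
  shows "(composition_operator \<phi> ^^ n) f = on_ball (f \<circ> (\<phi> ^^ n))"
proof (induction n)
  case 0
  then show ?case using f by (auto simp: on_ball_def)
next
  case (Suc n)
  then show ?case
    using assms(1) by (force simp: composition_operator_def on_ball_def funpow_swap1 fun_eq_iff)
qed

lemma funpow_image_subset: "f ` A \<subseteq> A \<Longrightarrow> (f ^^ n) ` A \<subseteq> A"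
  by (induction n) auto

lemma composition_operator_bounded:
  fixes \<phi> :: "complex^'m \<Rightarrow> complex^'m"
  assumes H2: "H2_space \<beta> H ip"
    and \<phi>: "\<phi> ` ball 0 1 \<subseteq> ball 0 1"
    and M: "0 \<le> M"
    and pos: "positive_kernel (ball 0 1)
      (\<lambda>z w. of_real M * drury_arveson z w - drury_arveson (\<phi> z) (\<phi> w))"
  shows "bounded_operator_on H ip (composition_operator \<phi>)"
  unfolding bounded_operator_on_def
proof (intro conjI ballI allI)
  show "composition_operator \<phi> ` H \<subseteq> H"
    using composition_bound_of_drury_arveson_bound(1)[OF H2 \<phi> M pos]
    unfolding composition_operator_def by blast
  show "\<exists>K. \<forall>f\<in>H. ip_norm ip (composition_operator \<phi> f) \<le> K * ip_norm ip f"
    using composition_bound_of_drury_arveson_bound(2)[OF H2 \<phi> M pos]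
    unfolding composition_operator_def by blast
qed (auto simp: composition_operator_def on_ball_def)

lemma composition_operator_spectrum_bound:
  fixes \<phi> :: "complex^'m \<Rightarrow> complex^'m"
  assumes H2: "H2_space \<beta> H ip"
    and \<phi>: "\<phi> ` ball 0 1 \<subseteq> ball 0 1"
    and M: "\<And>n. 0 \<le> M n" "\<And>n. M n \<le> C * \<rho> ^ n" "0 \<le> \<rho>"
    and pos: "\<And>n. positive_kernel (ball 0 1)
      (\<lambda>z w. of_real (M n) * drury_arveson z w - drury_arveson ((\<phi> ^^ n) z) ((\<phi> ^^ n) w))"
    and \<mu>: "\<mu> \<in> operator_spectrum H ip (composition_operator \<phi>)"
  shows "cmod \<mu> \<le> sqrt \<rho> ^ \<beta>"
proof (rule ccontr)
  interpret hilbert_function_space H ip by (rule H2_spaceD(1)[OF H2])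
  assume "\<not> cmod \<mu> \<le> sqrt \<rho> ^ \<beta>"
  have bdd: "bounded_operator_on H ip (composition_operator \<phi>)"
    using composition_operator_bounded[OF H2 \<phi> M(1)[of 1]] pos[of 1] by simp
  have "nrm ((composition_operator \<phi> ^^ n) f) \<le> sqrt C ^ \<beta> * (sqrt \<rho> ^ \<beta>) ^ n * nrm f"
    if f: "f \<in> H" for n f
  proof -
    have "nrm ((composition_operator \<phi> ^^ n) f) \<le> sqrt (M n) ^ \<beta> * nrm f"
      using composition_bound_of_drury_arveson_bound(2)[OF H2 funpow_image_subset[OF \<phi>] M(1) pos f]
      unfolding composition_operator_funpow[OF \<phi> H2_spaceD(2)[OF H2 f]] .
    also have "\<dots> \<le> sqrt (C * \<rho> ^ n) ^ \<beta> * nrm f"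
      using M by (intro mult_right_mono power_mono nrm_nonneg f) auto
    also have "sqrt (C * \<rho> ^ n) ^ \<beta> = sqrt C ^ \<beta> * (sqrt \<rho> ^ \<beta>) ^ n"
      by (simp add: real_sqrt_mult real_sqrt_power power_mult_distrib power_mult[symmetric] mult.commute)
    finally show ?thesis .
  qed
  from power_bound_not_in_operator_spectrum[OF bdd this, of \<mu>]
  show False using \<mu> \<open>\<not> cmod \<mu> \<le> sqrt \<rho> ^ \<beta>\<close> M(3) by simp
qed

text \<open>Pairing \<open>C_\<phi>\<^sup>n\<close> applied to the kernel function at \<open>z = \<phi>\<^sup>n(0)\<close> with the kernel function at \<open>0\<close>
  evaluates the former at \<open>z\<close>, that is, gives the square of its norm. A geometric bound on the
  powers thus bounds the norm of that kernel function, which is \<open>(1 - |z|\<^sup>2)\<close> to the power \<open>-\<beta>/2\<close>.\<close>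

lemma orbit_growth_of_spectrum_bound:
  fixes \<phi> :: "complex^'m \<Rightarrow> complex^'m"
  assumes H2: "H2_space \<beta> H ip"
    and \<phi>: "\<phi> ` ball 0 1 \<subseteq> ball 0 1"
    and bdd: "bounded_operator_on H ip (composition_operator \<phi>)"
    and spec: "\<And>\<mu>. \<mu> \<in> operator_spectrum H ip (composition_operator \<phi>) \<Longrightarrow> cmod \<mu> \<le> r\<^sub>1"
    and r: "0 < r\<^sub>1" "r\<^sub>1 < r"
  obtains K where "0 \<le> K" "\<And>n. 1 \<le> K * r ^ n * sqrt (1 - (norm ((\<phi> ^^ n) 0))\<^sup>2) ^ \<beta>"
proof -
  interpret hilbert_function_space H ip by (rule H2_spaceD(1)[OF H2])
  obtain K where K: "\<And>n f g. f \<in> H \<Longrightarrow> g \<in> H \<Longrightarrow>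
      cmod (ip ((composition_operator \<phi> ^^ n) f) g) \<le> K * r ^ n * nrm f * nrm g"
    using geometric_growth_of_spectrum_bound[OF bdd spec r] by blast
  have zero: "(0 :: complex^'m) \<in> ball 0 1" by simp
  have "1 \<le> K * r ^ n * sqrt (1 - (norm ((\<phi> ^^ n) 0))\<^sup>2) ^ \<beta>" for n
  proof -
    define z where "z = (\<phi> ^^ n) 0"
    define s where "s = sqrt (1 - (norm z)\<^sup>2) ^ \<beta>"
    have z: "z \<in> ball 0 1" unfolding z_def using funpow_image_subset[OF \<phi>, of n] zero by blast
    then have "(norm z)\<^sup>2 < 1" by (simp add: power_less_one_iff)
    then have s: "s > 0" "s\<^sup>2 = (1 - (norm z)\<^sup>2) ^ \<beta>"
      by (simp_all add: s_def power_mult[symmetric] mult.commute[of \<beta>]) (simp add: power_mult)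
    have k: "kernel_section \<beta> z \<in> H" "kernel_section \<beta> 0 \<in> H"
      using H2_spaceD(3)[OF H2] z zero by blast+
    have kz: "ball_kernel \<beta> z z = of_real (inverse (s\<^sup>2))"
      by (simp add: ball_kernel_def hinner_self s(2))
    have "nrm (kernel_section \<beta> z) = inverse s"
      using s(1) by (simp add: ip_norm_def ip_kernel_section[OF H2 z z] kz real_sqrt_inverse del: of_real_inverse)
    moreover have "nrm (kernel_section \<beta> 0) = 1"
      by (simp add: ip_norm_def ip_kernel_section[OF H2 zero zero] ball_kernel_def)
    moreover have "ip ((composition_operator \<phi> ^^ n) (kernel_section \<beta> z)) (kernel_section \<beta> 0) =
        ball_kernel \<beta> z z"
      using H2_spaceD(4)[OF H2 zero funpow_mem[OF bdd k(1)], of n] z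
      unfolding composition_operator_funpow[OF \<phi> H2_spaceD(2)[OF H2 k(1)]]
      by (simp add: on_ball_def kernel_section_def flip: z_def)
    ultimately have "inverse (s\<^sup>2) \<le> K * r ^ n * inverse s"
      using K[OF k, of n] by (simp add: kz norm_inverse norm_power del: of_real_inverse)
    then have "inverse (s\<^sup>2) * s\<^sup>2 \<le> K * r ^ n * inverse s * s\<^sup>2"
      by (rule mult_right_mono) simp
    then have "1 \<le> K * r ^ n * s"
      using s(1) by (simp add: power2_eq_square mult.assoc)
    then show ?thesis by (simp only: s_def z_def)
  qed
  moreover have "0 \<le> K" using calculation[of 0] by simp
  ultimately show ?thesis using that by blast
qed

section \<open>The Krein decomposition of a linear fractional self-map\<close>

definition homogeneous_scale :: "complex \<Rightarrow> (complex^'m) \<times> complex \<Rightarrow> (complex^'m) \<times> complex" where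
  "homogeneous_scale c x = (c *s fst x, c * snd x)"

definition homogenize :: "complex^'m \<Rightarrow> (complex^'m) \<times> complex" where
  "homogenize z = (z, 1)"

definition lorentz_form :: "(complex^'m) \<times> complex \<Rightarrow> (complex^'m) \<times> complex \<Rightarrow> complex" where
  "lorentz_form x y = snd x * cnj (snd y) - hinner (fst x) (fst y)"

lemma hermitian_lorentz_form: "hermitian_form homogeneous_scale lorentz_form"
  unfolding hermitian_form_def
proof (intro conjI allI)
  show "lorentz_form y x = cnj (lorentz_form x y)" for x y :: "(complex^'m) \<times> complex"
    by (simp add: lorentz_form_def hinner_commute[of "fst y" "fst x"])
qed (simp_all add: lorentz_form_def homogeneous_scale_def hinner_add_left hinner_scale_left algebra_simps)

lemma lorentz_form_homogenize: "lorentz_form (homogenize z) (homogenize w) = 1 - hinner z w"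
  by (simp add: lorentz_form_def homogenize_def)

lemma lorentz_form_homogenize_self:
  "lorentz_form (homogenize z) (homogenize z) = of_real (1 - (norm z)\<^sup>2)"
  by (simp add: lorentz_form_homogenize hinner_self)

locale linear_fractional =
  fixes \<phi> :: "complex^'m \<Rightarrow> complex^'m"
    and A :: "complex^'m^'m" and B C :: "complex^'m" and D :: complex
  assumes self_map: "\<phi> ` ball 0 1 \<subseteq> ball 0 1"
    and denominator_nonzero: "z \<in> ball 0 1 \<Longrightarrow> hinner z C + D \<noteq> 0"
    and map_eq: "z \<in> ball 0 1 \<Longrightarrow> \<phi> z = inverse (hinner z C + D) *s (A *v z + B)"
begin

definition den :: "complex^'m \<Rightarrow> complex" where
  "den z = hinner z C + D"

text \<open>The linear map of homogeneous coordinates that induces \<open>\<phi>\<close>.\<close>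

definition lift :: "(complex^'m) \<times> complex \<Rightarrow> (complex^'m) \<times> complex" where
  "lift x = (A *v fst x + snd x *s B, hinner (fst x) C + snd x * D)"

definition pullback_form :: "(complex^'m) \<times> complex \<Rightarrow> (complex^'m) \<times> complex \<Rightarrow> complex" where
  "pullback_form x y = lorentz_form (lift x) (lift y)"

lemma lift_add: "lift (x + y) = lift x + lift y"
  by (simp add: lift_def prod_eq_iff matrix_vector_right_distrib hinner_add_left vector_sadd_rdistrib
      distrib_right)

lemma lift_scale: "lift (homogeneous_scale c x) = homogeneous_scale c (lift x)"
  by (simp add: lift_def homogeneous_scale_def vector_scalar_commute hinner_scale_left
      vector_add_ldistrib vector_smult_assoc algebra_simps)

lemma hermitian_pullback_form: "hermitian_form homogeneous_scale pullback_form"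
  using hermitian_lorentz_form
  unfolding hermitian_form_def pullback_form_def lift_add lift_scale by blast

lemma den_nonzero: "z \<in> ball 0 1 \<Longrightarrow> den z \<noteq> 0"
  by (simp add: den_def denominator_nonzero)

lemma lift_homogenize:
  assumes "z \<in> ball 0 1"
  shows "lift (homogenize z) = homogeneous_scale (den z) (homogenize (\<phi> z))"
  using den_nonzero[OF assms] assms
  by (simp add: lift_def homogenize_def homogeneous_scale_def map_eq den_def vector_smult_assoc)

lemma pullback_form_homogenize:
  assumes "z \<in> ball 0 1" "w \<in> ball 0 1"
  shows "pullback_form (homogenize z) (homogenize w) = den z * cnj (den w) * (1 - hinner (\<phi> z) (\<phi> w))"
  using assms
  by (simp add: pullback_form_def lift_homogenize lorentz_form_homogenize
      form_scale_left[OF hermitian_lorentz_form] form_scale_right[OF hermitian_lorentz_form])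

lemma continuous_on_hinner [continuous_intros]:
  "continuous_on S f \<Longrightarrow> continuous_on S g \<Longrightarrow> continuous_on S (\<lambda>x. hinner (f x) (g x))"
  unfolding hinner_def by (intro continuous_intros)

lemma continuous_on_den: "continuous_on S den"
  unfolding den_def by (intro continuous_intros)

lemma continuous_on_num: "continuous_on S (\<lambda>z. A *v z + B)"
  unfolding matrix_vector_mult_def by (intro continuous_intros)

lemma continuous_on_pullback_form: "continuous_on S (\<lambda>z. pullback_form (homogenize z) (homogenize z))"
  unfolding pullback_form_def lift_def lorentz_form_def homogenize_def
  using continuous_on_num continuous_on_den
  by (auto intro!: continuous_intros simp: den_def)

text \<open>On vectors with \<open>u \<noteq> 0\<close> the quotient \<open>z/u\<close> lies in the closed ball, so by homogeneity and
  continuity it suffices to look at points of the open ball, where \<open>\<phi>\<close> takes values in the ball.\<close>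

lemma pullback_form_nonneg:
  assumes "0 \<le> Re (lorentz_form x x)"
  shows "0 \<le> Re (pullback_form x x)"
proof (cases "snd x = 0")
  case True
  then have "norm (fst x) = 0" using assms by (simp add: lorentz_form_def hinner_self)
  then have "x = 0" using True by (simp add: prod_eq_iff)
  then show ?thesis using form_zero_left[OF hermitian_pullback_form] by simp
next
  case False
  define z where "z = inverse (snd x) *s fst x"
  have x: "x = homogeneous_scale (snd x) (homogenize z)"
    using False by (simp add: z_def homogeneous_scale_def homogenize_def vector_smult_assoc prod_eq_iff)
  have scale: "Re (F x x) = (cmod (snd x))\<^sup>2 * Re (F (homogenize z) (homogenize z))"
    if "hermitian_form homogeneous_scale F" for F
  proof -
    have "F x x = (snd x * cnj (snd x)) * F (homogenize z) (homogenize z)"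
      by (subst (1 2) x) (simp add: form_scale_left[OF that] form_scale_right[OF that])
    then show ?thesis by (simp flip: complex_norm_square)
  qed
  have "(norm z)\<^sup>2 \<le> 1"
    using assms False unfolding scale[OF hermitian_lorentz_form]
    by (simp add: lorentz_form_homogenize_self zero_le_mult_iff)
  then have "norm z \<le> 1" by (simp add: power_le_one_iff abs_square_le_1)
  then have z: "z \<in> closure (ball 0 1)" by simp
  have "0 \<le> Re (pullback_form (homogenize z) (homogenize z))"
  proof (rule continuous_ge_on_closure[OF _ z])
    show "continuous_on (closure (ball 0 1)) (\<lambda>z. Re (pullback_form (homogenize z) (homogenize z)))"
      by (intro continuous_intros continuous_on_pullback_form)
    fix w :: "complex^'m" assume w: "w \<in> ball 0 1"
    have "pullback_form (homogenize w) (homogenize w) =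
        (den w * cnj (den w)) * of_real (1 - (norm (\<phi> w))\<^sup>2)"
      by (simp add: pullback_form_homogenize[OF w w] hinner_self)
    also have "\<dots> = of_real ((cmod (den w))\<^sup>2 * (1 - (norm (\<phi> w))\<^sup>2))"
      by (simp only: complex_norm_square of_real_mult)
    finally have "pullback_form (homogenize w) (homogenize w) = of_real ((cmod (den w))\<^sup>2 * (1 - (norm (\<phi> w))\<^sup>2))" .
    moreover have "norm (\<phi> w) \<le> 1" using self_map w by force
    ultimately show "0 \<le> Re (pullback_form (homogenize w) (homogenize w))"
      by (simp add: power_le_one del: of_real_mult)
  qed
  then show ?thesis unfolding scale[OF hermitian_pullback_form] by simp
qed

text \<open>For \<open>t > 0\<close> this says that a suitable multiple of the lift does not decrease the Lorentz form.
  The value \<open>t = 0\<close> is possible at this stage, for instance for constant maps written with a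
  denominator that vanishes on the sphere.\<close>

lemma krein_decomposition:
  obtains t P where "0 \<le> t" "hermitian_form homogeneous_scale P" "\<And>v. 0 \<le> Re (P v v)"
    "\<And>x y. pullback_form x y = of_real t * lorentz_form x y + P x y"
proof -
  have "0 < Re (lorentz_form (homogenize 0) (homogenize (0 :: complex^'m)))"
    by (simp add: lorentz_form_homogenize_self)
  from hermitian_s_lemma[OF hermitian_pullback_form hermitian_lorentz_form this pullback_form_nonneg]
  obtain t where t: "0 \<le> t" "\<And>x. t * Re (lorentz_form x x) \<le> Re (pullback_form x x)" by blast
  define P where "P = (\<lambda>x y. pullback_form x y - of_real t * lorentz_form x y)"
  have "hermitian_form homogeneous_scale P"
    unfolding P_def by (rule hermitian_form_diff_scaled[OF hermitian_pullback_form hermitian_lorentz_form])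
  moreover have "0 \<le> Re (P v v)" for v using t(2) by (simp add: P_def)
  moreover have "pullback_form x y = of_real t * lorentz_form x y + P x y" for x y by (simp add: P_def)
  ultimately show ?thesis using t(1) that by blast
qed

lemma schur_multiplier_composed: "schur_multiplier (ball 0 1) (\<lambda>z w. drury_arveson (\<phi> z) (\<phi> w))"
  by (rule schur_multiplier_drury_arveson[OF self_map])

text \<open>The kernel equals \<open>(t + P k) / (d d\<^sup>*)\<close>. Its positivity says that \<open>\<phi>\<close> is a contractive row
  multiplier of the Drury-Arveson space, a property that general
  holomorphic self-maps of the ball lack in dimension greater than one.\<close>

lemma de_branges_kernel_positive:
  "positive_kernel (ball 0 1) (\<lambda>z w. (1 - hinner (\<phi> z) (\<phi> w)) * drury_arveson z w)"
proof -
  obtain t P where tP: "0 \<le> t" "hermitian_form homogeneous_scale P" "\<And>v. 0 \<le> Re (P v v)"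
    "\<And>x y. pullback_form x y = of_real t * lorentz_form x y + P x y"
    by (rule krein_decomposition) blast
  let ?P = "\<lambda>z w. P (homogenize z) (homogenize w)"
  have "positive_kernel (ball 0 1) (\<lambda>z w. inverse (den z) * cnj (inverse (den w)) *
      (of_real t * 1 + drury_arveson z w * ?P z w))"
    by (intro positive_kernel_rank_one_mult positive_kernel_add positive_kernel_scale positive_kernel_one
        tP(1) schur_multiplierD[OF schur_multiplier_drury_arveson_ball] positive_kernel_of_form[OF tP(2,3)])
  then show ?thesis
  proof (rule positive_kernel_congD)
    fix z w :: "complex^'m" assume z: "z \<in> ball 0 1" and w: "w \<in> ball 0 1"
    have k: "1 - hinner z w \<noteq> 0" using one_minus_hinner_nonzero[OF z] w by simp
    have d: "den z \<noteq> 0" "cnj (den w) \<noteq> 0" using den_nonzero z w by auto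
    have "den z * cnj (den w) * (1 - hinner (\<phi> z) (\<phi> w)) = of_real t * (1 - hinner z w) + ?P z w"
      using tP(4)[of "homogenize z" "homogenize w"]
      by (simp add: pullback_form_homogenize[OF z w] lorentz_form_homogenize)
    then show "inverse (den z) * cnj (inverse (den w)) * (of_real t * 1 + drury_arveson z w * ?P z w) =
        (1 - hinner (\<phi> z) (\<phi> w)) * drury_arveson z w"
      using k d by (simp add: divide_simps) algebra
  qed
qed

text \<open>For \<open>p = 0\<close> this says that \<open>C_\<phi>\<close> is a contraction. In general the Schur complement at \<open>p\<close>,
  where the de Branges kernel is \<open>1\<close>, replaces the normalisation that would move \<open>p\<close> to the
  origin.\<close>

lemma fixed_point_kernel_decreasing:
  assumes p: "p \<in> ball 0 1" "\<phi> p = p"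
  shows "positive_kernel (ball 0 1) (\<lambda>z w.
     (1 - hinner z p) * cnj (1 - hinner w p) * drury_arveson z w -
     (1 - hinner (\<phi> z) p) * cnj (1 - hinner (\<phi> w) p) * drury_arveson (\<phi> z) (\<phi> w))"
proof -
  let ?S = "\<lambda>z w. (1 - hinner (\<phi> z) (\<phi> w)) * drury_arveson z w"
  have pp: "1 - hinner p p \<noteq> 0" by (rule one_minus_hinner_nonzero) (use p in auto)
  have S: "positive_kernel (ball 0 1) (\<lambda>z w. ?S z w - ?S z p * ?S p w)"
    by (rule positive_kernel_schur_complement[OF de_branges_kernel_positive _ p(1)])
      (use pp p(2) hinner_commute in \<open>auto simp: hinner_commute[symmetric]\<close>)
  have cancel: "x * y * (K * (a * k - u * X * (v * Y))) = x * y * k - u * v * K"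
    if "a * K = 1" "x * X = 1" "y * Y = 1" for a k u v x y K X Y :: complex
    using that by algebra
  from S have "positive_kernel (ball 0 1) (\<lambda>z w. (1 - hinner z p) * cnj (1 - hinner w p) *
      (drury_arveson (\<phi> z) (\<phi> w) * (?S z w - ?S z p * ?S p w)))"
    by (intro positive_kernel_rank_one_mult schur_multiplierD[OF schur_multiplier_composed])
  then show ?thesis
  proof (rule positive_kernel_congD)
    fix z w :: "complex^'m" assume z: "z \<in> ball 0 1" and w: "w \<in> ball 0 1"
    have \<phi>: "\<phi> z \<in> ball 0 1" "\<phi> w \<in> ball 0 1" using self_map z w by blast+
    have nz: "1 - hinner (\<phi> z) (\<phi> w) \<noteq> 0" "1 - hinner z p \<noteq> 0" "1 - hinner p w \<noteq> 0"
      using one_minus_hinner_nonzero[OF \<phi>(1), of "\<phi> w"] one_minus_hinner_nonzero[OF z, of p]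
        one_minus_hinner_nonzero[OF p(1), of w] \<phi> p w by simp_all
    have cnj: "cnj (1 - hinner w p) = 1 - hinner p w" "cnj (1 - hinner (\<phi> w) p) = 1 - hinner p (\<phi> w)"
      by (simp_all flip: hinner_commute)
    show "(1 - hinner z p) * cnj (1 - hinner w p) *
        (drury_arveson (\<phi> z) (\<phi> w) * (?S z w - ?S z p * ?S p w)) =
        (1 - hinner z p) * cnj (1 - hinner w p) * drury_arveson z w -
        (1 - hinner (\<phi> z) p) * cnj (1 - hinner (\<phi> w) p) * drury_arveson (\<phi> z) (\<phi> w)"
      unfolding cnj p(2) by (rule cancel) (use nz in simp_all)
  qed
qed

text \<open>The weighted kernel is comparable to \<open>k\<close> and decreases along the iterates, so one constant serves
  all of them.\<close>

lemma elliptic_iterate_bound: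
  assumes p: "p \<in> ball 0 1" "\<phi> p = p"
  obtains M where "0 \<le> M" "\<And>n. positive_kernel (ball 0 1)
     (\<lambda>z w. of_real M * drury_arveson z w - drury_arveson ((\<phi> ^^ n) z) ((\<phi> ^^ n) w))"
proof -
  let ?a = "\<lambda>z w. (1 - hinner z p) * cnj (1 - hinner w p) * drury_arveson z w"
  obtain \<kappa> where \<kappa>: "\<kappa> > 0" "positive_kernel (ball 0 1) (\<lambda>z w. ?a z w - of_real \<kappa> * drury_arveson z w)"
    using affine_multiplication_bounded_below[of p] p by auto
  have upper: "positive_kernel (ball 0 1) (\<lambda>z w. of_real 4 * drury_arveson z w - ?a z w)"
    using affine_multiplication_bounded[of "- p" 1] p by (simp add: hinner_def sum_negf)
  have iterate: "positive_kernel (ball 0 1) (\<lambda>z w. ?a z w - ?a ((\<phi> ^^ n) z) ((\<phi> ^^ n) w))" for n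
  proof (induction n)
    case 0
    then show ?case by (simp add: positive_kernel_zero)
  next
    case (Suc n)
    from positive_kernel_add[OF this positive_kernel_compose[OF fixed_point_kernel_decreasing[OF p]
          funpow_image_subset[OF self_map, of n]]]
    show ?case by simp
  qed
  have "positive_kernel (ball 0 1)
      (\<lambda>z w. of_real (4 / \<kappa>) * drury_arveson z w - drury_arveson ((\<phi> ^^ n) z) ((\<phi> ^^ n) w))" for n
  proof -
    have "positive_kernel (ball 0 1) (\<lambda>z w. of_real (1 / \<kappa>) *
        ((of_real 4 * drury_arveson z w - ?a z w) + ((?a z w - ?a ((\<phi> ^^ n) z) ((\<phi> ^^ n) w)) +
         (?a ((\<phi> ^^ n) z) ((\<phi> ^^ n) w) - of_real \<kappa> * drury_arveson ((\<phi> ^^ n) z) ((\<phi> ^^ n) w)))))"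
      using \<kappa>(1)
      by (intro positive_kernel_scale positive_kernel_add upper iterate
          positive_kernel_compose[OF \<kappa>(2) funpow_image_subset[OF self_map]]) auto
    then show ?thesis
    proof (rule positive_kernel_congD)
      have "of_real (1 / \<kappa>) * ((of_real 4 * k - a) + ((a - b) + (b - of_real \<kappa> * l))) =
          of_real (4 / \<kappa>) * k - l" for k a b l :: complex
        using \<kappa>(1) by (simp add: field_simps)
      then show "of_real (1 / \<kappa>) *
        ((of_real 4 * drury_arveson z w - ?a z w) + ((?a z w - ?a ((\<phi> ^^ n) z) ((\<phi> ^^ n) w)) +
         (?a ((\<phi> ^^ n) z) ((\<phi> ^^ n) w) - of_real \<kappa> * drury_arveson ((\<phi> ^^ n) z) ((\<phi> ^^ n) w)))) =
        of_real (4 / \<kappa>) * drury_arveson z w - drury_arveson ((\<phi> ^^ n) z) ((\<phi> ^^ n) w)" for z w .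
    qed
  qed
  moreover have "0 \<le> 4 / \<kappa>" using \<kappa>(1) by simp
  ultimately show ?thesis using that by blast
qed

end

section \<open>Iterates without an interior fixed point\<close>

text \<open>The bound beyond some index \<open>N\<close> follows from the ratios; summing the scaled terms up to \<open>N\<close> gives a
  constant that also covers the initial segment.\<close>

lemma geometric_bound_of_ratio_limit:
  fixes a :: "nat \<Rightarrow> real"
  assumes pos: "\<And>n. 0 < a n" and ratio: "(\<lambda>n. a (Suc n) / a n) \<longlonglongrightarrow> L" and "L < \<rho>" "0 < \<rho>"
  obtains C where "0 \<le> C" "\<And>n. a n \<le> C * \<rho> ^ n"
proof -
  obtain N where N: "\<And>n. n \<ge> N \<Longrightarrow> a (Suc n) / a n < \<rho>"
    using order_tendstoD(2)[OF ratio \<open>L < \<rho>\<close>] unfolding eventually_sequentially by blast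
  define C where "C = (\<Sum>k\<le>N. a k / \<rho> ^ k)"
  have small: "a n \<le> C * \<rho> ^ n" if "n \<le> N" for n
  proof -
    have "a n / \<rho> ^ n \<le> C"
      unfolding C_def using pos \<open>0 < \<rho>\<close> that
      by (intro member_le_sum[where f = "\<lambda>k. a k / \<rho> ^ k"]) (auto intro: less_imp_le)
    then show ?thesis using \<open>0 < \<rho>\<close> by (simp add: divide_le_eq)
  qed
  have large: "a n \<le> C * \<rho> ^ n" if "N \<le> n" for n
    using that
  proof (induction n rule: dec_induct)
    case (step n)
    have "a (Suc n) \<le> \<rho> * a n" using N[of n] step(1) pos[of n] by (simp add: divide_less_eq)
    also have "\<dots> \<le> \<rho> * (C * \<rho> ^ n)" using step(3) \<open>0 < \<rho>\<close> by (intro mult_left_mono) auto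
    finally show ?case by (simp add: mult.left_commute)
  qed (rule small, simp)
  have "0 \<le> C" unfolding C_def using pos \<open>0 < \<rho>\<close> by (intro sum_nonneg) (auto intro: less_imp_le)
  moreover have "a n \<le> C * \<rho> ^ n" for n using small large by (cases "n \<le> N") auto
  ultimately show ?thesis using that by blast
qed

text \<open>Otherwise the functional has its zero \<open>- b c / |c|\<^sup>2\<close> inside the ball.\<close>

lemma affine_coefficient_bound:
  fixes c :: "complex^'m"
  assumes "\<And>z. z \<in> ball 0 1 \<Longrightarrow> hinner z c + b \<noteq> 0"
  shows "norm c \<le> cmod b"
proof (rule ccontr)
  assume "\<not> norm c \<le> cmod b"
  then have c: "norm c > cmod b" "norm c > 0" using norm_ge_zero[of b] by linarith+
  define z where "z = (- b / of_real ((norm c)\<^sup>2)) *s c"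
  have "hinner z c = - b" using c unfolding z_def hinner_scale_left hinner_self by simp
  moreover have "z \<in> ball 0 1"
  proof -
    have "of_real ((norm z)\<^sup>2) = hinner z z" by (simp only: hinner_self)
    also have "\<dots> = cnj (- b / of_real ((norm c)\<^sup>2)) * hinner z c"
      by (subst (2) z_def) (simp only: hinner_scale_right)
    also have "\<dots> = of_real ((cmod b)\<^sup>2 / (norm c)\<^sup>2)"
      using complex_norm_square[of b] by (simp add: \<open>hinner z c = - b\<close> mult.commute)
    finally have "(norm z)\<^sup>2 = (cmod b)\<^sup>2 / (norm c)\<^sup>2" by (simp only: of_real_eq_iff)
    also have "\<dots> < 1" using c by (simp add: divide_less_eq power_strict_mono)
    finally show ?thesis by (simp add: power_less_one_iff)
  qed
  ultimately show False using assms[of z] by simp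
qed

context linear_fractional
begin

text \<open>The denominator of \<open>\<phi>\<close> clears the denominator of every affine function of \<open>\<phi> z\<close>.\<close>

lemma den_mult_affine:
  obtains c' b' where "\<And>z. z \<in> ball 0 1 \<Longrightarrow> den z * (hinner (\<phi> z) c + b) = hinner z c' + b'"
proof -
  define c' where "c' = (\<chi> j. (\<Sum>i\<in>UNIV. cnj (A $ i $ j) * c $ i)) + cnj b *s C"
  have adjoint: "hinner (A *v z) c = hinner z (\<chi> j. \<Sum>i\<in>UNIV. cnj (A $ i $ j) * c $ i)" for z
  proof -
    have "hinner (A *v z) c = (\<Sum>i\<in>UNIV. \<Sum>j\<in>UNIV. A $ i $ j * z $ j * cnj (c $ i))"
      by (simp add: hinner_def matrix_vector_mult_def sum_distrib_right)
    also have "\<dots> = (\<Sum>j\<in>UNIV. \<Sum>i\<in>UNIV. A $ i $ j * z $ j * cnj (c $ i))"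
      by (rule sum.swap)
    also have "\<dots> = hinner z (\<chi> j. \<Sum>i\<in>UNIV. cnj (A $ i $ j) * c $ i)"
      by (simp add: hinner_def sum_distrib_left ac_simps)
    finally show ?thesis .
  qed
  have "den z * (hinner (\<phi> z) c + b) = hinner z c' + (hinner B c + b * D)" if z: "z \<in> ball 0 1" for z
  proof -
    have "hinner (\<phi> z) c = inverse (den z) * (hinner (A *v z) c + hinner B c)"
      by (simp add: map_eq[OF z] den_def hinner_scale_left hinner_add_left distrib_left)
    then have "den z * (hinner (\<phi> z) c + b) = hinner (A *v z) c + hinner B c + b * den z"
      using den_nonzero[OF z] by (simp add: field_simps)
    then show ?thesis
      by (simp add: c'_def den_def adjoint hinner_add_right hinner_scale_right algebra_simps)
  qed
  then show ?thesis using that by blast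
qed

text \<open>By the cocycle identity this product is the denominator of \<open>\<phi>\<^sup>n\<close>.\<close>

definition iterate_den :: "nat \<Rightarrow> complex^'m \<Rightarrow> complex" where
  "iterate_den n z = (\<Prod>j<n. den ((\<phi> ^^ j) z))"

lemma iterate_in_ball: "z \<in> ball 0 1 \<Longrightarrow> (\<phi> ^^ n) z \<in> ball 0 1"
  using funpow_image_subset[OF self_map, of n] by blast

text \<open>Quantifying over all affine functions of \<open>\<phi>\<^sup>n z\<close>, and not only over the constant \<open>1\<close>, is what lets
  the induction close without composing matrices.\<close>

lemma iterate_den_affine:
  "\<exists>c' b'. \<forall>z\<in>ball 0 1. iterate_den n z * (hinner ((\<phi> ^^ n) z) c + b) = hinner z c' + b'"
proof (induction n arbitrary: c b)
  case 0
  show ?case by (auto simp: iterate_den_def)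
next
  case (Suc n)
  obtain c'' b'' where step: "\<And>z. z \<in> ball 0 1 \<Longrightarrow> den z * (hinner (\<phi> z) c + b) = hinner z c'' + b''"
    by (rule den_mult_affine) blast
  have "iterate_den (Suc n) z * (hinner ((\<phi> ^^ Suc n) z) c + b) =
      iterate_den n z * (hinner ((\<phi> ^^ n) z) c'' + b'')" if "z \<in> ball 0 1" for z
    using step[OF iterate_in_ball[OF that, of n]] by (simp add: iterate_den_def mult.assoc)
  then show ?case using Suc.IH[of c'' b''] by simp
qed

lemma iterate_den_bound:
  "positive_kernel (ball 0 1) (\<lambda>z w. of_real (4 * (cmod (iterate_den n 0))\<^sup>2) * drury_arveson z w
     - iterate_den n z * cnj (iterate_den n w) * drury_arveson z w)"
proof -
  obtain c b where cb: "\<And>z. z \<in> ball 0 1 \<Longrightarrow> iterate_den n z = hinner z c + b"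
    using iterate_den_affine[of n 0 1] by auto
  have "iterate_den n z \<noteq> 0" if "z \<in> ball 0 1" for z
    using that den_nonzero iterate_in_ball by (simp add: iterate_den_def)
  then have "norm c \<le> cmod b" using cb by (intro affine_coefficient_bound) metis
  from affine_multiplication_bounded[OF this] have "positive_kernel (ball 0 1)
     (\<lambda>z w. of_real (4 * (cmod b)\<^sup>2) * drury_arveson z w
          - (hinner z c + b) * cnj (hinner w c + b) * drury_arveson z w)" .
  then show ?thesis
    by (rule positive_kernel_congD) (simp add: cb)
qed

text \<open>The case \<open>t = 0\<close>. A semidefinite pullback form forces the lift of \<open>v\<close> to vanish as soon as its
  last coordinate does. Applied to the combination of two points of the ball whose denominators
  cancel, this shows that \<open>\<phi>\<close> is constant, and then its value is a fixed point.\<close>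

lemma elliptic_of_degenerate_form:
  assumes nonneg: "\<And>v. 0 \<le> Re (pullback_form v v)"
  shows "elliptic \<phi>"
proof -
  have const: "\<phi> z = \<phi> w" if z: "z \<in> ball 0 1" and w: "w \<in> ball 0 1" for z w
  proof -
    define v where "v = homogeneous_scale (den w) (homogenize z) - homogeneous_scale (den z) (homogenize w)"
    have "lift v = lift (homogeneous_scale (den w) (homogenize z)) - lift (homogeneous_scale (den z) (homogenize w))"
      unfolding v_def using lift_add[of "homogeneous_scale (den w) (homogenize z) - homogeneous_scale (den z) (homogenize w)"
          "homogeneous_scale (den z) (homogenize w)"] by simp
    also have "\<dots> = ((den z * den w) *s (\<phi> z - \<phi> w), 0)"
      unfolding lift_scale lift_homogenize[OF z] lift_homogenize[OF w]
      by (simp add: homogeneous_scale_def homogenize_def vector_smult_assoc mult.commute vector_sub_rdistrib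
          vec_eq_iff right_diff_distrib)
    finally have "pullback_form v v = - of_real ((norm ((den z * den w) *s (\<phi> z - \<phi> w)))\<^sup>2)"
      by (simp add: pullback_form_def lorentz_form_def hinner_self)
    then have "(norm ((den z * den w) *s (\<phi> z - \<phi> w)))\<^sup>2 \<le> 0" using nonneg[of v] by simp
    then have "(den z * den w) *s (\<phi> z - \<phi> w) = 0" by simp
    then show ?thesis using den_nonzero z w by (simp add: vec_eq_iff)
  qed
  have "\<phi> 0 \<in> ball 0 1" using self_map by force
  then have "\<phi> (\<phi> 0) = \<phi> 0" by (intro const) auto
  with \<open>\<phi> 0 \<in> ball 0 1\<close> show ?thesis unfolding elliptic_def by blast
qed

end

text \<open>A linear fractional self-map with a Denjoy-Wolff point, together with a decomposition as
  in \<open>krein_decomposition\<close> whose scalar is positive, as \<open>elliptic_of_degenerate_form\<close> ensures in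
  the absence of fixed points.\<close>

locale nonelliptic_linear_fractional = linear_fractional \<phi> A B C D
  for \<phi> :: "complex^'m \<Rightarrow> complex^'m" and A B C D +
  fixes \<zeta> :: "complex^'m" and t :: real
    and P :: "(complex^'m) \<times> complex \<Rightarrow> (complex^'m) \<times> complex \<Rightarrow> complex"
  assumes dw: "denjoy_wolff_point \<phi> \<zeta>"
    and t_pos: "0 < t"
    and P_hermitian: "hermitian_form homogeneous_scale P"
    and P_nonneg: "0 \<le> Re (P v v)"
    and decomposition: "pullback_form x y = of_real t * lorentz_form x y + P x y"
begin

abbreviation orbit :: "nat \<Rightarrow> complex^'m" where
  "orbit n \<equiv> (\<phi> ^^ n) 0"

lemma norm_dw: "norm \<zeta> = 1"
  using dw by (simp add: denjoy_wolff_point_def)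

lemma orbit_in_ball: "orbit n \<in> ball 0 1"
  by (rule iterate_in_ball) simp

lemma orbit_tendsto: "orbit \<longlonglongrightarrow> \<zeta>"
proof -
  have "uniform_limit {0} (\<lambda>n. \<phi> ^^ n) (\<lambda>_. \<zeta>) sequentially"
  proof -
    have "compact {0 :: complex^'m} \<and> {0 :: complex^'m} \<subseteq> ball 0 1" by simp
    then show ?thesis using dw unfolding denjoy_wolff_point_def by blast
  qed
  then show ?thesis by (rule tendsto_uniform_limitI) simp
qed

lemma tendsto_along_orbit:
  assumes "continuous_on UNIV h"
  shows "(\<lambda>n. h (orbit n)) \<longlonglongrightarrow> h \<zeta>"
  by (rule continuous_on_tendsto_compose[OF assms orbit_tendsto]) auto

text \<open>Along the orbit of \<open>0\<close> the pullback form is \<open>|d|\<^sup>2 (1 - |\<phi>|\<^sup>2)\<close>, and both the orbit and its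
  shift tend to \<open>\<zeta>\<close>.\<close>

lemma P_dw: "P (homogenize \<zeta>) (homogenize \<zeta>) = 0"
proof -
  have "(\<lambda>n. pullback_form (homogenize (orbit n)) (homogenize (orbit n)))
      \<longlonglongrightarrow> pullback_form (homogenize \<zeta>) (homogenize \<zeta>)"
    by (rule tendsto_along_orbit[OF continuous_on_pullback_form])
  moreover have "pullback_form (homogenize (orbit n)) (homogenize (orbit n)) =
      den (orbit n) * cnj (den (orbit n)) * (1 - hinner (orbit (Suc n)) (orbit (Suc n)))" for n
    by (simp add: pullback_form_homogenize[OF orbit_in_ball orbit_in_ball])
  moreover have "(\<lambda>n. den (orbit n) * cnj (den (orbit n)) * (1 - hinner (orbit (Suc n)) (orbit (Suc n))))
      \<longlonglongrightarrow> den \<zeta> * cnj (den \<zeta>) * (1 - hinner \<zeta> \<zeta>)"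
    by (intro tendsto_intros tendsto_along_orbit continuous_on_den
        LIMSEQ_Suc[OF tendsto_along_orbit[where h = "\<lambda>z. hinner z z"]] continuous_intros)
  ultimately have "pullback_form (homogenize \<zeta>) (homogenize \<zeta>) = den \<zeta> * cnj (den \<zeta>) * (1 - hinner \<zeta> \<zeta>)"
    using LIMSEQ_unique by simp
  then show ?thesis
    using decomposition[of "homogenize \<zeta>" "homogenize \<zeta>"]
    by (simp add: hinner_self norm_dw lorentz_form_homogenize)
qed

lemma P_dw_right: "P x (homogenize \<zeta>) = 0"
  by (rule form_isotropic_orthogonal[OF P_hermitian P_nonneg P_dw])

lemma pullback_dw: "pullback_form x (homogenize \<zeta>) = of_real t * lorentz_form x (homogenize \<zeta>)"
  by (simp add: decomposition P_dw_right)

lemma num_dw: "A *v \<zeta> + B = den \<zeta> *s \<zeta>"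
proof -
  have "(\<lambda>n. A *v orbit n + B) \<longlonglongrightarrow> A *v \<zeta> + B"
    by (rule tendsto_along_orbit[OF continuous_on_num])
  moreover have "A *v orbit n + B = den (orbit n) *s orbit (Suc n)" for n
    using den_nonzero[OF orbit_in_ball[of n]]
    by (simp add: map_eq[OF orbit_in_ball] den_def vector_smult_assoc)
  moreover have "(\<lambda>n. den (orbit n) *s orbit (Suc n)) \<longlonglongrightarrow> den \<zeta> *s \<zeta>"
    unfolding vector_scalar_mult_def
    by (intro tendsto_vec_lambda tendsto_mult tendsto_along_orbit[OF continuous_on_den]
        tendsto_vec_nth LIMSEQ_Suc[OF orbit_tendsto])
  ultimately show ?thesis using LIMSEQ_unique by simp
qed

lemma lift_dw: "lift (homogenize \<zeta>) = homogeneous_scale (den \<zeta>) (homogenize \<zeta>)"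
  by (simp add: lift_def homogenize_def homogeneous_scale_def num_dw) (simp add: den_def)

text \<open>If \<open>d(\<zeta>) = 0\<close>, the lift of \<open>\<zeta>\<close> vanishes and \<open>\<zeta>\<close> is in the kernel of the pullback form; being also
  in the kernel of \<open>P\<close>, it would be in the kernel of the Lorentz form, which is nondegenerate.\<close>

lemma den_dw_nonzero: "den \<zeta> \<noteq> 0"
proof
  assume "den \<zeta> = 0"
  then have "lift (homogenize \<zeta>) = 0"
    by (simp add: lift_dw homogeneous_scale_def prod_eq_iff)
  then have "pullback_form (homogenize 0) (homogenize \<zeta>) = 0"
    by (simp add: pullback_form_def lorentz_form_def)
  then show False using t_pos by (simp add: pullback_dw lorentz_form_homogenize)
qed

definition dilatation :: real where
  "dilatation = t / (cmod (den \<zeta>))\<^sup>2"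

lemma dilatation_pos: "0 < dilatation"
  using t_pos den_dw_nonzero by (simp add: dilatation_def)

text \<open>An exact form of Julia's lemma: the semidefinite part drops out because \<open>\<zeta>\<close> lies in its
  kernel.\<close>

lemma one_minus_hinner_image:
  assumes z: "z \<in> ball 0 1"
  shows "den z * cnj (den \<zeta>) * (1 - hinner (\<phi> z) \<zeta>) = of_real t * (1 - hinner z \<zeta>)"
  using pullback_dw[of "homogenize z"]
  by (simp add: pullback_form_def lift_homogenize[OF z] lift_dw lorentz_form_homogenize
      form_scale_left[OF hermitian_lorentz_form] form_scale_right[OF hermitian_lorentz_form] ac_simps)

lemma orbit_distance_bound:
  assumes "dilatation < \<rho>"
  obtains C' where "0 \<le> C'" "\<And>n. cmod (1 - hinner (orbit n) \<zeta>) \<le> C' * \<rho> ^ n"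
proof (rule geometric_bound_of_ratio_limit[OF _ _ assms])
  have nz: "1 - hinner (orbit n) \<zeta> \<noteq> 0" for n
    by (rule one_minus_hinner_nonzero[OF orbit_in_ball]) (simp add: norm_dw)
  then show "0 < cmod (1 - hinner (orbit n) \<zeta>)" for n by simp
  have "cmod (1 - hinner (orbit (Suc n)) \<zeta>) / cmod (1 - hinner (orbit n) \<zeta>) =
      t / (cmod (den (orbit n)) * cmod (den \<zeta>))" for n
  proof -
    have "cmod (den (orbit n)) * cmod (den \<zeta>) * cmod (1 - hinner (orbit (Suc n)) \<zeta>) =
        t * cmod (1 - hinner (orbit n) \<zeta>)"
      using arg_cong[OF one_minus_hinner_image[OF orbit_in_ball[of n]], of cmod] t_pos
      by (simp add: norm_mult)
    then show ?thesis
      using nz[of n] den_dw_nonzero den_nonzero[OF orbit_in_ball[of n]]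
      by (simp add: field_simps)
  qed
  moreover have "(\<lambda>n. t / (cmod (den (orbit n)) * cmod (den \<zeta>))) \<longlonglongrightarrow> t / (cmod (den \<zeta>) * cmod (den \<zeta>))"
    by (intro tendsto_intros tendsto_along_orbit continuous_on_den) (use den_dw_nonzero in simp)
  ultimately show "(\<lambda>n. cmod (1 - hinner (orbit (Suc n)) \<zeta>) / cmod (1 - hinner (orbit n) \<zeta>)) \<longlonglongrightarrow> dilatation"
    by (simp add: dilatation_def power2_eq_square)
  show "0 < \<rho>" using assms dilatation_pos by linarith
qed (use that in blast)

text \<open>The difference equals \<open>k (k \<circ> \<phi>) P\<close>.\<close>

lemma one_step_kernel_bound:
  "positive_kernel (ball 0 1) (\<lambda>z w. den z * cnj (den w) * drury_arveson z w
     - of_real t * drury_arveson (\<phi> z) (\<phi> w))"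
proof -
  let ?P = "\<lambda>z w. P (homogenize z) (homogenize w)"
  have cancel: "k * (K * (d * a - t' * x)) = d * k - t' * K"
    if "a * K = 1" "x * k = 1" for a k x d K t' :: complex
    using that by algebra
  have "positive_kernel (ball 0 1) (\<lambda>z w. drury_arveson z w * (drury_arveson (\<phi> z) (\<phi> w) * ?P z w))"
    by (intro schur_multiplierD[OF schur_multiplier_drury_arveson_ball]
        schur_multiplierD[OF schur_multiplier_composed] positive_kernel_of_form[OF P_hermitian P_nonneg])
  then show ?thesis
  proof (rule positive_kernel_congD)
    fix z w :: "complex^'m" assume z: "z \<in> ball 0 1" and w: "w \<in> ball 0 1"
    have \<phi>: "\<phi> z \<in> ball 0 1" "\<phi> w \<in> ball 0 1" using self_map z w by blast+
    have nz: "1 - hinner z w \<noteq> 0" "1 - hinner (\<phi> z) (\<phi> w) \<noteq> 0"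
      using one_minus_hinner_nonzero[OF z, of w] one_minus_hinner_nonzero[OF \<phi>(1), of "\<phi> w"] w \<phi> by simp_all
    have P: "?P z w = den z * cnj (den w) * (1 - hinner (\<phi> z) (\<phi> w)) - of_real t * (1 - hinner z w)"
      using decomposition[of "homogenize z" "homogenize w"]
      by (simp add: pullback_form_homogenize[OF z w] lorentz_form_homogenize)
    show "drury_arveson z w * (drury_arveson (\<phi> z) (\<phi> w) * ?P z w) =
        den z * cnj (den w) * drury_arveson z w - of_real t * drury_arveson (\<phi> z) (\<phi> w)"
      unfolding P by (rule cancel) (use nz in simp_all)
  qed
qed

lemma iterate_kernel_bound:
  "positive_kernel (ball 0 1) (\<lambda>z w. iterate_den n z * cnj (iterate_den n w) * drury_arveson z w
     - of_real (t ^ n) * drury_arveson ((\<phi> ^^ n) z) ((\<phi> ^^ n) w))"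
proof (induction n)
  case 0
  then show ?case by (simp add: iterate_den_def positive_kernel_zero)
next
  case (Suc n)
  let ?d = "\<lambda>z. den ((\<phi> ^^ n) z)"
  let ?k = "\<lambda>n z w. drury_arveson ((\<phi> ^^ n) z) ((\<phi> ^^ n) w)"
  have "positive_kernel (ball 0 1) (\<lambda>z w.
      ?d z * cnj (?d w) * (iterate_den n z * cnj (iterate_den n w) * drury_arveson z w - of_real (t ^ n) * ?k n z w) +
      of_real (t ^ n) * (?d z * cnj (?d w) * ?k n z w
        - of_real t * drury_arveson (\<phi> ((\<phi> ^^ n) z)) (\<phi> ((\<phi> ^^ n) w))))"
    using t_pos
    by (intro positive_kernel_add positive_kernel_scale positive_kernel_rank_one_mult[OF Suc]
        positive_kernel_compose[OF one_step_kernel_bound funpow_image_subset[OF self_map]]) simp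
  then show ?case
    by (rule positive_kernel_congD) (simp add: iterate_den_def algebra_simps)
qed

lemma iterate_bound:
  "positive_kernel (ball 0 1) (\<lambda>z w. of_real (4 * (cmod (iterate_den n 0))\<^sup>2 / t ^ n) * drury_arveson z w
     - drury_arveson ((\<phi> ^^ n) z) ((\<phi> ^^ n) w))"
proof -
  have "positive_kernel (ball 0 1) (\<lambda>z w. of_real (1 / t ^ n) *
     ((of_real (4 * (cmod (iterate_den n 0))\<^sup>2) * drury_arveson z w
     - iterate_den n z * cnj (iterate_den n w) * drury_arveson z w) +
     (iterate_den n z * cnj (iterate_den n w) * drury_arveson z w
     - of_real (t ^ n) * drury_arveson ((\<phi> ^^ n) z) ((\<phi> ^^ n) w))))"
    using t_pos by (intro positive_kernel_scale positive_kernel_add iterate_den_bound iterate_kernel_bound) simp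
  then show ?thesis
    by (rule positive_kernel_congD) (use t_pos in \<open>simp add: field_simps\<close>)
qed

text \<open>Passing from \<open>n\<close> to \<open>n + 1\<close> multiplies the bound by \<open>|d(\<phi>\<^sup>n(0))|\<^sup>2 / t\<close>, which tends to
  \<open>|d(\<zeta>)|\<^sup>2 / t\<close>.\<close>

lemma iterate_bound_growth:
  assumes "1 / dilatation < \<rho>"
  obtains C' where "0 \<le> C'" "\<And>n. 4 * (cmod (iterate_den n 0))\<^sup>2 / t ^ n \<le> C' * \<rho> ^ n"
proof (rule geometric_bound_of_ratio_limit[OF _ _ assms])
  have nz: "iterate_den n 0 \<noteq> 0" for n
    using den_nonzero[OF orbit_in_ball] by (simp add: iterate_den_def)
  then show "0 < 4 * (cmod (iterate_den n 0))\<^sup>2 / t ^ n" for n using t_pos by simp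
  have "4 * (cmod (iterate_den (Suc n) 0))\<^sup>2 / t ^ Suc n / (4 * (cmod (iterate_den n 0))\<^sup>2 / t ^ n) =
      (cmod (den (orbit n)))\<^sup>2 / t" for n
  proof -
    have "iterate_den (Suc n) 0 = iterate_den n 0 * den (orbit n)" by (simp add: iterate_den_def)
    then show ?thesis using nz[of n] t_pos by (simp add: norm_mult power_mult_distrib)
  qed
  moreover have "(\<lambda>n. (cmod (den (orbit n)))\<^sup>2 / t) \<longlonglongrightarrow> (cmod (den \<zeta>))\<^sup>2 / t"
    by (intro tendsto_intros tendsto_along_orbit continuous_on_den) (use t_pos in simp)
  ultimately show "(\<lambda>n. 4 * (cmod (iterate_den (Suc n) 0))\<^sup>2 / t ^ Suc n / (4 * (cmod (iterate_den n 0))\<^sup>2 / t ^ n))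
      \<longlonglongrightarrow> 1 / dilatation"
    by (simp add: dilatation_def)
  show "0 < \<rho>" using assms dilatation_pos by (meson less_trans zero_less_divide_1_iff)
qed (use that in blast)

lemma dilatation_quotient:
  assumes z: "z \<in> ball 0 1"
  shows "(1 - (norm (\<phi> z))\<^sup>2) / (1 - (norm z)\<^sup>2) =
    (t + Re (P (homogenize z) (homogenize z)) / (1 - (norm z)\<^sup>2)) / (cmod (den z))\<^sup>2"
proof -
  have "of_real ((cmod (den z))\<^sup>2 * (1 - (norm (\<phi> z))\<^sup>2)) = (den z * cnj (den z)) * (1 - hinner (\<phi> z) (\<phi> z))"
    by (simp only: complex_norm_square[symmetric] hinner_self of_real_mult of_real_diff of_real_1)
  also have "\<dots> = of_real (t * (1 - (norm z)\<^sup>2)) + P (homogenize z) (homogenize z)"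
    using decomposition[of "homogenize z" "homogenize z"]
    by (simp add: pullback_form_homogenize[OF z z] lorentz_form_homogenize_self)
  finally have "Re (of_real ((cmod (den z))\<^sup>2 * (1 - (norm (\<phi> z))\<^sup>2))) =
      Re (of_real (t * (1 - (norm z)\<^sup>2)) + P (homogenize z) (homogenize z))" by simp
  then have "(cmod (den z))\<^sup>2 * (1 - (norm (\<phi> z))\<^sup>2) = t * (1 - (norm z)\<^sup>2) + Re (P (homogenize z) (homogenize z))"
    by (simp only: Re_complex_of_real plus_complex.simps)
  moreover have "1 - (norm z)\<^sup>2 \<noteq> 0" "cmod (den z) \<noteq> 0"
    using z den_nonzero[OF z] abs_square_less_1[of "norm z"] by auto
  moreover have "v / u = (t + p / u) / d" if "d * v = t * u + p" "u \<noteq> 0" "d \<noteq> 0" for u v p d :: real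
    using that by (simp add: field_simps)
  ultimately show ?thesis by simp
qed

text \<open>The quotient is \<open>(t + P / (1 - |z|\<^sup>2)) / |d(z)|\<^sup>2\<close>. Dropping \<open>P\<close> bounds it from below. Along the
  radius to \<open>\<zeta>\<close> the form \<open>P\<close> is quadratic in \<open>1 - r\<close>, because \<open>\<zeta>\<close> lies in its kernel, whereas
  \<open>1 - |z|\<^sup>2\<close> is only linear; so the lower bound is attained in the limit.\<close>

lemma Liminf_dilatation:
  "Liminf (at \<zeta> within ball 0 1) (\<lambda>z. ereal ((1 - (norm (\<phi> z))\<^sup>2) / (1 - (norm z)\<^sup>2))) = ereal dilatation"
proof (rule antisym)
  let ?F = "at \<zeta> within ball 0 1"
  let ?q = "\<lambda>z. (1 - (norm (\<phi> z))\<^sup>2) / (1 - (norm z)\<^sup>2)"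
  have in_ball: "\<forall>\<^sub>F z in ?F. z \<in> ball 0 1" by (simp add: eventually_at_filter)
  define r where "r = (\<lambda>n::nat. 1 - inverse (real (Suc n)))"
  define x where "x = (\<lambda>n. of_real (r n) *s \<zeta>)"
  have r: "0 \<le> r n" "r n < 1" for n by (auto simp: r_def inverse_le_1_iff)
  have r_lim: "r \<longlonglongrightarrow> 1"
    unfolding r_def using tendsto_diff[OF tendsto_const LIMSEQ_inverse_real_of_nat, of 1] by simp
  have norm_x: "norm (x n) = r n" for n
  proof -
    have "of_real ((norm (x n))\<^sup>2) = complex_of_real ((r n)\<^sup>2)"
      using hinner_self[of "x n", symmetric] hinner_self[of \<zeta>]
      by (simp add: x_def hinner_scale_left hinner_scale_right norm_dw power2_eq_square)
    then show ?thesis using r(1)[of n] by (simp only: of_real_eq_iff power2_eq_iff_nonneg norm_ge_zero)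
  qed
  have x_ball: "x n \<in> ball 0 1" for n using norm_x r by simp
  have x_lim: "x \<longlonglongrightarrow> \<zeta>"
  proof -
    have "x \<longlonglongrightarrow> of_real 1 *s \<zeta>"
      unfolding x_def vector_scalar_mult_def by (intro tendsto_vec_lambda tendsto_intros r_lim)
    then show ?thesis by simp
  qed
  have x_filter: "filterlim x ?F sequentially"
    unfolding filterlim_at using x_lim x_ball norm_x norm_dw r
    by (auto intro!: always_eventually) (metis less_irrefl)
  \<comment> \<open>the lift of \<open>r \<zeta>\<close> is that of \<open>\<zeta>\<close> minus \<open>(1 - r) \<zeta>'\<close>\<close>
  define \<zeta>' where "\<zeta>' = (\<zeta>, 0 :: complex)"
  have P_x: "Re (P (homogenize (x n)) (homogenize (x n))) = (1 - r n)\<^sup>2 * Re (P \<zeta>' \<zeta>')" for n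
  proof -
    have "homogenize (x n) = homogenize \<zeta> - homogeneous_scale (of_real (1 - r n)) \<zeta>'"
      by (simp add: homogenize_def x_def homogeneous_scale_def \<zeta>'_def vector_sub_rdistrib vec_eq_iff algebra_simps)
    then show ?thesis
      using form_commute[OF P_hermitian, of "homogenize \<zeta>" \<zeta>']
      by (simp add: form_diff_left[OF P_hermitian] form_diff_right[OF P_hermitian] P_dw P_dw_right
          form_scale_left[OF P_hermitian] form_scale_right[OF P_hermitian] power2_eq_square
          del: of_real_diff)
  qed
  have "(\<lambda>n. ?q (x n)) \<longlonglongrightarrow> dilatation"
  proof -
    have "?q (x n) = (t + (1 - r n) / (1 + r n) * Re (P \<zeta>' \<zeta>')) / (cmod (den (x n)))\<^sup>2" for n
    proof -
      have "1 - (r n)\<^sup>2 = (1 - r n) * (1 + r n)" by (simp add: power2_eq_square algebra_simps)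
      then have "(1 - r n)\<^sup>2 * Re (P \<zeta>' \<zeta>') / (1 - (r n)\<^sup>2) = (1 - r n) / (1 + r n) * Re (P \<zeta>' \<zeta>')"
        using r[of n] by (simp add: power2_eq_square)
      then show ?thesis using dilatation_quotient[OF x_ball, of n] by (simp add: P_x norm_x)
    qed
    moreover have "(\<lambda>n. (t + (1 - r n) / (1 + r n) * Re (P \<zeta>' \<zeta>')) / (cmod (den (x n)))\<^sup>2) \<longlonglongrightarrow>
        (t + (1 - 1) / (1 + 1) * Re (P \<zeta>' \<zeta>')) / (cmod (den \<zeta>))\<^sup>2"
      using den_dw_nonzero
      by (intro tendsto_intros r_lim continuous_on_tendsto_compose[OF continuous_on_den[of UNIV] x_lim]) auto
    ultimately show ?thesis by (simp add: dilatation_def)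
  qed
  then have q_lim: "(\<lambda>n. ereal (?q (x n))) \<longlonglongrightarrow> ereal dilatation" by simp
  show "Liminf ?F (\<lambda>z. ereal (?q z)) \<le> ereal dilatation"
  proof (rule ccontr)
    assume "\<not> ?thesis"
    then have "ereal dilatation < Liminf ?F (\<lambda>z. ereal (?q z))" by (simp only: not_le)
    from dense[OF this] obtain y where y: "ereal dilatation < y" "y < Liminf ?F (\<lambda>z. ereal (?q z))"
      by blast
    then have "\<forall>\<^sub>F z in ?F. y < ereal (?q z)" by (intro less_LiminfD)
    then have "\<forall>\<^sub>F n in sequentially. y < ereal (?q (x n))"
      using x_filter by (rule eventually_compose_filterlim)
    moreover have "\<forall>\<^sub>F n in sequentially. ereal (?q (x n)) < y" by (rule order_tendstoD(2)[OF q_lim y(1)])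
    ultimately have "\<forall>\<^sub>F n :: nat in sequentially. False"
      by eventually_elim auto
    then show False by simp
  qed
  have nontrivial: "?F \<noteq> bot"
    by (simp add: trivial_limit_within islimpt_ball norm_dw)
  have lim: "((\<lambda>z. ereal (t / (cmod (den z))\<^sup>2)) \<longlongrightarrow> ereal dilatation) ?F"
    unfolding dilatation_def lim_ereal
    using den_dw_nonzero continuous_on_den[of UNIV]
    by (intro tendsto_intros) (auto simp: continuous_on_def intro: tendsto_within_subset)
  have "ereal dilatation = Liminf ?F (\<lambda>z. ereal (t / (cmod (den z))\<^sup>2))"
    by (rule lim_imp_Liminf[OF nontrivial lim, symmetric])
  also have "\<dots> \<le> Liminf ?F (\<lambda>z. ereal (?q z))"
  proof (rule Liminf_mono)
    show "\<forall>\<^sub>F z in ?F. ereal (t / (cmod (den z))\<^sup>2) \<le> ereal (?q z)"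
      using in_ball
    proof eventually_elim
      case (elim z)
      have "1 - (norm z)\<^sup>2 \<ge> 0" using elim by (simp add: power_le_one)
      then show ?case
        unfolding dilatation_quotient[OF elim] using P_nonneg
        by (simp add: divide_right_mono)
    qed
  qed
  finally show "ereal dilatation \<le> Liminf ?F (\<lambda>z. ereal (?q z))" .
qed

end

section \<open>The spectral radius\<close>

context nonelliptic_linear_fractional
begin

lemma composition_operator_is_bounded:
  assumes H2: "H2_space \<beta> H ip"
  shows "bounded_operator_on H ip (composition_operator \<phi>)"
proof -
  have "\<phi> ^^ 1 = \<phi>" by simp
  from composition_operator_bounded[OF H2 self_map _ iterate_bound[of 1, unfolded this]]
  show ?thesis using t_pos by simp
qed

lemma spectrum_le:
  assumes H2: "H2_space \<beta> H ip" and \<mu>: "\<mu> \<in> operator_spectrum H ip (composition_operator \<phi>)"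
  shows "cmod \<mu> \<le> sqrt (1 / dilatation) ^ \<beta>"
proof (rule LIMSEQ_le_const)
  show "(\<lambda>n. sqrt (1 / dilatation + inverse (real (Suc n))) ^ \<beta>) \<longlonglongrightarrow> sqrt (1 / dilatation) ^ \<beta>"
  proof -
    have "(\<lambda>n. sqrt (1 / dilatation + inverse (real (Suc n))) ^ \<beta>)
        \<longlonglongrightarrow> sqrt (1 / dilatation + 0) ^ \<beta>"
      by (intro tendsto_power tendsto_real_sqrt tendsto_add tendsto_const LIMSEQ_inverse_real_of_nat)
    then show ?thesis by simp
  qed
  have "cmod \<mu> \<le> sqrt \<rho> ^ \<beta>" if \<rho>: "1 / dilatation < \<rho>" for \<rho>
  proof -
    obtain C' where "\<And>n. 4 * (cmod (iterate_den n 0))\<^sup>2 / t ^ n \<le> C' * \<rho> ^ n"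
      using iterate_bound_growth[OF \<rho>] by blast
    moreover have "0 \<le> \<rho>" using \<rho> dilatation_pos by (meson less_imp_le less_trans zero_less_divide_1_iff)
    ultimately show ?thesis
      using t_pos by (intro composition_operator_spectrum_bound[OF H2 self_map _ _ _ iterate_bound \<mu>]) auto
  qed
  then show "\<exists>N. \<forall>n\<ge>N. cmod \<mu> \<le> sqrt (1 / dilatation + inverse (real (Suc n))) ^ \<beta>"
    by simp
qed

text \<open>The orbit of \<open>0\<close> satisfies \<open>1 - |\<phi>\<^sup>n(0)|\<^sup>2 \<le> 2 |1 - \<langle>\<phi>\<^sup>n(0), \<zeta>\<rangle>|\<close>, which decays almost like \<open>\<alpha>\<^sup>n\<close>. A
  smaller spectrum would make the norms of the kernel functions along the orbit grow too slowly.\<close>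

lemma spectrum_exceeds:
  assumes H2: "H2_space \<beta> H ip" and r: "0 < r\<^sub>1" "r\<^sub>1 < sqrt (1 / dilatation) ^ \<beta>"
  shows "\<exists>\<mu>\<in>operator_spectrum H ip (composition_operator \<phi>). r\<^sub>1 < cmod \<mu>"
proof (rule ccontr)
  assume "\<not> ?thesis"
  then have spec: "cmod \<mu> \<le> r\<^sub>1" if "\<mu> \<in> operator_spectrum H ip (composition_operator \<phi>)" for \<mu>
    using that by (meson not_le)
  obtain r where r': "r\<^sub>1 < r" "r < sqrt (1 / dilatation) ^ \<beta>" using dense[OF r(2)] by blast
  obtain K where K: "0 \<le> K" "\<And>n. 1 \<le> K * r ^ n * sqrt (1 - (norm (orbit n))\<^sup>2) ^ \<beta>"
    using orbit_growth_of_spectrum_bound[OF H2 self_map composition_operator_is_bounded[OF H2] spec r(1) r'(1)]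
    by blast
  have "r * sqrt dilatation ^ \<beta> < sqrt (1 / dilatation) ^ \<beta> * sqrt dilatation ^ \<beta>"
    using r'(2) dilatation_pos by (intro mult_strict_right_mono) auto
  also have "\<dots> = 1" using dilatation_pos by (simp flip: power_mult_distrib real_sqrt_mult)
  finally have "r * sqrt dilatation ^ \<beta> < 1" .
  moreover have "(\<lambda>n. r * sqrt (dilatation + inverse (real (Suc n))) ^ \<beta>) \<longlonglongrightarrow> r * sqrt dilatation ^ \<beta>"
  proof -
    have "(\<lambda>n. r * sqrt (dilatation + inverse (real (Suc n))) ^ \<beta>)
        \<longlonglongrightarrow> r * sqrt (dilatation + 0) ^ \<beta>"
      by (intro tendsto_mult tendsto_power tendsto_real_sqrt tendsto_add tendsto_const
          LIMSEQ_inverse_real_of_nat)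
    then show ?thesis by simp
  qed
  ultimately have "\<forall>\<^sub>F n in sequentially. r * sqrt (dilatation + inverse (real (Suc n))) ^ \<beta> < 1"
    by (intro order_tendstoD(2))
  then obtain n where n: "r * sqrt (dilatation + inverse (real (Suc n))) ^ \<beta> < 1"
    using eventually_happens'[OF sequentially_bot] by blast
  define \<rho> where "\<rho> = dilatation + inverse (real (Suc n))"
  have \<rho>: "dilatation < \<rho>" "0 < \<rho>" using dilatation_pos by (auto simp: \<rho>_def add_pos_pos)
  obtain C' where C': "0 \<le> C'" "\<And>n. cmod (1 - hinner (orbit n) \<zeta>) \<le> C' * \<rho> ^ n"
    by (rule orbit_distance_bound[OF \<rho>(1)]) blast
  have bound: "1 \<le> K * sqrt (2 * C') ^ \<beta> * (r * sqrt \<rho> ^ \<beta>) ^ n" for n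
  proof -
    have le1: "norm (orbit n) < 1" using orbit_in_ball by simp
    have "1 - (norm (orbit n))\<^sup>2 = (1 - norm (orbit n)) * (1 + norm (orbit n))"
      by (simp add: power2_eq_square algebra_simps)
    also have "\<dots> \<le> (1 - norm (orbit n)) * 2" using le1 by (intro mult_left_mono) auto
    also have "\<dots> \<le> cmod (1 - hinner (orbit n) \<zeta>) * 2"
      using norm_hinner_le[of "orbit n" \<zeta>] norm_triangle_ineq2[of 1 "hinner (orbit n) \<zeta>"]
      by (simp add: norm_dw)
    also have "\<dots> \<le> 2 * C' * \<rho> ^ n" using C'(2)[of n] by simp
    finally have "sqrt (1 - (norm (orbit n))\<^sup>2) ^ \<beta> \<le> sqrt (2 * C' * \<rho> ^ n) ^ \<beta>"
      using le1 by (intro power_mono) (auto simp: power_le_one)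
    then have "K * r ^ n * sqrt (1 - (norm (orbit n))\<^sup>2) ^ \<beta> \<le> K * r ^ n * sqrt (2 * C' * \<rho> ^ n) ^ \<beta>"
      using K(1) r(1) r'(1) by (intro mult_left_mono) auto
    also have "\<dots> = K * sqrt (2 * C') ^ \<beta> * (r * sqrt \<rho> ^ \<beta>) ^ n"
      by (simp add: real_sqrt_mult real_sqrt_power power_mult_distrib power_mult[symmetric] mult.commute[of \<beta>])
    finally show ?thesis using K(2)[of n] by linarith
  qed
  have "(\<lambda>n. K * sqrt (2 * C') ^ \<beta> * (r * sqrt \<rho> ^ \<beta>) ^ n) \<longlonglongrightarrow> 0"
    using n r(1) r'(1) \<rho>(2) unfolding \<rho>_def[symmetric]
    by (intro tendsto_mult_right_zero LIMSEQ_realpow_zero) auto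
  then have "1 \<le> (0::real)" by (rule LIMSEQ_le_const) (use bound in blast)
  then show False by simp
qed

lemma spectral_radius:
  assumes H2: "H2_space \<beta> H ip"
  shows "operator_spectral_radius H ip (composition_operator \<phi>) = ereal (dilatation powr (- (real \<beta> / 2)))"
proof -
  let ?S = "operator_spectrum H ip (composition_operator \<phi>)"
  let ?R = "sqrt (1 / dilatation) ^ \<beta>"
  have R: "0 < ?R" using dilatation_pos by simp
  have "(SUP \<mu>\<in>?S. ereal (cmod \<mu>)) = ereal ?R"
  proof (rule antisym)
    show "(SUP \<mu>\<in>?S. ereal (cmod \<mu>)) \<le> ereal ?R"
      by (rule SUP_least) (use spectrum_le[OF H2] in simp)
    show "ereal ?R \<le> (SUP \<mu>\<in>?S. ereal (cmod \<mu>))"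
    proof (rule dense_le_bounded)
      show "0 < ereal ?R" using R by simp
      fix w :: ereal assume w: "0 < w" "w < ereal ?R"
      then obtain r where r: "w = ereal r" by (cases w) auto
      then obtain \<mu> where "\<mu> \<in> ?S" "r < cmod \<mu>"
        using spectrum_exceeds[OF H2, of r] w by auto
      then show "w \<le> (SUP \<mu>\<in>?S. ereal (cmod \<mu>))"
        unfolding r by (intro SUP_upper2[of \<mu>]) auto
    qed
  qed
  also have "?R = dilatation powr (- (real \<beta> / 2))"
  proof -
    have sqrt_eq: "sqrt (1 / dilatation) = (dilatation powr - 1) powr (1 / 2)"
      using dilatation_pos by (subst powr_half_sqrt) (simp_all add: powr_neg_one)
    have "?R = sqrt (1 / dilatation) powr real \<beta>"
      using dilatation_pos by (intro powr_realpow[symmetric]) simp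
    also have "\<dots> = dilatation powr (- (real \<beta> / 2))"
      unfolding sqrt_eq powr_powr by simp
    finally show ?thesis .
  qed
  finally show ?thesis unfolding operator_spectral_radius_def .
qed

end

theorem theorem3p8:
  fixes \<phi> :: "complex^'m \<Rightarrow> complex^'m"
    and \<beta> :: nat
    and H :: "(complex^'m \<Rightarrow> complex) set"
    and ip :: "(complex^'m \<Rightarrow> complex) \<Rightarrow> (complex^'m \<Rightarrow> complex) \<Rightarrow> complex"
  assumes "\<beta> > 0"
    and "linear_fractional_self_map \<phi>"
    and "H2_space \<beta> H ip"
  shows "(elliptic \<phi> \<longrightarrow>
            operator_spectral_radius H ip (composition_operator \<phi>) = 1) \<and>
         (\<forall>\<alpha>. \<not> elliptic \<phi> \<and> dilatation_coefficient \<phi> \<alpha> \<longrightarrow>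
            operator_spectral_radius H ip (composition_operator \<phi>)
              = ereal (\<alpha> powr (- (real \<beta> / 2))))"
proof (intro conjI impI allI)
  note H2 = assms(3)
  obtain A B C D where "linear_fractional \<phi> A B C D"
    using assms(2) unfolding linear_fractional_self_map_def linear_fractional_def by blast
  then interpret linear_fractional \<phi> A B C D .
  let ?T = "composition_operator \<phi>"
  show "operator_spectral_radius H ip ?T = 1" if ell: "elliptic \<phi>"
  proof -
    obtain p where p: "p \<in> ball 0 1" "\<phi> p = p" using ell unfolding elliptic_def by blast
    obtain M where M: "0 \<le> M" "\<And>n. positive_kernel (ball 0 1)
        (\<lambda>z w. of_real M * drury_arveson z w - drury_arveson ((\<phi> ^^ n) z) ((\<phi> ^^ n) w))"
      by (rule elliptic_iterate_bound[OF p]) blast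
    interpret hilbert_function_space H ip by (rule H2_spaceD(1)[OF H2])
    have bdd: "bounded_operator_on H ip ?T"
      using composition_operator_bounded[OF H2 self_map M(1)] M(2)[of 1] by simp
    have zero: "(0 :: complex^'m) \<in> ball 0 1" by simp
    let ?one = "kernel_section \<beta> 0 :: complex^'m \<Rightarrow> complex"
    have one: "?one = on_ball (\<lambda>_. 1)" by (simp add: kernel_section_def ball_kernel_def on_ball_def)
    have "?T ?one = (\<lambda>z. 1 * ?one z)"
    proof -
      have "\<phi> z \<in> ball 0 1" if "z \<in> ball 0 1" for z using self_map that by blast
      then show ?thesis
        by (simp add: one composition_operator_def on_ball_def fun_eq_iff del: mem_ball mem_ball_0)
    qed
    moreover have "?one \<noteq> (\<lambda>_. 0)"
      unfolding one on_ball_def using zero by (metis zero_neq_one)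
    ultimately have "1 \<in> operator_spectrum H ip ?T"
      by (intro eigenvalue_in_operator_spectrum[OF bdd H2_spaceD(3)[OF H2 zero]])
    then have "1 \<le> operator_spectral_radius H ip ?T"
      unfolding operator_spectral_radius_def by (rule SUP_upper2) simp
    moreover have "operator_spectral_radius H ip ?T \<le> 1"
      unfolding operator_spectral_radius_def
    proof (rule SUP_least)
      fix \<mu> assume "\<mu> \<in> operator_spectrum H ip ?T"
      then have "cmod \<mu> \<le> sqrt 1 ^ \<beta>"
        using M by (intro composition_operator_spectrum_bound[OF H2 self_map, where M = "\<lambda>_. M" and C = M]) auto
      then show "ereal (cmod \<mu>) \<le> 1" by simp
    qed
    ultimately show ?thesis by (rule antisym[rotated])
  qed
  show "operator_spectral_radius H ip ?T = ereal (\<alpha> powr (- (real \<beta> / 2)))"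
    if nonell: "\<not> elliptic \<phi> \<and> dilatation_coefficient \<phi> \<alpha>" for \<alpha>
  proof -
    obtain \<zeta> where \<zeta>: "denjoy_wolff_point \<phi> \<zeta>" "ereal \<alpha> = Liminf (at \<zeta> within ball 0 1)
        (\<lambda>z. ereal ((1 - (norm (\<phi> z))\<^sup>2) / (1 - (norm z)\<^sup>2)))"
      using nonell unfolding dilatation_coefficient_def by blast
    obtain t P where tP: "0 \<le> t" "hermitian_form homogeneous_scale P" "\<And>v. 0 \<le> Re (P v v)"
        "\<And>x y. pullback_form x y = of_real t * lorentz_form x y + P x y"
      by (rule krein_decomposition) blast
    have "t \<noteq> 0" using elliptic_of_degenerate_form tP(3,4) nonell by auto
    then interpret nonelliptic_linear_fractional \<phi> A B C D \<zeta> t P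
      using tP \<zeta>(1) by unfold_locales auto
    have "\<alpha> = dilatation" using \<zeta>(2) Liminf_dilatation by simp
    then show ?thesis using spectral_radius[OF H2] by simp
  qed
qed

end
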